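(* Let $G$ be a finitely generated group which is not recursively presented. There exist a finite alphabet $A$ and a $(G\times\mathbb Z)$-effectively closed subshift $X\subset A^{G\times\mathbb Z}$ such that its $\mathbb Z$-projective subdynamics $\pi_{\mathbb Z}(X)\subset A^{\mathbb Z}$ is not $\mathbb Z$-effectively closed.
   Context: Let $K$ be a finitely generated group with finite generating set $S$ closed under inverses and containing $1_K$; words in $S^*$ represent elements of $K$, and $\mathtt{WP}(K)$ is the set of words in $S^*$ representing $1_K$. $K$ is recursively presented if it has a presentation $\langle S\mid R\rangle$ with $S$ finite and $R\subset S^*$ recursively enumerable. For a finite alphabet $A$, $A^K$ has the product topology and left shift action $(\sigma_g x)_h=x_{g^{-1}h}$; a subshift is a closed shift-invariant subset. Put $[a]_g=\{x\in A^K:x_g=a\}$. A pattern coding over $A$ is a finite set $c$ of pairs $(w,a)$ with $w\in S^*$, $a\in A$. For a set $\mathcal C$ of pattern codings, $X_{\mathcal C}=\bigcap_{g\in K,\,c\in\mathcal C}\big(A^K\setminus\bigcap_{(w,a)\in c}[a]_{gw}\big)$. $X\subset A^K$ is $K$-effectively closed if $X=X_{\mathcal C}$ for some set $\mathcal C$ of pattern codings over $A$ that is recursively enumerable by a Turing machine with oracle $\mathtt{WP}(K)$. For $X\subset A^{G\times\mathbb Z}$, $\pi_{\mathbb Z}(X)=\{x\in A^{\mathbb Z}:\exists y\in X,\ \forall n\in\mathbb Z,\ x_n=y_{(1_G,n)}\}$. *)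

theory Defs
  imports
    "HOL-Algebra.Elementary_Groups"
    "HOL-Analysis.Product_Topology"
begin

section \<open>Oracle Turing machines\<close>

text \<open>
  Deterministic Turing machines with finitely many two-way infinite tapes. Tape 0 carries the
  input and tape 1 is the oracle tape. States and tape symbols are initial segments of the natural
  numbers; tape symbol 0 is the blank and the letter \<open>i\<close> of a word is written as tape symbol
  \<open>Suc i\<close>. Words are read off the tapes from cell 0 rightwards up to the first blank.
\<close>

datatype move = Go_Left | Stay | Go_Right

record otm =
  n_tapes :: nat
  n_letters :: nat
  n_symbols :: nat
  n_states :: nat
  start_state :: nat
  halt_state :: nat
  query_state :: nat
  yes_state :: nat
  no_state :: nat
  trans_fun :: "nat \<Rightarrow> nat list \<Rightarrow> nat \<times> (nat \<times> move) list"

text \<open>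
  The last clause makes the relevant part of the transition function a finite table: the machine
  never leaves its finite sets of states and symbols.
\<close>

definition wf_otm :: "otm \<Rightarrow> bool" where
  "wf_otm M \<longleftrightarrow>
     2 \<le> n_tapes M \<and> n_letters M < n_symbols M \<and>
     {start_state M, halt_state M, query_state M, yes_state M, no_state M} \<subseteq> {..<n_states M} \<and>
     (\<forall>q < n_states M. \<forall>rs. length rs = n_tapes M \<and> set rs \<subseteq> {..<n_symbols M} \<longrightarrow>
        (case trans_fun M q rs of (q', acts) \<Rightarrow>
           q' < n_states M \<and> length acts = n_tapes M \<and> fst ` set acts \<subseteq> {..<n_symbols M}))"

type_synonym tape = "(int \<Rightarrow> nat) \<times> int"  \<comment> \<open>cell contents and head position\<close>
type_synonym otm_config = "nat \<times> tape list"

definition tape_of_word :: "nat list \<Rightarrow> int \<Rightarrow> nat" where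
  "tape_of_word w p = (if 0 \<le> p \<and> p < int (length w) then Suc (w ! nat p) else 0)"

definition holds_word :: "(int \<Rightarrow> nat) \<Rightarrow> nat list \<Rightarrow> bool" where
  "holds_word t w \<longleftrightarrow> (\<forall>i < length w. t (int i) = Suc (w ! i)) \<and> t (int (length w)) = 0"

fun move_head :: "move \<Rightarrow> int \<Rightarrow> int" where
  "move_head Go_Left p = p - 1"
| "move_head Stay p = p"
| "move_head Go_Right p = p + 1"

fun act_on_tape :: "tape \<Rightarrow> nat \<times> move \<Rightarrow> tape" where
  "act_on_tape (t, p) (b, m) = (t(p := b), move_head m p)"

fun otm_step :: "nat list set \<Rightarrow> otm \<Rightarrow> otm_config \<Rightarrow> otm_config" where
  "otm_step Orc M (q, ts) =
     (if q = halt_state M then (q, ts)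
      else if q = query_state M then
        (if \<exists>w \<in> Orc. holds_word (fst (ts ! 1)) w then yes_state M else no_state M, ts)
      else (case trans_fun M q (map (\<lambda>(t, p). t p) ts) of
              (q', acts) \<Rightarrow> (q', map2 act_on_tape ts acts)))"

definition otm_init :: "otm \<Rightarrow> nat list \<Rightarrow> otm_config" where
  "otm_init M w =
     (start_state M, (tape_of_word w, 0) # replicate (n_tapes M - 1) (tape_of_word [], 0))"

definition otm_halts :: "nat list set \<Rightarrow> otm \<Rightarrow> nat list \<Rightarrow> bool" where
  "otm_halts Orc M w \<longleftrightarrow> (\<exists>n. fst ((otm_step Orc M ^^ n) (otm_init M w)) = halt_state M)"

definition re_with_oracle :: "nat list set \<Rightarrow> nat list set \<Rightarrow> bool" where
  "re_with_oracle Orc L \<longleftrightarrow>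
     (\<exists>M. wf_otm M \<and> L = {w \<in> lists {..<n_letters M}. otm_halts Orc M w})"

text \<open>With the empty oracle every query is answered negatively, so this is plain enumerability.\<close>

definition recursively_enumerable :: "nat list set \<Rightarrow> bool" where
  "recursively_enumerable L \<longleftrightarrow> re_with_oracle {} L"


section \<open>Group presentations\<close>

text \<open>
  The free group on generators \<open>0, \<dots>, k - 1\<close>: signed words modulo the equivalence generated by
  cancelling adjacent inverse letters. The letter \<open>(i, True)\<close> is the generator \<open>i\<close> and
  \<open>(i, False)\<close> is its formal inverse.
\<close>

inductive cancels :: "(nat \<times> bool) list \<Rightarrow> (nat \<times> bool) list \<Rightarrow> bool" where
  "cancels (u @ [(i, b), (i, \<not> b)] @ v) (u @ v)"

definition free_rel :: "nat \<Rightarrow> ((nat \<times> bool) list \<times> (nat \<times> bool) list) set" where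
  "free_rel k = {(u, v). u \<in> lists ({..<k} \<times> UNIV) \<and> v \<in> lists ({..<k} \<times> UNIV) \<and>
                         equivclp cancels u v}"

definition free_group :: "nat \<Rightarrow> (nat \<times> bool) list set monoid" where
  "free_group k =
     \<lparr>carrier = lists ({..<k} \<times> UNIV) // free_rel k,
      monoid.mult = (\<lambda>P Q. \<Union>u\<in>P. \<Union>v\<in>Q. free_rel k `` {u @ v}),
      one = free_rel k `` {[]}\<rparr>"

definition free_elem :: "nat \<Rightarrow> nat list \<Rightarrow> (nat \<times> bool) list set" where
  "free_elem k w = free_rel k `` {map (\<lambda>i. (i, True)) w}"

definition normal_closure :: "('a, 'b) monoid_scheme \<Rightarrow> 'a set \<Rightarrow> 'a set" where
  "normal_closure F Y = \<Inter> {N. N \<lhd> F \<and> Y \<subseteq> N}"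

definition presented_group :: "nat \<Rightarrow> nat list set \<Rightarrow> (nat \<times> bool) list set set monoid" where
  "presented_group k R = free_group k Mod normal_closure (free_group k) (free_elem k ` R)"

definition recursively_presented :: "('a, 'b) monoid_scheme \<Rightarrow> bool" where
  "recursively_presented G \<longleftrightarrow>
     (\<exists>k R. R \<subseteq> lists {..<k} \<and> recursively_enumerable R \<and> G \<cong> presented_group k R)"


section \<open>Generating sets and the word problem\<close>

definition finitely_generated :: "('a, 'b) monoid_scheme \<Rightarrow> bool" where
  "finitely_generated K \<longleftrightarrow>
     (\<exists>S. finite S \<and> S \<subseteq> carrier K \<and> generate K S = carrier K)"

text \<open>
  \<open>S\<close> enumerates without repetition a finite generating set that contains the identity and is
  closed under inverses. Words over this set are lists of indices into \<open>S\<close>.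
\<close>

definition generating_list :: "('a, 'b) monoid_scheme \<Rightarrow> 'a list \<Rightarrow> bool" where
  "generating_list K S \<longleftrightarrow>
     distinct S \<and> set S \<subseteq> carrier K \<and> \<one>\<^bsub>K\<^esub> \<in> set S \<and>
     (\<forall>s \<in> set S. inv\<^bsub>K\<^esub> s \<in> set S) \<and> generate K (set S) = carrier K"

definition word_eval :: "('a, 'b) monoid_scheme \<Rightarrow> 'a list \<Rightarrow> nat list \<Rightarrow> 'a" where
  "word_eval K S w = foldr (\<lambda>i g. (S ! i) \<otimes>\<^bsub>K\<^esub> g) w \<one>\<^bsub>K\<^esub>"

definition word_problem :: "('a, 'b) monoid_scheme \<Rightarrow> 'a list \<Rightarrow> nat list set" where
  "word_problem K S = {w \<in> lists {..<length S}. word_eval K S w = \<one>\<^bsub>K\<^esub>}"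


section \<open>Subshifts\<close>

definition full_shift :: "('a, 'b) monoid_scheme \<Rightarrow> nat set \<Rightarrow> ('a \<Rightarrow> nat) set" where
  "full_shift K A = carrier K \<rightarrow>\<^sub>E A"

definition shift :: "('a, 'b) monoid_scheme \<Rightarrow> 'a \<Rightarrow> ('a \<Rightarrow> nat) \<Rightarrow> 'a \<Rightarrow> nat" where
  "shift K g x = (\<lambda>h \<in> carrier K. x (inv\<^bsub>K\<^esub> g \<otimes>\<^bsub>K\<^esub> h))"

definition subshift :: "('a, 'b) monoid_scheme \<Rightarrow> nat set \<Rightarrow> ('a \<Rightarrow> nat) set \<Rightarrow> bool" where
  "subshift K A X \<longleftrightarrow>
     closedin (product_topology (\<lambda>_. discrete_topology A) (carrier K)) X \<and>
     (\<forall>g \<in> carrier K. \<forall>x \<in> X. shift K g x \<in> X)"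

type_synonym pattern_coding = "(nat list \<times> nat) set"

definition pattern_codings :: "'a list \<Rightarrow> nat set \<Rightarrow> pattern_coding set" where
  "pattern_codings S A = {c. finite c \<and> c \<subseteq> lists {..<length S} \<times> A}"

definition cylinder :: "('a, 'b) monoid_scheme \<Rightarrow> nat set \<Rightarrow> nat \<Rightarrow> 'a \<Rightarrow> ('a \<Rightarrow> nat) set" where
  "cylinder K A a g = {x \<in> full_shift K A. x g = a}"

text \<open>Intersecting inside \<open>full_shift K A\<close> gives the empty intersections their intended value.\<close>

definition shift_avoiding ::
    "('a, 'b) monoid_scheme \<Rightarrow> 'a list \<Rightarrow> nat set \<Rightarrow> pattern_coding set \<Rightarrow> ('a \<Rightarrow> nat) set" where
  "shift_avoiding K S A C =
     full_shift K A \<inter>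
     (\<Inter>g \<in> carrier K. \<Inter>c \<in> C.
        full_shift K A -
        (full_shift K A \<inter> (\<Inter>(w, a) \<in> c. cylinder K A a (g \<otimes>\<^bsub>K\<^esub> word_eval K S w))))"

text \<open>
  A pattern coding is presented to a machine by listing its pairs. Generators become even letters
  and alphabet symbols odd letters; the symbol after each group word also ends it, so the encoding
  is uniquely decodable. A set of codings is enumerable if some enumerable set of listings lists
  exactly its members (each member at least once, in some order, possibly with repetitions).
\<close>

definition encode_listing :: "(nat list \<times> nat) list \<Rightarrow> nat list" where
  "encode_listing l = concat (map (\<lambda>(w, a). map (\<lambda>i. 2 * i) w @ [2 * a + 1]) l)"

definition re_codings_with_oracle :: "nat list set \<Rightarrow> pattern_coding set \<Rightarrow> bool" where
  "re_codings_with_oracle Orc C \<longleftrightarrow>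
     (\<exists>E. C = set ` E \<and> re_with_oracle Orc (encode_listing ` E))"

definition effectively_closed ::
    "('a, 'b) monoid_scheme \<Rightarrow> 'a list \<Rightarrow> nat set \<Rightarrow> ('a \<Rightarrow> nat) set \<Rightarrow> bool" where
  "effectively_closed K S A X \<longleftrightarrow>
     (\<exists>C \<subseteq> pattern_codings S A.
        re_codings_with_oracle (word_problem K S) C \<and> X = shift_avoiding K S A C)"

definition Z_projective_subdynamics ::
    "('a, 'b) monoid_scheme \<Rightarrow> nat set \<Rightarrow> ('a \<times> int \<Rightarrow> nat) set \<Rightarrow> (int \<Rightarrow> nat) set" where
  "Z_projective_subdynamics G A X =
     {x \<in> full_shift integer_group A. \<exists>y \<in> X. \<forall>n. x n = y (\<one>\<^bsub>G\<^esub>, n)}"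

end

theory Submission
  imports Defs
begin

text \<open>
  Fix a finite generating list \<open>S\<close> of \<open>G\<close> with \<open>n\<close> entries. The \<open>\<int>\<close>-subshift used here forbids, for
  every word \<open>w\<close> representing \<open>\<one>\<close>, the pattern \<open>0 w $\<close>, where the letters of \<open>w\<close> are shifted to
  \<open>1, \<dots>, n\<close> and the end marker \<open>$\<close> is the symbol \<open>n + 1\<close>. The \<open>G \<times> \<int>\<close>-subshift \<open>X\<close> consists of the
  configurations all of whose rows \<open>{g} \<times> \<int>\<close> avoid these patterns. Rows may be chosen equal, so
  projecting \<open>X\<close> to \<open>\<int>\<close> returns exactly the \<open>\<int>\<close>-subshift.

  \<^bold>\<open>Effectiveness of \<open>X\<close>.\<close> The word problem of \<open>G\<close> reduces to that of \<open>G \<times> \<int>\<close>, so an oracle machine can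
  list the forbidden patterns. The work lies in an explicit machine that recognises exactly
  the codings of these patterns: the \<open>i\<close>-th position is written with a power of a word for
  \<open>(\<one>, 1)\<close>, a counter tape checks the exponents, and the codings contain redundant subwords of
  trivial value that let the machine copy a word for the relator to its oracle tape letter by letter
  (locale \<open>code_reader\<close>, theorem \<open>re_codes\<close>).

  \<^bold>\<open>Non-effectiveness of the projection.\<close> Let \<open>\<dots> 0 0 w $ 0 0 \<dots>\<close> be the configuration with a single
  copy of \<open>w\<close>. It contains only one pattern of the above shape, so it lies in the \<open>\<int>\<close>-subshift
  iff \<open>w\<close> does not represent \<open>\<one>\<close> (\<open>occurs_tape_of_word\<close>). The whole configuration is prescribed by
  \<open>w\<close>. Hence if the \<open>\<int>\<close>-subshift were defined by a set of codings enumerated by a machine \<open>M\<close>, then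
  \<open>w\<close> would represent \<open>\<one>\<close> iff a \<^emph>\<open>single\<close> coding accepted by \<open>M\<close> matches this configuration
  somewhere. The word problem of \<open>\<int>\<close>, which \<open>M\<close> may use
  as an oracle, is decided by walking along a tape.

  To turn this into a recursive presentation of \<open>G\<close>, the search for the coding and for the halting run
  is moved into the relators. Besides the \<open>n\<close> generators of \<open>S\<close> there are finitely many further
  generators, all equal to \<open>\<one>\<close> in \<open>G\<close>, which serve as instructions. A relator is either one of these
  new letters or a word \<open>w v\<close>, where the new letters in \<open>v\<close> form a script that guides a verifier
  through guessing a coding, matching it against the configuration of \<open>w\<close> and simulating \<open>M\<close> on it
  until it halts. Since the letters of \<open>v\<close> are trivial, \<open>w v\<close> is a relator of \<open>G\<close> iff \<open>w\<close> is, and these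
  relators present \<open>G\<close> (\<open>presentation_by_certified_relators\<close>). All choices are written on the input, so
  the machine that accepts the relators is deterministic and takes one step per input letter
  (\<open>re_script_accepts\<close>). If \<open>G\<close> is not recursively presented, such an \<open>M\<close> cannot exist.
\<close>

section \<open>Words in a group\<close>

context group
begin

lemma word_eval_closed [simp]:
  assumes "set S \<subseteq> carrier G" "w \<in> lists {..<length S}"
  shows "word_eval G S w \<in> carrier G"
  using assms(2,1) by (induction w) (auto simp: word_eval_def dest: nth_mem)

lemma word_eval_Nil [simp]: "word_eval G S [] = \<one>"
  by (simp add: word_eval_def)

lemma word_eval_Cons [simp]: "word_eval G S (i # w) = (S ! i) \<otimes> word_eval G S w"
  by (simp add: word_eval_def)

lemma word_eval_append:
  assumes "set S \<subseteq> carrier G" "u \<in> lists {..<length S}" "v \<in> lists {..<length S}"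
  shows "word_eval G S (u @ v) = word_eval G S u \<otimes> word_eval G S v"
  using assms(2)
proof (induction u)
  case (Cons i u)
  then show ?case
    using assms(1,3) word_eval_closed [of S u] word_eval_closed [of S v]
    by (auto simp: m_assoc subset_iff)
qed (use assms in auto)

lemma word_eval_surj:
  assumes "generating_list G S" "x \<in> carrier G"
  obtains w where "w \<in> lists {..<length S}" "word_eval G S w = x"
proof -
  have sub: "set S \<subseteq> carrier G"
    using assms(1) by (auto simp: generating_list_def)
  have letter: "\<exists>i<length S. S ! i = s" if "s \<in> set S" for s
    using that by (auto simp: in_set_conv_nth)
  have "x \<in> generate G (set S)"
    using assms by (auto simp: generating_list_def)
  then have "\<exists>w \<in> lists {..<length S}. word_eval G S w = x"
  proof induction
    case one
    show ?case by (rule bexI [of _ "[]"]) auto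
  next
    case (incl s)
    then obtain i where "i < length S" "S ! i = s" using letter by blast
    then show ?case using sub incl by (intro bexI [of _ "[i]"]) auto
  next
    case (inv s)
    then have "inv s \<in> set S" using assms(1) by (auto simp: generating_list_def)
    then obtain i where "i < length S" "S ! i = inv s" using letter by blast
    then show ?case using sub inv by (intro bexI [of _ "[i]"]) auto
  next
    case (eng x y)
    then obtain u v where "u \<in> lists {..<length S}" "word_eval G S u = x"
        "v \<in> lists {..<length S}" "word_eval G S v = y" by blast
    then show ?case
      using sub by (intro bexI [of _ "u @ v"]) (auto simp: word_eval_append)
  qed
  then show thesis using that by blast
qed

lemma finitely_generated_imp_generating_list:
  assumes "finitely_generated G"
  obtains S where "generating_list G S"
proof -
  obtain Y where Y: "finite Y" "Y \<subseteq> carrier G" "generate G Y = carrier G"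
    using assms by (auto simp: finitely_generated_def)
  define Y' where "Y' = insert \<one> (Y \<union> (\<lambda>y. inv y) ` Y)"
  have "finite Y'" "Y' \<subseteq> carrier G" using Y by (auto simp: Y'_def)
  then obtain S where S: "set S = Y'" "distinct S" using finite_distinct_list by blast
  have "generate G Y \<subseteq> generate G Y'"
    by (rule mono_generate) (auto simp: Y'_def)
  then have "generate G Y' = carrier G"
    using Y generate_incl [OF \<open>Y' \<subseteq> carrier G\<close>] by auto
  then have "generating_list G S"
    using S \<open>Y' \<subseteq> carrier G\<close> Y by (auto simp: generating_list_def Y'_def)
  then show thesis using that by blast
qed

end

lemma zeval_snoc:
  "word_eval integer_group U (u @ [i]) = word_eval integer_group U u + U ! i"
  by (induction u) (auto simp: word_eval_def)

section \<open>Presentations of a group\<close>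

text \<open>
  Membership in the lists over \<open>{..<k} \<times> UNIV\<close> is kept behind a constant, since otherwise the classical
  reasoner unfolds it into statements about single letters.
\<close>

definition signed_words :: "nat \<Rightarrow> (nat \<times> bool) list set" where
  "signed_words k = lists ({..<k} \<times> UNIV)"

lemma Nil_signed_words [simp]: "[] \<in> signed_words k"
  by (simp add: signed_words_def)

lemma append_signed_words [simp]:
  "u @ v \<in> signed_words k \<longleftrightarrow> u \<in> signed_words k \<and> v \<in> signed_words k"
  by (auto simp: signed_words_def)

lemma Cons_signed_words [simp]:
  "x # u \<in> signed_words k \<longleftrightarrow> fst x < k \<and> u \<in> signed_words k"
  by (cases x) (auto simp: signed_words_def)

lemma free_rel_iff:
  "(u, v) \<in> free_rel k \<longleftrightarrow> u \<in> signed_words k \<and> v \<in> signed_words k \<and> equivclp cancels u v"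
  by (simp add: free_rel_def signed_words_def)

lemma equiv_free_rel: "equiv (signed_words k) (free_rel k)"
proof (rule equivI)
  show "free_rel k \<subseteq> signed_words k \<times> signed_words k"
    by (auto simp: free_rel_iff)
  show "refl_on (signed_words k) (free_rel k)"
    by (auto simp: refl_on_def free_rel_iff)
  show "sym (free_rel k)"
    by (rule symI) (simp add: free_rel_iff equivclp_sym)
  show "trans (free_rel k)"
    unfolding trans_def free_rel_iff by (blast intro: equivclp_trans)
qed

lemma equivclp_cancels_context:
  assumes "equivclp cancels u v"
  shows "equivclp cancels (x @ u @ y) (x @ v @ y)"
proof -
  have single: "cancels (x @ u @ y) (x @ v @ y)" if "cancels u v" for u v
    using that
  proof cases
    case (1 u' i b v')
    then show ?thesis using cancels.intros [of "x @ u'" i b "v' @ y"] by simp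
  qed
  show ?thesis
    using assms
  proof (induction rule: equivclp_induct)
    case (step v v')
    then have "cancels (x @ v @ y) (x @ v' @ y) \<or> cancels (x @ v' @ y) (x @ v @ y)"
      using single by blast
    with step.IH show ?case by (rule equivclp_into_equivclp)
  qed simp
qed

lemma free_rel_append:
  assumes "(u, u') \<in> free_rel k" "(v, v') \<in> free_rel k"
  shows "(u @ v, u' @ v') \<in> free_rel k"
proof -
  have "equivclp cancels (u @ v) (u' @ v)"
    using equivclp_cancels_context [of u u' "[]" v] assms by (simp add: free_rel_iff)
  moreover have "equivclp cancels (u' @ v) (u' @ v')"
    using equivclp_cancels_context [of v v' u' "[]"] assms by (simp add: free_rel_iff)
  ultimately have "equivclp cancels (u @ v) (u' @ v')"
    by (rule equivclp_trans)
  then show ?thesis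
    using assms by (simp add: free_rel_iff)
qed

abbreviation free_class :: "nat \<Rightarrow> (nat \<times> bool) list \<Rightarrow> (nat \<times> bool) list set" where
  "free_class k u \<equiv> free_rel k `` {u}"

lemma free_class_eq_iff:
  assumes "u \<in> signed_words k" "v \<in> signed_words k"
  shows "free_class k u = free_class k v \<longleftrightarrow> equivclp cancels u v"
  using eq_equiv_class_iff [OF equiv_free_rel assms] assms by (simp add: free_rel_iff)

lemma carrier_free_group_iff:
  "P \<in> carrier (free_group k) \<longleftrightarrow> (\<exists>u \<in> signed_words k. P = free_class k u)"
  by (auto simp: free_group_def quotient_def signed_words_def [symmetric])

lemma free_class_closed [simp]:
  "u \<in> signed_words k \<Longrightarrow> free_class k u \<in> carrier (free_group k)"
  using carrier_free_group_iff by blast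

lemma free_class_mult [simp]:
  assumes "u \<in> signed_words k" "v \<in> signed_words k"
  shows "free_class k u \<otimes>\<^bsub>free_group k\<^esub> free_class k v = free_class k (u @ v)"
proof -
  have rep: "free_class k (u' @ v') = free_class k (u @ v)"
    if "u' \<in> free_class k u" "v' \<in> free_class k v" for u' v'
  proof -
    have "(u @ v, u' @ v') \<in> free_rel k"
      using that by (simp add: free_rel_append)
    then show ?thesis
      by (rule equiv_class_eq [OF equiv_free_rel, symmetric])
  qed
  have "u \<in> free_class k u" "v \<in> free_class k v"
    using assms by (simp_all add: free_rel_iff)
  then have ne: "free_class k u \<noteq> {}" "free_class k v \<noteq> {}"
    by (metis empty_iff)+
  have "(\<Union>u'\<in>free_class k u. \<Union>v'\<in>free_class k v. free_class k (u' @ v')) =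
      (\<Union>u'\<in>free_class k u. \<Union>v'\<in>free_class k v. free_class k (u @ v))"
    by (intro SUP_cong refl rep)
  also have "\<dots> = free_class k (u @ v)"
    unfolding UN_constant using ne by (simp only: if_False)
  finally show ?thesis
    by (simp add: free_group_def)
qed

lemma free_group_one: "\<one>\<^bsub>free_group k\<^esub> = free_class k []"
  by (simp add: free_group_def)

text \<open>
  Cancellation starts in the middle of the product, where the inverse of the first letter
  of \<open>u\<close> meets that letter.
\<close>

lemma equivclp_cancels_inverse:
  "equivclp cancels (rev (map (\<lambda>(i, b). (i, \<not> b)) u) @ u) []"
proof (induction u)
  case (Cons x u)
  obtain i b where x: "x = (i, b)" by force
  let ?v = "rev (map (\<lambda>(i, b). (i, \<not> b)) u)"
  have "cancels (?v @ [(i, \<not> b), (i, \<not> \<not> b)] @ u) (?v @ u)"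
    by (rule cancels.intros)
  then have "equivclp cancels (?v @ [(i, \<not> b), (i, b)] @ u) (?v @ u)"
    by (simp add: r_into_equivclp)
  from equivclp_trans [OF this Cons.IH] x show ?case by simp
qed simp

lemma group_free_group: "group (free_group k)"
proof (rule groupI)
  fix P assume "P \<in> carrier (free_group k)"
  then obtain u where u: "u \<in> signed_words k" "P = free_class k u"
    using carrier_free_group_iff by blast
  show "\<one>\<^bsub>free_group k\<^esub> \<otimes>\<^bsub>free_group k\<^esub> P = P"
    using free_class_mult [of "[]" k u] u by (simp add: free_group_one)
  let ?v = "rev (map (\<lambda>(i, b). (i, \<not> b)) u)"
  have v: "?v \<in> signed_words k"
    using u(1) by (auto simp: signed_words_def)
  have "free_class k (?v @ u) = free_class k []"
    using u(1) v equivclp_cancels_inverse by (subst free_class_eq_iff) simp_all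
  then have "free_class k ?v \<otimes>\<^bsub>free_group k\<^esub> P = \<one>\<^bsub>free_group k\<^esub>"
    unfolding u(2) free_class_mult [OF v u(1)] free_group_one .
  then show "\<exists>Q\<in>carrier (free_group k). Q \<otimes>\<^bsub>free_group k\<^esub> P = \<one>\<^bsub>free_group k\<^esub>"
    using free_class_closed [OF v] by (rule bexI)
next
  fix P Q assume "P \<in> carrier (free_group k)" "Q \<in> carrier (free_group k)"
  then obtain u v where uv: "u \<in> signed_words k" "P = free_class k u"
      "v \<in> signed_words k" "Q = free_class k v"
    unfolding carrier_free_group_iff by blast
  then show "P \<otimes>\<^bsub>free_group k\<^esub> Q \<in> carrier (free_group k)"
    by simp
  fix R assume "R \<in> carrier (free_group k)"
  then obtain w where "w \<in> signed_words k" "R = free_class k w"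
    unfolding carrier_free_group_iff by blast
  with uv show "P \<otimes>\<^bsub>free_group k\<^esub> Q \<otimes>\<^bsub>free_group k\<^esub> R = P \<otimes>\<^bsub>free_group k\<^esub> (Q \<otimes>\<^bsub>free_group k\<^esub> R)"
    by simp
qed (simp add: free_group_one)

context group
begin

text \<open>
  The letters are evaluated by a function that is total on \<open>nat\<close>: a chain of cancellations between
  two words over the first \<open>k\<close> generators may pass through words with other letters.
\<close>

definition signed_eval :: "(nat \<Rightarrow> 'a) \<Rightarrow> (nat \<times> bool) list \<Rightarrow> 'a" where
  "signed_eval f u = foldr (\<lambda>(i, b) g. (if b then f i else inv (f i)) \<otimes> g) u \<one>"

lemma signed_eval_closed [simp]:
  assumes "range f \<subseteq> carrier G"
  shows "signed_eval f u \<in> carrier G"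
  using assms by (induction u) (auto simp: signed_eval_def image_subset_iff)

lemma signed_eval_append:
  assumes "range f \<subseteq> carrier G"
  shows "signed_eval f (u @ v) = signed_eval f u \<otimes> signed_eval f v"
proof (induction u)
  case Nil
  show ?case using signed_eval_closed [OF assms, of v] by (simp add: signed_eval_def)
next
  case (Cons x u)
  then show ?case
    using assms signed_eval_closed [OF assms, of u] signed_eval_closed [OF assms, of v]
    by (cases x) (auto simp: signed_eval_def m_assoc image_subset_iff)
qed

text \<open>
  Hence the evaluation descends to the free group: it does not depend on the representative.
\<close>

lemma signed_eval_cancels:
  assumes f: "range f \<subseteq> carrier G" and "equivclp cancels u v"
  shows "signed_eval f u = signed_eval f v"
proof -
  have single: "signed_eval f u = signed_eval f v" if "cancels u v" for u v
    using that
  proof cases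
    case (1 u' i b v')
    have pair: "signed_eval f [(i, b), (i, \<not> b)] = \<one>"
      using f by (auto simp: signed_eval_def image_subset_iff)
    have "signed_eval f u = signed_eval f u' \<otimes> (\<one> \<otimes> signed_eval f v')"
      unfolding 1(1) signed_eval_append [OF f] pair ..
    also have "\<dots> = signed_eval f v"
      unfolding 1(2) signed_eval_append [OF f] using f by simp
    finally show ?thesis .
  qed
  from assms(2) show ?thesis
  proof (induction rule: equivclp_induct)
    case (step v v')
    then show ?case using single [of v v'] single [of v' v] by auto
  qed simp
qed

definition free_hom :: "(nat \<Rightarrow> 'a) \<Rightarrow> (nat \<times> bool) list set \<Rightarrow> 'a" where
  "free_hom f P = signed_eval f (SOME u. u \<in> P)"

lemma free_hom_class:
  assumes f: "range f \<subseteq> carrier G" and u: "u \<in> signed_words k"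
  shows "free_hom f (free_class k u) = signed_eval f u"
proof -
  define v where "v = (SOME v. v \<in> free_class k u)"
  have "u \<in> free_class k u"
    using u by (simp add: free_rel_iff)
  then have "v \<in> free_class k u"
    unfolding v_def by (rule someI)
  then have "equivclp cancels u v"
    by (simp add: free_rel_iff)
  from signed_eval_cancels [OF f this] show ?thesis
    by (simp add: free_hom_def v_def)
qed

lemma group_hom_free_hom:
  assumes f: "range f \<subseteq> carrier G"
  shows "group_hom (free_group k) G (free_hom f)"
proof -
  have "free_hom f \<in> hom (free_group k) G"
  proof (rule homI)
    fix P Q assume "P \<in> carrier (free_group k)" "Q \<in> carrier (free_group k)"
    then obtain u v where uv: "u \<in> signed_words k" "P = free_class k u"
        "v \<in> signed_words k" "Q = free_class k v"
      unfolding carrier_free_group_iff by blast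
    show "free_hom f P \<in> carrier G"
      using uv f by (simp add: free_hom_class)
    show "free_hom f (P \<otimes>\<^bsub>free_group k\<^esub> Q) = free_hom f P \<otimes> free_hom f Q"
      using uv f by (simp add: free_hom_class signed_eval_append)
  qed
  then show ?thesis
    by (simp add: group_hom_def group_hom_axioms_def group_free_group group_axioms)
qed


text \<open>
  The generators \<open>i \<ge> length S\<close> are sent to \<open>\<one>\<close>. They are relators themselves, so modulo any normal
  subgroup containing the relators they may be erased from a word. Thus \<open>v\<close> in a relator \<open>w @ v\<close> can be
  any certificate for \<open>w\<close>, and each word of the word problem dies in the quotient. Inverse letters are
  removed with relators of length two: the list \<open>S\<close> contains the inverse \<open>S ! j\<close> of \<open>S ! i\<close>, and the word
  \<open>[j, i]\<close> is in the word problem. So every signed word equals, modulo the relators, a positive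
  word over \<open>S\<close> with the same value in \<open>G\<close>, and the kernel of the evaluation is the normal closure of
  the relators.
\<close>

theorem presentation_by_certified_relators:
  assumes S: "generating_list G S" and R: "R \<subseteq> lists {..<k}" and k: "length S \<le> k"
    and sound: "\<And>u. u \<in> R \<Longrightarrow> word_eval G S (filter (\<lambda>i. i < length S) u) = \<one>"
    and triv: "\<And>i. length S \<le> i \<Longrightarrow> i < k \<Longrightarrow> [i] \<in> R"
    and compl: "\<And>w. w \<in> word_problem G S \<Longrightarrow> w \<noteq> [] \<Longrightarrow>
      \<exists>v. v \<in> lists {length S..<k} \<and> w @ v \<in> R"
  shows "G \<cong> presented_group k R"
proof -
  let ?n = "length S" and ?F = "free_group k" and ?pos = "map (\<lambda>i. (i, True))"
  define f where "f i = (if i < ?n then S ! i else \<one>)" for i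
  have subS: "set S \<subseteq> carrier G" and invS: "\<And>s. s \<in> set S \<Longrightarrow> inv s \<in> set S"
    using S by (auto simp: generating_list_def)
  have f: "range f \<subseteq> carrier G"
    using subS by (auto simp: f_def)
  then have f1: "f i \<in> carrier G" for i by auto
  interpret F: group ?F by (rule group_free_group)
  interpret h: group_hom ?F G "free_hom f" by (rule group_hom_free_hom [OF f])
  have pos_words: "?pos w \<in> signed_words k" if "w \<in> lists {..<k}" for w
    using that by (auto simp: signed_words_def)
  have eval_pos: "signed_eval f (?pos w) = word_eval G S (filter (\<lambda>i. i < ?n) w)" for w
  proof (induction w)
    case (Cons i w)
    have "word_eval G S (filter (\<lambda>i. i < ?n) w) \<in> carrier G"
      using subS by (intro word_eval_closed) auto
    with Cons show ?case by (auto simp: signed_eval_def f_def)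
  qed (simp add: signed_eval_def)
  have filter_id: "filter (\<lambda>i. i < ?n) w = w" if "w \<in> lists {..<?n}" for w
    using that by (auto simp: filter_id_conv)
  have lists_k: "w \<in> lists {..<k}" if "w \<in> lists {..<?n}" for w
    using that k by auto
  have "free_hom f ` carrier ?F = carrier G"
  proof
    show "carrier G \<subseteq> free_hom f ` carrier ?F"
    proof
      fix x assume "x \<in> carrier G"
      then obtain w where w: "w \<in> lists {..<?n}" "word_eval G S w = x"
        using word_eval_surj [OF S] by blast
      have "free_hom f (free_class k (?pos w)) = x"
        using free_hom_class [OF f pos_words [OF lists_k [OF w(1)]]] eval_pos filter_id w by simp
      then show "x \<in> free_hom f ` carrier ?F"
        using free_class_closed [OF pos_words [OF lists_k [OF w(1)]]] by blast
    qed
  qed (use h.hom_closed in blast)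
  moreover have "kernel ?F G (free_hom f) = normal_closure ?F (free_elem k ` R)"
  proof
    have "free_elem k ` R \<subseteq> kernel ?F G (free_hom f)"
    proof
      fix P assume "P \<in> free_elem k ` R"
      then obtain u where u: "u \<in> R" "P = free_class k (?pos u)"
        by (auto simp: free_elem_def)
      then have "?pos u \<in> signed_words k"
        using R pos_words by blast
      then show "P \<in> kernel ?F G (free_hom f)"
        using u sound eval_pos free_hom_class [OF f] by (simp add: kernel_def)
    qed
    then show "normal_closure ?F (free_elem k ` R) \<subseteq> kernel ?F G (free_hom f)"
      using h.normal_kernel by (auto simp: normal_closure_def)
    show "kernel ?F G (free_hom f) \<subseteq> normal_closure ?F (free_elem k ` R)"
      unfolding normal_closure_def
    proof (intro subsetI InterI, clarify)
      fix P N
      assume P: "P \<in> kernel ?F G (free_hom f)" and N: "N \<lhd> ?F" and RN: "free_elem k ` R \<subseteq> N"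
      interpret N: normal N ?F by (rule N)
      define Q where "Q = ?F Mod N"
      interpret Q: group Q
        unfolding Q_def by (rule N.factorgroup_is_group)
      \<comment> \<open>\<open>\<psi>\<close> is the image of a signed word in the quotient by an arbitrary normal subgroup above the relators\<close>
      define \<psi> where "\<psi> u = N #>\<^bsub>?F\<^esub> free_class k u" for u
      have \<psi>_closed: "\<psi> u \<in> carrier Q" if "u \<in> signed_words k" for u
        using that by (auto simp: \<psi>_def Q_def FactGroup_def RCOSETS_def)
      have \<psi>_append: "\<psi> (u @ v) = \<psi> u \<otimes>\<^bsub>Q\<^esub> \<psi> v"
        if "u \<in> signed_words k" "v \<in> signed_words k" for u v
        using that by (simp add: \<psi>_def Q_def N.rcos_sum)
      have \<psi>_one: "\<psi> u = \<one>\<^bsub>Q\<^esub>" if "free_class k u \<in> N" for u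
        using that by (simp add: \<psi>_def Q_def N.rcos_const)
      have \<psi>_Nil: "\<psi> [] = \<one>\<^bsub>Q\<^esub>"
        using N.one_closed by (intro \<psi>_one) (simp add: free_group_one)
      have \<psi>_R: "\<psi> (?pos u) = \<one>\<^bsub>Q\<^esub>" if "u \<in> R" for u
        using RN that by (intro \<psi>_one) (auto simp: free_elem_def)
      have \<psi>_extra: "\<psi> (?pos v) = \<one>\<^bsub>Q\<^esub>" if "v \<in> lists {?n..<k}" for v
        using that
      proof (induction v)
        case (Cons i v)
        have "\<psi> (?pos ([i] @ v)) = \<psi> (?pos [i]) \<otimes>\<^bsub>Q\<^esub> \<psi> (?pos v)"
          unfolding map_append using Cons.hyps by (intro \<psi>_append pos_words) auto
        then show ?case
          using Cons \<psi>_R [OF triv, of i] by simp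
      qed (simp add: \<psi>_Nil)
      have \<psi>_WP: "\<psi> (?pos w) = \<one>\<^bsub>Q\<^esub>" if w: "w \<in> word_problem G S" for w
      proof (cases "w = []")
        case False
        then obtain v where v: "v \<in> lists {?n..<k}" "w @ v \<in> R"
          using compl [OF w] by blast
        have "w @ v \<in> lists {..<k}"
          using R v(2) by blast
        then have "?pos w \<in> signed_words k" "?pos v \<in> signed_words k"
          using pos_words by simp_all
        then show ?thesis
          using \<psi>_R [OF v(2)] \<psi>_extra [OF v(1)] \<psi>_append \<psi>_closed by simp
      qed (simp add: \<psi>_Nil)
      have letter: "\<exists>w \<in> lists {..<?n}. \<psi> [(i, b)] = \<psi> (?pos w) \<and>
          signed_eval f [(i, b)] = word_eval G S w" if "i < k" for i b
      proof (cases "i < ?n")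
        case True
        obtain j where j: "j < ?n" "S ! j = inv (S ! i)"
          using invS [of "S ! i"] True by (metis in_set_conv_nth)
        have Si: "S ! i \<in> carrier G" using subS True by auto
        show ?thesis
        proof (cases b)
          case False
          have "[j, i] \<in> word_problem G S"
            using j True Si by (simp add: word_problem_def)
          from \<psi>_WP [OF this] have "\<psi> [(j, True)] \<otimes>\<^bsub>Q\<^esub> \<psi> [(i, True)] = \<one>\<^bsub>Q\<^esub>"
            using \<psi>_append [of "[(j, True)]" "[(i, True)]"] j True k by simp
          moreover have "free_class k [(i, False), (i, True)] = free_class k []"
            using that cancels.intros [of "[]" i False "[]"]
            by (subst free_class_eq_iff) (simp_all add: r_into_equivclp)
          then have "\<psi> [(i, False)] \<otimes>\<^bsub>Q\<^esub> \<psi> [(i, True)] = \<one>\<^bsub>Q\<^esub>"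
            using \<psi>_append [of "[(i, False)]" "[(i, True)]"] that \<psi>_Nil by (simp add: \<psi>_def)
          ultimately have "\<psi> [(i, False)] = \<psi> [(j, True)]"
            using that j k \<psi>_closed [of "[(j, True)]"] \<psi>_closed [of "[(i, True)]"]
              \<psi>_closed [of "[(i, False)]"] Q.right_cancel [of "\<psi> [(i, True)]" "\<psi> [(i, False)]" "\<psi> [(j, True)]"] by simp
          then show ?thesis
            using j False True Si by (intro bexI [of _ "[j]"]) (auto simp: signed_eval_def f_def)
        qed (use True Si in \<open>auto intro!: bexI [of _ "[i]"] simp: signed_eval_def f_def\<close>)
      next
        case False
        have pos: "\<psi> [(i, True)] = \<one>\<^bsub>Q\<^esub>"
          using \<psi>_extra [of "[i]"] False that by simp
        have "free_class k [(i, False), (i, True)] = free_class k []"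
          using that cancels.intros [of "[]" i False "[]"]
          by (subst free_class_eq_iff) (simp_all add: r_into_equivclp)
        then have "\<psi> [(i, False)] \<otimes>\<^bsub>Q\<^esub> \<psi> [(i, True)] = \<one>\<^bsub>Q\<^esub>"
          using \<psi>_append [of "[(i, False)]" "[(i, True)]"] that \<psi>_Nil by (simp add: \<psi>_def)
        then have "\<psi> [(i, b)] = \<one>\<^bsub>Q\<^esub>"
          using pos \<psi>_closed [of "[(i, False)]"] that by (cases b) simp_all
        then show ?thesis
          using False \<psi>_Nil by (intro bexI [of _ "[]"]) (auto simp: signed_eval_def f_def)
      qed
      have positive: "\<exists>w \<in> lists {..<?n}. \<psi> u = \<psi> (?pos w) \<and> signed_eval f u = word_eval G S w"
        if "u \<in> signed_words k" for u
        using that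
      proof (induction u)
        case (Cons x u)
        obtain i b where x: "x = (i, b)" by force
        with Cons.prems have i: "i < k" and u: "u \<in> signed_words k" by auto
        obtain v where v: "v \<in> lists {..<?n}" "\<psi> [x] = \<psi> (?pos v)"
            "signed_eval f [x] = word_eval G S v"
          using letter [OF i] x by blast
        obtain w where w: "w \<in> lists {..<?n}" "\<psi> u = \<psi> (?pos w)"
            "signed_eval f u = word_eval G S w"
          using Cons.IH u by blast
        have "\<psi> (x # u) = \<psi> [x] \<otimes>\<^bsub>Q\<^esub> \<psi> u"
          using \<psi>_append [of "[x]" u] x i u by simp
        also have "\<dots> = \<psi> (?pos (v @ w))"
          using \<psi>_append pos_words lists_k v w by simp
        finally have 1: "\<psi> (x # u) = \<psi> (?pos (v @ w))" .
        have "signed_eval f (x # u) = signed_eval f [x] \<otimes> signed_eval f u"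
          using signed_eval_append [OF f, of "[x]" u] by simp
        also have "\<dots> = word_eval G S (v @ w)"
          using v w subS by (simp add: word_eval_append)
        finally show ?case
          using 1 v(1) w(1) by (intro bexI [of _ "v @ w"]) auto
      qed (auto intro!: bexI [of _ "[]"] simp: signed_eval_def)
      obtain u where u: "u \<in> signed_words k" "P = free_class k u"
        using P carrier_free_group_iff unfolding kernel_def by blast
      obtain w where w: "w \<in> lists {..<?n}" "\<psi> u = \<psi> (?pos w)" "signed_eval f u = word_eval G S w"
        using positive [OF u(1)] by blast
      have "signed_eval f u = \<one>"
        using P u free_hom_class [OF f u(1)] by (simp add: kernel_def)
      then have "w \<in> word_problem G S"
        using w by (simp add: word_problem_def)
      then have "N #>\<^bsub>?F\<^esub> P = N"
        using \<psi>_WP w(2) u(2) by (simp add: \<psi>_def Q_def)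
      then show "P \<in> N"
        using F.coset_join1 N.subgroup_axioms u by simp
    qed
  qed
  ultimately have "presented_group k R \<cong> G"
    using h.FactGroup_iso by (simp add: presented_group_def)
  moreover have "group (presented_group k R)"
    using h.normal_kernel \<open>kernel ?F G (free_hom f) = _\<close>
    by (simp add: presented_group_def normal.factorgroup_is_group)
  ultimately show ?thesis
    using group.iso_sym by blast
qed

end

section \<open>Scripted machines\<close>

definition keep :: "nat \<Rightarrow> nat \<times> move" where
  "keep b = (b, Stay)"

fun read_tape :: "tape \<Rightarrow> nat" where
  "read_tape (t, p) = t p"

lemma read_tape_eq: "map (\<lambda>(t, p). t p) ts = map read_tape ts"
  by (rule map_cong) auto

text \<open>
  A scripted machine consumes one letter of its input per step: the letter, the state and
  the symbols under the heads determine the next state and one action per tape, or that the letter is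
  not applicable. The input thus prescribes the run. For a machine that
  should make nondeterministic choices, the choices are additional letters, and the accepted inputs are
  the descriptions of its successful runs. Letters and states have arbitrary types.
\<close>

type_synonym ('l, 'q) rules = "'l \<Rightarrow> 'q \<Rightarrow> nat list \<Rightarrow> ('q \<times> (nat \<times> move) list) option"

fun script_step :: "('l, 'q) rules \<Rightarrow> 'l \<Rightarrow> 'q \<times> tape list \<Rightarrow> ('q \<times> tape list) option" where
  "script_step \<delta> l (q, ts) =
     (case \<delta> l q (map read_tape ts) of
        None \<Rightarrow> None
      | Some (q', acts) \<Rightarrow> Some (q', map2 act_on_tape ts acts))"

fun script_run :: "('l, 'q) rules \<Rightarrow> 'l list \<Rightarrow> 'q \<times> tape list \<Rightarrow> ('q \<times> tape list) option" where
  "script_run \<delta> [] c = Some c"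
| "script_run \<delta> (l # ls) c = Option.bind (script_step \<delta> l c) (script_run \<delta> ls)"

definition blank_tapes :: "nat \<Rightarrow> tape list" where
  "blank_tapes K = replicate K (\<lambda>_. 0, 0)"

text \<open>
  The whole input must be consumed and the final state must be accepting. With an oracle set, the
  word on the first tape is then the only query, and it must be answered positively.
\<close>

definition script_accepts ::
    "nat list set option \<Rightarrow> ('l, 'q) rules \<Rightarrow> nat \<Rightarrow> 'q \<Rightarrow> 'q set \<Rightarrow> 'l list \<Rightarrow> bool" where
  "script_accepts orc \<delta> K q0 Acc ls \<longleftrightarrow>
     (\<exists>q ts. script_run \<delta> ls (q0, blank_tapes K) = Some (q, ts) \<and> q \<in> Acc \<and>
        (case orc of None \<Rightarrow> True | Some Orc \<Rightarrow> \<exists>w \<in> Orc. holds_word (fst (hd ts)) w))"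

lemma script_run_append:
  "script_run \<delta> (u @ v) c = Option.bind (script_run \<delta> u c) (script_run \<delta> v)"
  by (induction u arbitrary: c) (auto split: Option.bind_splits)

definition wf_rules :: "('l, 'q) rules \<Rightarrow> 'l list \<Rightarrow> nat \<Rightarrow> nat \<Rightarrow> 'q set \<Rightarrow> bool" where
  "wf_rules \<delta> Ls K B Q \<longleftrightarrow>
     (\<forall>l \<in> set Ls. \<forall>q \<in> Q. \<forall>rs q' acts. length rs = K \<longrightarrow> set rs \<subseteq> {..<B} \<longrightarrow>
        \<delta> l q rs = Some (q', acts) \<longrightarrow>
        q' \<in> Q \<and> length acts = K \<and> (\<forall>(b, m) \<in> set acts. b < B))"

text \<open>
  The halting configuration is a fixed point, so one step does not affect halting. This lets
  the simulation be proved by following single steps, with no count of the steps.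
\<close>

lemma halts_step_iff:
  "(\<exists>n. fst ((otm_step Orc M ^^ n) c) = halt_state M) \<longleftrightarrow>
   (\<exists>n. fst ((otm_step Orc M ^^ n) (otm_step Orc M c)) = halt_state M)"
proof
  assume "\<exists>n. fst ((otm_step Orc M ^^ n) c) = halt_state M"
  then obtain n where n: "fst ((otm_step Orc M ^^ n) c) = halt_state M" ..
  then have "fst ((otm_step Orc M ^^ Suc n) c) = halt_state M"
    by (cases "(otm_step Orc M ^^ n) c") simp
  then show "\<exists>n. fst ((otm_step Orc M ^^ n) (otm_step Orc M c)) = halt_state M"
    by (metis funpow_swap1 comp_apply funpow.simps(2))
next
  assume "\<exists>n. fst ((otm_step Orc M ^^ n) (otm_step Orc M c)) = halt_state M"
  then show "\<exists>n. fst ((otm_step Orc M ^^ n) c) = halt_state M"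
    by (metis funpow_swap1 comp_apply funpow.simps(2))
qed

text \<open>
  The Turing machine has the script on its tape 0, and the tapes of the scripted machine follow, so the
  first of them becomes the oracle tape. States are numbered by \<open>f\<close> with inverse \<open>g\<close>. Three further
  states are added: \<open>card Q\<close> for halting, \<open>card Q + 1\<close> for the final query and \<open>card Q + 2\<close>, in which the
  machine stays forever after an inapplicable letter or a failed test.
\<close>

locale scripted =
  fixes \<delta> :: "('l, 'q) rules" and Ls :: "'l list" and K B :: nat
    and Q :: "'q set" and q0 :: 'q and Acc :: "'q set" and query :: bool
    and f :: "'q \<Rightarrow> nat" and g :: "nat \<Rightarrow> 'q"
  assumes fin: "finite Q" and q0: "q0 \<in> Q" and K: "0 < K" and B: "length Ls < B"
    and wf: "wf_rules \<delta> Ls K B Q"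
    and f: "bij_betw f Q {..<card Q}" and gf: "\<And>q. q \<in> Q \<Longrightarrow> g (f q) = q"
begin

definition trans_table :: "nat \<Rightarrow> nat list \<Rightarrow> nat \<times> (nat \<times> move) list" where
  "trans_table q rs =
     (let stuck = (card Q + 2, map keep rs); a = hd rs in
      if card Q \<le> q then stuck
      else if a = 0 then
        (if g q \<in> Acc then (if query then card Q + 1 else card Q) else card Q + 2, map keep rs)
      else if length Ls < a then stuck
      else (case \<delta> (Ls ! (a - 1)) (g q) (tl rs) of
              None \<Rightarrow> stuck
            | Some (q', acts) \<Rightarrow> (f q', (a, Go_Right) # acts)))"

definition machine :: otm where
  "machine = \<lparr>n_tapes = Suc K, n_letters = length Ls, n_symbols = B, n_states = card Q + 3,
     start_state = f q0, halt_state = card Q, query_state = card Q + 1, yes_state = card Q,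
     no_state = card Q + 2, trans_fun = trans_table\<rparr>"

lemma f_less: "q \<in> Q \<Longrightarrow> f q < card Q"
  using f by (auto simp: bij_betw_def)

lemma g_in: "q < card Q \<Longrightarrow> g q \<in> Q"
  using f gf by (metis bij_betw_imp_surj_on imageE lessThan_iff)

lemma wf_machine: "wf_otm machine"
proof -
  have keep: "fst ` set (map keep rs) = set rs" for rs
    by (auto simp: keep_def image_iff)
  have "case trans_table q rs of (q', acts) \<Rightarrow>
          q' < card Q + 3 \<and> length acts = Suc K \<and> fst ` set acts \<subseteq> {..<B}"
    if q: "q < card Q + 3" and rs: "length rs = Suc K" "set rs \<subseteq> {..<B}" for q rs
  proof (cases "card Q \<le> q \<or> hd rs = 0 \<or> length Ls < hd rs \<or>
      \<delta> (Ls ! (hd rs - 1)) (g q) (tl rs) = None")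
    case True
    then have "snd (trans_table q rs) = map keep rs \<and> fst (trans_table q rs) < card Q + 3"
      by (auto simp: trans_table_def Let_def)
    then show ?thesis
      using rs keep [of rs] by (cases "trans_table q rs") simp
  next
    case False
    then obtain q' acts where d: "\<delta> (Ls ! (hd rs - 1)) (g q) (tl rs) = Some (q', acts)"
      by auto
    obtain a rs' where rs': "rs = a # rs'"
      using rs(1) by (cases rs) auto
    have "q' \<in> Q \<and> length acts = K \<and> (\<forall>(b, m) \<in> set acts. b < B)"
      using wf d False rs rs' g_in [of q] nth_mem [of "a - 1" Ls]
      unfolding wf_rules_def by (auto dest!: bspec)
    then show ?thesis
      using False d rs rs' f_less [of q'] by (fastforce simp: trans_table_def Let_def)
  qed
  then show ?thesis
    using K B f_less [OF q0] by (auto simp: wf_otm_def machine_def)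
qed

definition halts_from :: "nat list set \<Rightarrow> otm_config \<Rightarrow> bool" where
  "halts_from Orc c \<longleftrightarrow> (\<exists>n. fst ((otm_step Orc machine ^^ n) c) = card Q)"

lemma halts_from_step: "halts_from Orc c \<longleftrightarrow> halts_from Orc (otm_step Orc machine c)"
  using halts_step_iff [of Orc machine c] by (simp add: halts_from_def machine_def)

lemma halts_from_halted: "halts_from Orc (card Q, ts)"
  unfolding halts_from_def by (rule exI [of _ 0]) simp

lemma not_halts_from_stuck: "\<not> halts_from Orc (card Q + 2, ts)"
proof -
  have "fst ((otm_step Orc machine ^^ n) (card Q + 2, ts)) = card Q + 2" for n
  proof (induction n)
    case (Suc n)
    then show ?case
      by (cases "(otm_step Orc machine ^^ n) (card Q + 2, ts)")
        (simp add: machine_def trans_table_def)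
  qed simp
  then show ?thesis by (simp add: halts_from_def)
qed

lemma keep_tapes: "map2 act_on_tape ts (map keep (map read_tape ts)) = ts"
  by (induction ts) (auto simp: keep_def)

definition bounded_tapes :: "tape list \<Rightarrow> bool" where
  "bounded_tapes ts \<longleftrightarrow> length ts = K \<and> (\<forall>(t, p) \<in> set ts. \<forall>z. t z < B)"

lemma bounded_tapes_act:
  assumes "bounded_tapes ts" "length acts = K" "\<forall>(b, m) \<in> set acts. b < B"
  shows "bounded_tapes (map2 act_on_tape ts acts)"
proof -
  have "\<forall>z. fst (act_on_tape c a) z < B" if "(c, a) \<in> set (zip ts acts)" for c a
  proof -
    have "c \<in> set ts" "a \<in> set acts"
      using that by (auto dest: set_zip_leftD set_zip_rightD)
    moreover obtain t p b m where "c = (t, p)" "a = (b, m)"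
      by (metis prod.exhaust)
    ultimately have "\<forall>z. t z < B" "b < B"
      using assms by (auto simp: bounded_tapes_def)
    then show ?thesis
      using \<open>c = (t, p)\<close> \<open>a = (b, m)\<close> by simp
  qed
  then have "\<forall>z. fst x z < B" if "x \<in> set (map2 act_on_tape ts acts)" for x
    using that by auto
  moreover have "length (map2 act_on_tape ts acts) = K"
    using assms by (simp add: bounded_tapes_def)
  ultimately show ?thesis
    unfolding bounded_tapes_def by fastforce
qed

lemma bounded_tapes_read:
  "bounded_tapes ts \<Longrightarrow> length (map read_tape ts) = K \<and> set (map read_tape ts) \<subseteq> {..<B}"
  by (auto simp: bounded_tapes_def)

text \<open>
  The Turing machine and the scripted machine are in lockstep, by induction on the unread part of the
  script.
\<close>

lemma halts_from_run:
  assumes "u \<in> lists {..<length Ls}" "i \<le> length u" "q \<in> Q" "bounded_tapes ts"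
  shows "halts_from Orc (f q, (tape_of_word u, int i) # ts) \<longleftrightarrow>
    (\<exists>q' ts'. script_run \<delta> (map ((!) Ls) (drop i u)) (q, ts) = Some (q', ts') \<and> q' \<in> Acc \<and>
       (query \<longrightarrow> (\<exists>w \<in> Orc. holds_word (fst (hd ts')) w)))"
  using assms(2-4)
proof (induction "length u - i" arbitrary: i q ts)
  case 0
  then have i: "i = length u" by simp
  have fq: "f q < card Q" "g (f q) = q"
    using f_less gf 0 by auto
  have hd: "ts ! 0 = hd ts"
    using 0 K by (cases ts) (auto simp: bounded_tapes_def)
  let ?c = "(f q, (tape_of_word u, int i) # ts)"
  have 1: "otm_step Orc machine ?c =
      (if q \<in> Acc then (if query then card Q + 1 else card Q) else card Q + 2,
       (tape_of_word u, int i) # ts)"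
    using fq keep_tapes [of "(tape_of_word u, int i) # ts"]
    by (simp add: machine_def trans_table_def read_tape_eq i tape_of_word_def Let_def)
  have 2: "otm_step Orc machine (card Q + 1, (tape_of_word u, int i) # ts) =
      (if \<exists>w \<in> Orc. holds_word (fst (hd ts)) w then card Q else card Q + 2,
       (tape_of_word u, int i) # ts)"
    by (simp add: machine_def hd)
  have 3: "halts_from Orc (card Q + 1, (tape_of_word u, int i) # ts) \<longleftrightarrow>
      (\<exists>w \<in> Orc. holds_word (fst (hd ts)) w)"
    unfolding halts_from_step [of Orc "(card Q + 1, _)"] 2
    using not_halts_from_stuck halts_from_halted by auto
  have "halts_from Orc ?c \<longleftrightarrow>
      q \<in> Acc \<and> (query \<longrightarrow> (\<exists>w \<in> Orc. holds_word (fst (hd ts)) w))"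
    unfolding halts_from_step [of Orc ?c] 1
    using 3 not_halts_from_stuck halts_from_halted by (cases "q \<in> Acc"; cases query) simp_all
  then show ?case by (simp add: i)
next
  case (Suc d)
  then have i: "i < length u" by simp
  have fq: "f q < card Q" "g (f q) = q"
    using f_less gf Suc.prems by auto
  have a: "tape_of_word u (int i) = Suc (u ! i)" "u ! i < length Ls"
    using i assms(1) by (auto simp: tape_of_word_def in_lists_conv_set)
  let ?c = "(f q, (tape_of_word u, int i) # ts)" and ?l = "Ls ! (u ! i)"
  have drop: "drop i u = u ! i # drop (Suc i) u"
    using i by (simp add: Cons_nth_drop_Suc)
  show ?case
  proof (cases "\<delta> ?l q (map read_tape ts)")
    case None
    have "otm_step Orc machine ?c = (card Q + 2, (tape_of_word u, int i) # ts)"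
      using fq a None keep_tapes [of "(tape_of_word u, int i) # ts"]
      by (simp add: machine_def trans_table_def read_tape_eq Let_def)
    then show ?thesis
      using not_halts_from_stuck None
      by (subst halts_from_step) (auto simp: drop simp del: otm_step.simps)
  next
    case (Some qa)
    obtain q' acts where qa: "qa = (q', acts)" by force
    have ok: "q' \<in> Q" "length acts = K" "\<forall>(b, m) \<in> set acts. b < B"
      using wf Some qa a(2) Suc.prems bounded_tapes_read [of ts] nth_mem [of "u ! i" Ls]
      unfolding wf_rules_def by blast+
    let ?ts = "map2 act_on_tape ts acts"
    have "otm_step Orc machine ?c = (f q', (tape_of_word u, int (Suc i)) # ?ts)"
      using fq a Some qa
      by (simp add: machine_def trans_table_def read_tape_eq Let_def fun_upd_idem)
    then show ?thesis
      using Suc.hyps(1) [of "Suc i" q' ?ts] Suc.hyps(2) i ok bounded_tapes_act Suc.prems Some qa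
      by (subst halts_from_step) (auto simp: drop simp del: otm_step.simps)
  qed
qed

end

theorem re_script_accepts:
  fixes \<delta> :: "('l, 'q) rules" and Ls :: "'l list"
  assumes "finite Q" "q0 \<in> Q" "0 < K" "length Ls < B" "wf_rules \<delta> Ls K B Q"
  shows "re_with_oracle Orc {u \<in> lists {..<length Ls}.
           script_accepts (if query then Some Orc else None) \<delta> K q0 Acc (map ((!) Ls) u)}"
proof -
  obtain f where f: "bij_betw f Q {..<card Q}"
    using ex_bij_betw_finite_nat [OF assms(1)] by (auto simp: lessThan_atLeast0)
  interpret scripted \<delta> Ls K B Q q0 Acc query f "inv_into Q f"
    using assms f by unfold_locales (auto simp: bij_betw_def)
  have good: "bounded_tapes (blank_tapes K)"
    using B by (auto simp: bounded_tapes_def blank_tapes_def)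
  have "otm_halts Orc machine u \<longleftrightarrow>
      script_accepts (if query then Some Orc else None) \<delta> K q0 Acc (map ((!) Ls) u)"
    if u: "u \<in> lists {..<length Ls}" for u
  proof -
    have "otm_init machine u = (f q0, (tape_of_word u, int 0) # blank_tapes K)"
      by (simp add: otm_init_def machine_def blank_tapes_def tape_of_word_def fun_eq_iff)
    then have "otm_halts Orc machine u \<longleftrightarrow>
        halts_from Orc (f q0, (tape_of_word u, int 0) # blank_tapes K)"
      by (simp add: otm_halts_def halts_from_def machine_def)
    also have "\<dots> \<longleftrightarrow> script_accepts (if query then Some Orc else None) \<delta> K q0 Acc (map ((!) Ls) u)"
      using halts_from_run [OF u _ q0 good, of 0 Orc] by (auto simp: script_accepts_def)
    finally show ?thesis .
  qed
  moreover have "n_letters machine = length Ls"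
    by (simp add: machine_def)
  ultimately show ?thesis
    using wf_machine unfolding re_with_oracle_def
    by (intro exI [of _ machine] conjI Collect_cong)
      (simp_all cong: conj_cong del: in_lists_conv_set)
qed

section \<open>A verifier for certificates of forbidden patterns\<close>

lemma keep_tapes [simp]:
  "map2 act_on_tape ts (map (keep \<circ> read_tape) ts) = ts"
  by (induction ts) (auto simp: keep_def)

lemma act_keep [simp]: "act_on_tape c (keep (read_tape c)) = c"
  by (cases c) (simp add: keep_def)

lemma act_keep_pair [simp]: "t p = b \<Longrightarrow> act_on_tape (t, p) (keep b) = (t, p)"
  by (auto simp: keep_def)

lemma tape_of_word_snoc:
  "(tape_of_word u)(int (length u) := Suc e) = tape_of_word (u @ [e])"
  by (auto simp: tape_of_word_def fun_eq_iff nth_append nat_less_iff)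

lemma tape_of_word_Nil [simp]: "tape_of_word [] = (\<lambda>_. 0)"
  by (simp add: tape_of_word_def fun_eq_iff)

lemma encode_listing_append [simp]:
  "encode_listing (l @ l') = encode_listing l @ encode_listing l'"
  by (simp add: encode_listing_def)

lemma encode_listing_Nil [simp]: "encode_listing [] = []"
  by (simp add: encode_listing_def)

lemma encode_listing_Cons [simp]:
  "encode_listing ((w, a) # l) = map (\<lambda>i. 2 * i) w @ [2 * a + 1] @ encode_listing l"
  by (simp add: encode_listing_def)

text \<open>
  The first odd letter marks the end of the group word, so both can be read off.
\<close>

lemma even_prefix_unique:
  assumes "map (\<lambda>i. 2 * i) u @ (2 * a + 1) # x = map (\<lambda>i. 2 * i) v @ (2 * b + 1) # (y :: nat list)"
  shows "u = v \<and> a = b \<and> x = y"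
  using assms
proof (induction u arbitrary: v)
  case Nil
  then show ?case by (cases v) (auto, presburger)
next
  case (Cons i u)
  then show ?case by (cases v) (auto, presburger)
qed

lemma encode_listing_inject: "encode_listing l = encode_listing l' \<Longrightarrow> l = l'"
proof (induction l arbitrary: l')
  case Nil
  then show ?case by (cases l') auto
next
  case (Cons x l)
  obtain u a where x: "x = (u, a)" by force
  with Cons.prems obtain v b l'' where l': "l' = (v, b) # l''"
    by (cases l') auto
  show ?case
    using even_prefix_unique [of u a "encode_listing l" v b "encode_listing l''"] Cons x l' by auto
qed

lemma zeval_Nil [simp]: "word_eval integer_group U [] = 0"
  by (simp add: word_eval_def)

text \<open>
  The instructions of a script. \<open>Gen\<close> supplies a letter of the word to be certified and \<open>Emit\<close> a letter
  of the guessed listing. \<open>HMove\<close> and \<open>TMove\<close> let the script steer a group of heads freely, \<open>Go\<close> performs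
  the step that the current state calls for, and \<open>Fin\<close> ends the guessed listing.
\<close>

datatype instr = Gen nat | Emit nat | Go | Fin | HMove move | TMove move

text \<open>
  A run reads the word (\<open>Reading\<close>), chooses where the coding is to be matched (\<open>Placing\<close>), writes the
  listing of a coding while matching it (\<open>Pairs\<close> between two pairs, \<open>Word\<close> inside the group word of a pair),
  returns to the start of the listing (\<open>Rewind\<close>) and simulates the given machine (\<open>Sim\<close>). The states
  \<open>Seek\<close>, \<open>Scan\<close> and \<open>Ret\<close> answer an oracle query. \<open>Walk s d\<close> has to move by \<open>d\<close> cells, and the flag says
  whether to resume in \<open>Scan\<close> or in \<open>Word\<close>. \<open>Trivial\<close> accepts the one-letter scripts, which make the
  instructions relators.
\<close>

datatype ctl =
  Start | Reading | Trivial | Placing | Pairs | Word | Walk bool int | Rewind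
| Sim nat | Seek | Scan | Ret nat

definition towards :: "int \<Rightarrow> move" where
  "towards d = (if 0 < d then Go_Right else Go_Left)"

text \<open>
  Four tapes precede those of the simulated machine \<open>M\<close>. The tape under \<open>x\<close> holds the configuration
  that is to be matched; a blank is its symbol \<open>0\<close>, so the tape \<^emph>\<open>is\<close> the configuration. The head on
  \<open>h\<close> moves together with the one on \<open>x\<close> once the position is chosen, and a single mark on this tape
  tells the home position. This pair of heads evaluates words over \<open>U\<close>: the displacement
  from home is the value of the word read so far. The heads on \<open>z\<close> and \<open>r\<close> follow the oracle tape of \<open>M\<close>.
  On \<open>z\<close> the cell \<open>0\<close> is marked; on \<open>r\<close> a mark is set when a query starts, to find the way back.

  A machine cannot know in which direction a mark lies. Here the script
  chooses the moves, and only the arrival at the mark is checked.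
\<close>

definition verifier :: "otm \<Rightarrow> int list \<Rightarrow> nat \<Rightarrow> (instr, ctl) rules" where
  "verifier M U n l q rs =
     (case rs of x # h # z # r # a # b # cs \<Rightarrow>
       (let X = keep x; H = keep h; Z = keep z; R = keep r; A = keep a; B = keep b;
            C = map keep cs
        in case q of
          Start \<Rightarrow> (case l of
              Gen i \<Rightarrow> if i < n then Some (Reading, (Suc i, Go_Right) # H # Z # R # A # B # C) else None
            | _ \<Rightarrow> Some (Trivial, X # H # Z # R # A # B # C))
        | Reading \<Rightarrow> (case l of
              Gen i \<Rightarrow> if i < n then Some (Reading, (Suc i, Go_Right) # H # Z # R # A # B # C) else None
            | Go \<Rightarrow> Some (Placing, (Suc n, Stay) # (1, Stay) # (1, Stay) # R # A # B # C)
            | _ \<Rightarrow> None)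
        | Trivial \<Rightarrow> None
        | Placing \<Rightarrow> (case l of
              HMove m \<Rightarrow> Some (Placing, (x, m) # H # Z # R # A # B # C)
            | Go \<Rightarrow> Some (Pairs, X # H # Z # R # A # B # C)
            | _ \<Rightarrow> None)
        | Pairs \<Rightarrow> (case l of
              HMove m \<Rightarrow> Some (Pairs, (x, m) # (h, m) # Z # R # A # B # C)
            | Go \<Rightarrow> if h = 1 then Some (Word, X # H # Z # R # A # B # C) else None
            | Fin \<Rightarrow> if h = 1 then Some (Rewind, X # H # Z # R # (a, Go_Left) # B # C) else None
            | _ \<Rightarrow> None)
        | Word \<Rightarrow> (case l of
              Emit e \<Rightarrow>
                if n_letters M \<le> e then None
                else if even e then
                  (if e div 2 < length U
                   then Some (Walk False (U ! (e div 2)), X # H # Z # R # (Suc e, Go_Right) # B # C)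
                   else None)
                else if x = e div 2
                then Some (Pairs, X # H # Z # R # (Suc e, Go_Right) # B # C)
                else None
            | _ \<Rightarrow> None)
        | Walk s d \<Rightarrow> (case l of
              Go \<Rightarrow>
                if d = 0 then Some (if s then Scan else Word, X # H # Z # R # A # B # C)
                else Some (Walk s (d - sgn d), (x, towards d) # (h, towards d) # Z # R # A # B # C)
            | _ \<Rightarrow> None)
        | Rewind \<Rightarrow> (case l of
              Go \<Rightarrow>
                if a = 0 then Some (Sim (start_state M), X # H # Z # R # (a, Go_Right) # B # C)
                else Some (Rewind, X # H # Z # R # (a, Go_Left) # B # C)
            | _ \<Rightarrow> None)
        | Sim p \<Rightarrow> (case l of
              Go \<Rightarrow>
                if p = halt_state M then None
                else if p = query_state M then Some (Seek, X # H # Z # (1, Stay) # A # B # C)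
                else if set (a # b # cs) \<subseteq> {..<n_symbols M} then
                  (case trans_fun M p (a # b # cs) of (p', acts) \<Rightarrow>
                     Some (Sim p', X # H # (z, snd (acts ! 1)) # (r, snd (acts ! 1)) # acts))
                else None
            | _ \<Rightarrow> None)
        | Seek \<Rightarrow> (case l of
              TMove m \<Rightarrow> Some (Seek, X # H # (z, m) # (r, m) # A # (b, m) # C)
            | Go \<Rightarrow> if z = 1 then Some (Scan, X # H # Z # R # A # B # C) else None
            | _ \<Rightarrow> None)
        | Scan \<Rightarrow> (case l of
              Go \<Rightarrow>
                if b = 0
                then Some (Ret (if h = 1 then yes_state M else no_state M), X # H # Z # R # A # B # C)
                else if length U < b then Some (Ret (no_state M), X # H # Z # R # A # B # C)
                else Some (Walk True (U ! (b - 1)),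
                       X # H # (z, Go_Right) # (r, Go_Right) # A # (b, Go_Right) # C)
            | _ \<Rightarrow> None)
        | Ret p \<Rightarrow> (case l of
              TMove m \<Rightarrow> Some (Ret p, X # H # (z, m) # (r, m) # A # (b, m) # C)
            | HMove m \<Rightarrow> Some (Ret p, (x, m) # (h, m) # Z # R # A # B # C)
            | Go \<Rightarrow>
                if r = 1 \<and> h = 1 then Some (Sim p, X # H # Z # (0, Stay) # A # B # C) else None
            | _ \<Rightarrow> None))
     | _ \<Rightarrow> None)"

abbreviation zeval :: "int list \<Rightarrow> nat list \<Rightarrow> int" where
  "zeval U \<equiv> word_eval integer_group U"

definition point :: "int \<Rightarrow> int \<Rightarrow> nat" where
  "point p = (\<lambda>_. 0)(p := 1)"

lemma point_eq_1_iff [simp]: "point p z = Suc 0 \<longleftrightarrow> z = p"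
  by (simp add: point_def)

abbreviation blank :: tape where
  "blank \<equiv> (\<lambda>_. 0, 0)"

lemma wf_otm_trans:
  assumes "wf_otm M" "q < n_states M" "length rs = n_tapes M" "set rs \<subseteq> {..<n_symbols M}"
    and "trans_fun M q rs = (q', acts)"
  shows "q' < n_states M" "length acts = n_tapes M" "fst ` set acts \<subseteq> {..<n_symbols M}"
proof -
  have "\<forall>q < n_states M. \<forall>rs. length rs = n_tapes M \<and> set rs \<subseteq> {..<n_symbols M} \<longrightarrow>
      (case trans_fun M q rs of (q', acts) \<Rightarrow>
         q' < n_states M \<and> length acts = n_tapes M \<and> fst ` set acts \<subseteq> {..<n_symbols M})"
    using assms(1) unfolding wf_otm_def by (elim conjE)
  with assms(2-4) have "case trans_fun M q rs of (q', acts) \<Rightarrow>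
      q' < n_states M \<and> length acts = n_tapes M \<and> fst ` set acts \<subseteq> {..<n_symbols M}"
    by (elim allE impE) simp_all
  with assms(5) show "q' < n_states M" "length acts = n_tapes M" "fst ` set acts \<subseteq> {..<n_symbols M}"
    by simp_all
qed

lemma holds_word_unique:
  assumes "holds_word t u" "holds_word t v" shows "u = v"
proof -
  have "\<not> length u < length v" "\<not> length v < length u"
    using assms by (auto simp: holds_word_def)
  then show ?thesis
    using assms by (intro nth_equalityI) (auto simp: holds_word_def)
qed

locale verification =
  fixes M :: otm and U :: "int list" and n :: nat
  assumes wf_M: "wf_otm M"
begin

abbreviation Orc :: "nat list set" where
  "Orc \<equiv> word_problem integer_group U"

text \<open>
  The next lemmas evaluate \<open>verifier\<close> once for each control state, directly on tapes, so that
  the table itself need not be unfolded again.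
\<close>

definition vstep :: "instr \<Rightarrow> ctl \<times> tape list \<Rightarrow> (ctl \<times> tape list) option" where
  "vstep = script_step (verifier M U n)"

lemma vstep_start:
  "vstep l (Start, (x, p) # H # Z # R # A # B # C) =
    (case l of
       Gen i \<Rightarrow> if i < n then Some (Reading, (x(p := Suc i), p + 1) # H # Z # R # A # B # C) else None
     | _ \<Rightarrow> Some (Trivial, (x, p) # H # Z # R # A # B # C))"
  by (auto simp: vstep_def verifier_def Let_def split: instr.split)

lemma vstep_reading:
  "vstep l (Reading, (x, p) # (h, k) # (z, o1) # R # A # B # C) =
    (case l of
       Gen i \<Rightarrow> if i < n then Some (Reading, (x(p := Suc i), p + 1) # (h, k) # (z, o1) # R # A # B # C) else None
     | Go \<Rightarrow> Some (Placing, (x(p := Suc n), p) # (h(k := 1), k) # (z(o1 := 1), o1) # R # A # B # C)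
     | _ \<Rightarrow> None)"
  by (auto simp: vstep_def verifier_def Let_def split: instr.split)

lemma vstep_placing:
  "vstep l (Placing, (x, p) # H # Z # R # A # B # C) =
    (case l of
       HMove m \<Rightarrow> Some (Placing, (x, move_head m p) # H # Z # R # A # B # C)
     | Go \<Rightarrow> Some (Pairs, (x, p) # H # Z # R # A # B # C)
     | _ \<Rightarrow> None)"
  by (auto simp: vstep_def verifier_def Let_def split: instr.split)

lemma vstep_pairs:
  "vstep l (Pairs, (x, p) # (h, k) # Z # R # (a, e) # B # C) =
    (case l of
       HMove m \<Rightarrow> Some (Pairs, (x, move_head m p) # (h, move_head m k) # Z # R # (a, e) # B # C)
     | Go \<Rightarrow> if h k = 1 then Some (Word, (x, p) # (h, k) # Z # R # (a, e) # B # C) else None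
     | Fin \<Rightarrow> if h k = 1 then Some (Rewind, (x, p) # (h, k) # Z # R # (a, e - 1) # B # C) else None
     | _ \<Rightarrow> None)"
  by (auto simp: vstep_def verifier_def Let_def split: instr.split)

lemma vstep_word:
  "vstep l (Word, (x, p) # H # Z # R # (a, f) # B # C) =
    (case l of
       Emit e \<Rightarrow>
         if n_letters M \<le> e then None
         else if even e then
           (if e div 2 < length U
            then Some (Walk False (U ! (e div 2)), (x, p) # H # Z # R # (a(f := Suc e), f + 1) # B # C)
            else None)
         else if x p = e div 2
         then Some (Pairs, (x, p) # H # Z # R # (a(f := Suc e), f + 1) # B # C)
         else None
     | _ \<Rightarrow> None)"
  by (auto simp: vstep_def verifier_def Let_def split: instr.split)

lemma move_towards [simp]: "d \<noteq> 0 \<Longrightarrow> move_head (towards d) p = p + sgn d"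
  by (auto simp: towards_def)

lemma vstep_walk:
  "vstep l (Walk s d, (x, p) # (h, k) # Z # R # A # B # C) =
    (case l of
       Go \<Rightarrow>
         if d = 0 then Some (if s then Scan else Word, (x, p) # (h, k) # Z # R # A # B # C)
         else Some (Walk s (d - sgn d), (x, p + sgn d) # (h, k + sgn d) # Z # R # A # B # C)
     | _ \<Rightarrow> None)"
  by (auto simp: vstep_def verifier_def Let_def split: instr.split)

lemma vstep_rewind:
  "vstep l (Rewind, X # H # Z # R # (a, f) # B # C) =
    (case l of
       Go \<Rightarrow>
         if a f = 0 then Some (Sim (start_state M), X # H # Z # R # (a, f + 1) # B # C)
         else Some (Rewind, X # H # Z # R # (a, f - 1) # B # C)
     | _ \<Rightarrow> None)"
  by (auto simp: vstep_def verifier_def Let_def split: instr.split)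

lemma vstep_seek:
  "vstep l (Seek, X # H # (z, o1) # (r, y) # A # (b, f) # C) =
    (case l of
       TMove m \<Rightarrow>
         Some (Seek, X # H # (z, move_head m o1) # (r, move_head m y) # A # (b, move_head m f) # C)
     | Go \<Rightarrow>
         if z o1 = 1 then Some (Scan, X # H # (z, o1) # (r, y) # A # (b, f) # C) else None
     | _ \<Rightarrow> None)"
  by (auto simp: vstep_def verifier_def Let_def split: instr.split)

lemma vstep_scan:
  "vstep l (Scan, X # (h, k) # (z, o1) # (r, y) # A # (b, f) # C) =
    (case l of
       Go \<Rightarrow>
         if b f = 0 then Some (Ret (if h k = 1 then yes_state M else no_state M),
           X # (h, k) # (z, o1) # (r, y) # A # (b, f) # C)
         else if length U < b f then Some (Ret (no_state M),
           X # (h, k) # (z, o1) # (r, y) # A # (b, f) # C)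
         else Some (Walk True (U ! (b f - 1)),
           X # (h, k) # (z, o1 + 1) # (r, y + 1) # A # (b, f + 1) # C)
     | _ \<Rightarrow> None)"
  by (auto simp: vstep_def verifier_def Let_def split: instr.split)

lemma vstep_ret:
  "vstep l (Ret q, (x, p) # (h, k) # (z, o1) # (r, y) # A # (b, f) # C) =
    (case l of
       TMove m \<Rightarrow> Some (Ret q,
         (x, p) # (h, k) # (z, move_head m o1) # (r, move_head m y) # A # (b, move_head m f) # C)
     | HMove m \<Rightarrow> Some (Ret q,
         (x, move_head m p) # (h, move_head m k) # (z, o1) # (r, y) # A # (b, f) # C)
     | Go \<Rightarrow>
         if r y = 1 \<and> h k = 1
         then Some (Sim q, (x, p) # (h, k) # (z, o1) # (r(y := 0), y) # A # (b, f) # C) else None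
     | _ \<Rightarrow> None)"
  by (auto simp: vstep_def verifier_def Let_def split: instr.split)

lemma vstep_sim_query:
  assumes "query_state M \<noteq> halt_state M"
  shows "vstep Go (Sim (query_state M), X # H # Z # (r, y) # A # B # C) =
    Some (Seek, X # H # Z # (r(y := 1), y) # A # B # C)"
  using assms by (auto simp: vstep_def verifier_def Let_def)

lemma vstep_sim_None:
  "l \<noteq> Go \<or> q = halt_state M \<Longrightarrow> vstep l (Sim q, X # H # Z # R # A # B # C) = None"
  by (auto simp: vstep_def verifier_def Let_def split: instr.split)

lemma vstep_sim_other:
  assumes "q \<noteq> halt_state M" "q \<noteq> query_state M"
    and "trans_fun M q (map read_tape (A # (b, f) # C)) = (q', a1 # (c, m) # acts)"
    and "otm_step Orc M (q, A # (b, f) # C) = (q', A' # B' # C')"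
  shows "vstep Go (Sim q, X # H # (z, o1) # (r, y) # A # (b, f) # C) =
    (if set (map read_tape (A # (b, f) # C)) \<subseteq> {..<n_symbols M}
     then Some (Sim q', X # H # (z, move_head m o1) # (r, move_head m y) # A' # B' # C') else None)"
proof -
  have "otm_step Orc M (q, A # (b, f) # C) =
      (q', map2 act_on_tape (A # (b, f) # C) (a1 # (c, m) # acts))"
    using assms(1-3) by (simp add: read_tape_eq del: list.map)
  with assms show ?thesis
    by (auto simp: vstep_def verifier_def Let_def)
qed

abbreviation "xtape w \<equiv> tape_of_word (w @ [n])"

text \<open>
  The listing \<open>l\<close> is a possible input of \<open>M\<close>, and its pairs match the configuration of \<open>w\<close> at \<open>g\<close>.
\<close>

definition listed :: "nat list \<Rightarrow> int \<Rightarrow> (nat list \<times> nat) list \<Rightarrow> bool" where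
  "listed w g l \<longleftrightarrow> w \<in> lists {..<n} \<and> encode_listing l \<in> lists {..<n_letters M} \<and>
     (\<forall>(u, a) \<in> set l. u \<in> lists {..<length U} \<and> xtape w (g + zeval U u) = a)"

definition reached :: "(nat list \<times> nat) list \<Rightarrow> otm_config \<Rightarrow> bool" where
  "reached l c \<longleftrightarrow> (\<exists>j. (otm_step Orc M ^^ j) (otm_init M (encode_listing l)) = c)"

abbreviation "K0 \<equiv> n_tapes M - 2"

text \<open>
  \<open>tracks w c\<close> is the invariant of the verifier: \<open>c\<close> is a possible configuration after a script whose
  \<open>Gen\<close> letters spell \<open>w\<close>. Because the script may steer the heads as it likes, the positions \<open>k\<close> and \<open>z\<close> are
  arbitrary; what is invariant is that heads of one group stay aligned with each other and that the
  marks stay where they are. During a query, \<open>p\<close> is the position of the head of \<open>M\<close> on its oracle tape,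
  remembered by the mark. The answer is fixed before the heads return, so \<open>Ret\<close> carries it.
\<close>

inductive tracks :: "nat list \<Rightarrow> ctl \<times> tape list \<Rightarrow> bool" where
  start: "tracks [] (Start, blank # blank # blank # blank # blank # blank # replicate K0 blank)"
| reading: "tracks w (Reading, (tape_of_word w, int (length w)) # blank # blank # blank # blank # blank #
    replicate K0 blank)" if "w \<in> lists {..<n}"
| placing: "tracks w (Placing, (xtape w, g) # (point 0, 0) # (point 0, 0) # blank # blank # blank #
    replicate K0 blank)" if "w \<in> lists {..<n}"
| pairs: "tracks w (Pairs, (xtape w, g + k) # (point 0, k) # (point 0, 0) # blank #
    (tape_of_word (encode_listing l), int (length (encode_listing l))) # blank # replicate K0 blank)"
  if "listed w g l"
| word: "tracks w (Word, (xtape w, g + zeval U u) # (point 0, zeval U u) # (point 0, 0) # blank #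
    (tape_of_word (encode_listing l @ map (\<lambda>i. 2 * i) u),
     int (length (encode_listing l @ map (\<lambda>i. 2 * i) u))) # blank # replicate K0 blank)"
  if "listed w g l" "u \<in> lists {..<length U}" "map (\<lambda>i. 2 * i) u \<in> lists {..<n_letters M}"
| walk_word: "tracks w (Walk False d, (xtape w, g + k) # (point 0, k) # (point 0, 0) # blank #
    (tape_of_word (encode_listing l @ map (\<lambda>i. 2 * i) u),
     int (length (encode_listing l @ map (\<lambda>i. 2 * i) u))) # blank # replicate K0 blank)"
  if "listed w g l" "u \<in> lists {..<length U}" "map (\<lambda>i. 2 * i) u \<in> lists {..<n_letters M}"
    "k + d = zeval U u"
| rewind: "tracks w (Rewind, (xtape w, g) # (point 0, 0) # (point 0, 0) # blank #
    (tape_of_word (encode_listing l), p) # blank # replicate K0 blank)"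
  if "listed w g l" "-1 \<le> p" "p < int (length (encode_listing l))"
| sim: "tracks w (Sim q, (xtape w, g) # (point 0, 0) # (point 0, z) # (\<lambda>_. 0, z) # a # (t, z) # cs)"
  if "listed w g l" "reached l (q, a # (t, z) # cs)"
| seek: "tracks w (Seek, (xtape w, g) # (point 0, 0) # (point 0, z) # (point p, z) # a # (t, z) # cs)"
  if "listed w g l" "query_state M \<noteq> halt_state M" "reached l (query_state M, a # (t, p) # cs)"
| scan: "tracks w (Scan, (xtape w, g + zeval U v) # (point 0, zeval U v) # (point 0, int (length v)) #
    (point p, int (length v)) # a # (t, int (length v)) # cs)"
  if "listed w g l" "query_state M \<noteq> halt_state M" "reached l (query_state M, a # (t, p) # cs)" "v \<in> lists {..<length U}"
    "\<forall>i < length v. t (int i) = Suc (v ! i)"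
| walk_scan: "tracks w (Walk True d, (xtape w, g + k) # (point 0, k) # (point 0, int (length v)) #
    (point p, int (length v)) # a # (t, int (length v)) # cs)"
  if "listed w g l" "query_state M \<noteq> halt_state M" "reached l (query_state M, a # (t, p) # cs)" "v \<in> lists {..<length U}"
    "\<forall>i < length v. t (int i) = Suc (v ! i)" "k + d = zeval U v"
| ret: "tracks w (Ret q, (xtape w, g + k) # (point 0, k) # (point 0, z) # (point p, z) # a # (t, z) # cs)"
  if "listed w g l" "query_state M \<noteq> halt_state M" "reached l (query_state M, a # (t, p) # cs)"
    "q = (if \<exists>v \<in> Orc. holds_word t v then yes_state M else no_state M)"

definition gens :: "instr list \<Rightarrow> nat list" where
  "gens ls = concat (map (\<lambda>l. case l of Gen i \<Rightarrow> [i] | _ \<Rightarrow> []) ls)"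

lemma gens_append [simp]: "gens (u @ v) = gens u @ gens v"
  by (simp add: gens_def)

lemma reached_step: "reached l c \<Longrightarrow> reached l (otm_step Orc M c)"
  unfolding reached_def by (metis comp_apply funpow.simps(2))

text \<open>
  Finite support guarantees that the scan of the oracle tape meets a blank, and the bounds on states
  and symbols make the transition table of \<open>M\<close> applicable.
\<close>

definition regular :: "otm_config \<Rightarrow> bool" where
  "regular c \<longleftrightarrow> fst c < n_states M \<and> length (snd c) = n_tapes M \<and>
     (\<forall>T \<in> set (snd c). (\<forall>z. fst T z < n_symbols M) \<and> finite {z. fst T z \<noteq> 0})"

lemma regular_tape_act:
  assumes "\<forall>z. fst T z < B" "finite {z. fst T z \<noteq> 0}" "fst x < B"
  shows "(\<forall>z. fst (act_on_tape T x) z < B) \<and> finite {z. fst (act_on_tape T x) z \<noteq> 0}"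
proof -
  obtain t p b m where "T = (t, p)" "x = (b, m)" by (metis prod.exhaust)
  moreover have "{z. (t(p := b)) z \<noteq> 0} \<subseteq> insert p {z. t z \<noteq> 0}" by auto
  ultimately show ?thesis
    using assms finite_subset [of "{z. (t(p := b)) z \<noteq> 0}" "insert p {z. t z \<noteq> 0}"] by simp
qed

lemma wf_trans:
  assumes "regular (q, ts)" "trans_fun M q (map read_tape ts) = (q', acts)"
  shows "q' < n_states M" "length acts = n_tapes M" "fst ` set acts \<subseteq> {..<n_symbols M}"
    "set (map read_tape ts) \<subseteq> {..<n_symbols M}"
proof -
  show rs: "set (map read_tape ts) \<subseteq> {..<n_symbols M}"
    using assms(1) by (auto simp: regular_def)
  have "q < n_states M" "length (map read_tape ts) = n_tapes M"
    using assms(1) by (auto simp: regular_def)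
  from wf_otm_trans [OF wf_M this rs assms(2)]
  show "q' < n_states M" "length acts = n_tapes M" "fst ` set acts \<subseteq> {..<n_symbols M}" .
qed

lemma regular_step:
  assumes "regular c" shows "regular (otm_step Orc M c)"
proof -
  obtain q ts where c: "c = (q, ts)" by force
  show ?thesis
  proof (cases "q = halt_state M \<or> q = query_state M")
    case True
    then show ?thesis
      using assms wf_M by (auto simp: c regular_def wf_otm_def)
  next
    case False
    obtain q' acts where tr: "trans_fun M q (map read_tape ts) = (q', acts)" by force
    note wf = wf_trans [OF assms [unfolded c] tr]
    have "(\<forall>z. fst T z < n_symbols M) \<and> finite {z. fst T z \<noteq> 0}"
      if T: "T \<in> set (map2 act_on_tape ts acts)" for T
    proof -
      obtain S x where "(S, x) \<in> set (zip ts acts)" "T = act_on_tape S x"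
        using T by auto
      then have "S \<in> set ts" "x \<in> set acts" "T = act_on_tape S x"
        by (auto dest: set_zip_leftD set_zip_rightD)
      then show ?thesis
        using regular_tape_act [of S "n_symbols M" x] assms wf(3) by (auto simp: c regular_def)
    qed
    then show ?thesis
      using assms wf(1,2) False tr by (simp add: c regular_def read_tape_eq)
  qed
qed

lemma regular_reached:
  assumes "encode_listing l \<in> lists {..<n_letters M}" "reached l c" shows "regular c"
proof -
  have pos: "0 < n_symbols M" and lt: "n_letters M < n_symbols M"
    using wf_M by (auto simp: wf_otm_def)
  have "tape_of_word (encode_listing l) z < n_symbols M" for z
  proof (cases "0 \<le> z \<and> z < int (length (encode_listing l))")
    case True
    then have "encode_listing l ! nat z < n_letters M"
      using assms(1) by (auto simp: nat_less_iff in_lists_conv_set)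
    with True lt show ?thesis by (simp add: tape_of_word_def)
  next
    case False
    then have "tape_of_word (encode_listing l) z = 0" by (auto simp: tape_of_word_def)
    with pos show ?thesis by simp
  qed
  moreover have "{z. tape_of_word (encode_listing l) z \<noteq> 0} \<subseteq> {0..int (length (encode_listing l))}"
    by (auto simp: tape_of_word_def)
  then have "finite {z. tape_of_word (encode_listing l) z \<noteq> 0}"
    by (rule finite_subset) simp
  ultimately have "regular (otm_init M (encode_listing l))"
    using wf_M by (auto simp: regular_def otm_init_def wf_otm_def)
  then have "regular ((otm_step Orc M ^^ j) (otm_init M (encode_listing l)))" for j
    by (induction j) (auto intro: regular_step)
  with assms(2) show ?thesis by (auto simp: reached_def)
qed

lemma otm_init_two_tapes:
  "otm_init M s = (start_state M, (tape_of_word s, 0) # blank # replicate K0 blank)"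
  using wf_M by (cases "n_tapes M"; cases "n_tapes M - 1") (auto simp: otm_init_def wf_otm_def)

text \<open>
  The scan has read the word \<open>v\<close> and stops at a blank or at a symbol that is no letter over \<open>U\<close>. In the
  second case the tape cannot hold any word over \<open>U\<close>; in the first case it holds \<open>v\<close> and nothing else.
\<close>

lemma query_answer:
  assumes "v \<in> lists {..<length U}" "\<forall>i < length v. t (int i) = Suc (v ! i)"
    and "t (int (length v)) = 0 \<or> length U < t (int (length v))"
  shows "(\<exists>u \<in> Orc. holds_word t u) \<longleftrightarrow> t (int (length v)) = 0 \<and> zeval U v = 0"
proof
  assume "\<exists>u \<in> Orc. holds_word t u"
  then obtain u where u: "u \<in> Orc" "holds_word t u" by blast
  have "length v < length u" if "t (int (length v)) \<noteq> 0"
  proof (rule ccontr)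
    assume "\<not> length v < length u"
    then have "length u < length v \<or> length u = length v" by auto
    with u(2) assms(2) that show False by (auto simp: holds_word_def)
  qed
  moreover have "u ! length v < length U" if "length v < length u"
    using u(1) nth_mem [OF that] by (auto simp: word_problem_def)
  ultimately have "t (int (length v)) = 0"
    using u(2) assms(3) by (auto simp: holds_word_def)
  then have "holds_word t v" using assms by (auto simp: holds_word_def)
  with u have "u = v" by (auto intro: holds_word_unique)
  with u \<open>t (int (length v)) = 0\<close> show "t (int (length v)) = 0 \<and> zeval U v = 0" by (simp add: word_problem_def)
next
  assume "t (int (length v)) = 0 \<and> zeval U v = 0"
  then have "holds_word t v" "v \<in> Orc"
    using assms by (auto simp: holds_word_def word_problem_def)
  then show "\<exists>u \<in> Orc. holds_word t u" by blast
qed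

lemma tracks_step_start:
  assumes "vstep l
      (Start, blank # blank # blank # blank # blank # blank # replicate K0 blank) = Some (q', ts')"
    "q' \<noteq> Trivial"
  shows "tracks (gens [l]) (q', ts')"
  using assms tracks.reading [of "[_]"] tape_of_word_snoc [of "[]"]
  by (auto simp: vstep_start gens_def split: instr.splits if_splits)

text \<open>
  Soundness of the verifier, one rule at a time. In each state only few instructions are applicable.
\<close>

lemma tracks_step:
  assumes "tracks w c" "vstep l c = Some (q', ts')"
    and "q' \<noteq> Trivial"
  shows "tracks (w @ gens [l]) (q', ts')"
  using assms(1)
proof cases
  case start
  with assms tracks_step_start show ?thesis by simp
next
  case reading
  show ?thesis
  proof (cases l)
    case (Gen i)
    with assms(2) reading have "i < n" by (auto simp: vstep_reading split: if_splits)
    with assms(2) reading Gen tracks.reading [of "w @ [i]"] show ?thesis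
      by (auto simp: vstep_reading gens_def tape_of_word_snoc add.commute)
  next
    case Go
    with assms(2) reading tracks.placing [of w] show ?thesis
      by (auto simp: vstep_reading gens_def tape_of_word_snoc point_def)
  qed (use assms reading in \<open>auto simp: vstep_reading\<close>)
next
  case (placing g)
  show ?thesis
  proof (cases l)
    case Go
    have "listed w g []" using placing by (simp add: listed_def)
    with assms(2) placing Go tracks.pairs [of w g "[]" 0] show ?thesis
      by (auto simp: vstep_placing gens_def)
  next
    case (HMove m)
    with assms(2) placing tracks.placing [of w] show ?thesis
      by (auto simp: vstep_placing gens_def)
  qed (use assms placing in \<open>auto simp: vstep_placing\<close>)
next
  case (pairs g l0 k)
  show ?thesis
  proof (cases l)
    case Go
    with assms(2) pairs have "k = 0" by (auto simp: vstep_pairs split: if_splits)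
    with assms(2) pairs Go tracks.word [of w g l0 "[]"] show ?thesis
      by (auto simp: vstep_pairs gens_def)
  next
    case Fin
    with assms(2) pairs have "k = 0" by (auto simp: vstep_pairs split: if_splits)
    with assms(2) pairs Fin tracks.rewind [of w g l0 "int (length (encode_listing l0)) - 1"]
    show ?thesis
      by (auto simp: vstep_pairs gens_def)
  next
    case (HMove m)
    have "move_head m (g + k) = g + move_head m k" by (cases m) auto
    with assms(2) pairs HMove tracks.pairs [of w g l0 "move_head m k"] show ?thesis
      by (auto simp: vstep_pairs gens_def)
  qed (use assms pairs in \<open>auto simp: vstep_pairs\<close>)
next
  case (word g l0 u)
  show ?thesis
  proof (cases l)
    case (Emit e)
    with assms(2) word have e: "e < n_letters M" by (auto simp: vstep_word split: if_splits)
    let ?s = "encode_listing l0 @ map (\<lambda>i. 2 * i) u"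
    have snoc: "(tape_of_word ?s)(int (length ?s) := Suc e) = tape_of_word (?s @ [e])"
      by (rule tape_of_word_snoc)
    show ?thesis
    proof (cases "even e")
      case True
      then obtain i where i: "e = 2 * i" by blast
      with assms(2) word Emit e have "i < length U" by (auto simp: vstep_word split: if_splits)
      with assms(2) word Emit e i snoc
        tracks.walk_word [of w g l0 "u @ [i]" "zeval U u" "U ! i"]
      show ?thesis
        by (auto simp: vstep_word gens_def zeval_snoc add.commute add.left_commute)
    next
      case False
      then obtain a where a: "e = 2 * a + 1" by (blast elim: oddE)
      with assms(2) word Emit e have "xtape w (g + zeval U u) = a"
        by (auto simp: vstep_word split: if_splits)
      with word e a have "listed w g (l0 @ [(u, a)])"
        by (auto simp: listed_def)
      with assms(2) word Emit e a snoc tracks.pairs [of w g "l0 @ [(u, a)]" "zeval U u"]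
      show ?thesis
        by (auto simp: vstep_word gens_def add.commute add.left_commute split: if_splits)
    qed
  qed (use assms word in \<open>auto simp: vstep_word\<close>)
next
  case (walk_word g l0 u k d)
  show ?thesis
  proof (cases l)
    case Go
    show ?thesis
    proof (cases "d = 0")
      case True
      with assms(2) walk_word Go tracks.word [of w g l0 u] show ?thesis
        by (auto simp: vstep_walk gens_def)
    next
      case False
      have "move_head (towards d) p = p + sgn d" for p
        using False by (auto simp: towards_def)
      with assms(2) walk_word Go False tracks.walk_word [of w g l0 u "k + sgn d" "d - sgn d"]
      show ?thesis
        by (auto simp: vstep_walk gens_def add.assoc)
    qed
  qed (use assms walk_word in \<open>auto simp: vstep_walk\<close>)
next
  case (rewind g l0 p)
  show ?thesis
  proof (cases l)
    case Go
    let ?s = "encode_listing l0"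
    show ?thesis
    proof (cases "p = -1")
      case True
      have "reached l0 (start_state M, (tape_of_word ?s, 0) # blank # replicate K0 blank)"
        unfolding reached_def by (intro exI [of _ 0]) (simp add: otm_init_two_tapes)
      with assms(2) rewind Go True tracks.sim [of w g l0] show ?thesis
        by (auto simp: vstep_rewind gens_def tape_of_word_def)
    next
      case False
      with rewind have "tape_of_word ?s p \<noteq> 0" by (auto simp: tape_of_word_def)
      with assms(2) rewind Go False tracks.rewind [of w g l0 "p - 1"] show ?thesis
        by (auto simp: vstep_rewind gens_def)
    qed
  qed (use assms rewind in \<open>auto simp: vstep_rewind\<close>)
next
  case (sim g l0 q a t z cs)
  have "l = Go \<and> q \<noteq> halt_state M"
  proof (rule ccontr)
    assume "\<not> (l = Go \<and> q \<noteq> halt_state M)"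
    then have "vstep l c = None"
      unfolding sim(1) by (intro vstep_sim_None) simp
    with assms(2) show False by simp
  qed
  then have l: "l = Go" "q \<noteq> halt_state M" by simp_all
  have regular: "regular (q, a # (t, z) # cs)"
    using sim regular_reached by (auto simp: listed_def)
  show ?thesis
  proof (cases "q = query_state M")
    case True
    with assms(2) sim l tracks.seek [of w g l0 a t z cs z] show ?thesis
      by (auto simp: vstep_sim_query gens_def point_def)
  next
    case False
    obtain p' acts where tr: "trans_fun M q (map read_tape (a # (t, z) # cs)) = (p', acts)"
      by force
    note wf = wf_trans [OF regular tr]
    then have "2 \<le> length acts"
      using wf_M by (simp add: wf_otm_def)
    then obtain a1 b m acts' where acts: "acts = a1 # (b, m) # acts'"
      by (cases acts; cases "tl acts") auto
    let ?next = "act_on_tape a a1 # (t(z := b), move_head m z) # map2 act_on_tape cs acts'"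
    have "map2 act_on_tape (a # (t, z) # cs) (a1 # (b, m) # acts') = ?next"
      by simp
    moreover have "otm_step Orc M (q, a # (t, z) # cs) =
        (p', map2 act_on_tape (a # (t, z) # cs) (a1 # (b, m) # acts'))"
      using l False tr acts by (simp add: read_tape_eq del: list.map)
    ultimately have st: "otm_step Orc M (q, a # (t, z) # cs) = (p', ?next)"
      by (rule subst)
    have "(q', ts') = (Sim p', (xtape w, g) # (point 0, 0) # (point 0, move_head m z) #
        (\<lambda>_. 0, move_head m z) # ?next)"
      using assms(2) sim l False wf(4)
        vstep_sim_other [OF l(2) False tr [unfolded acts] st, of "(xtape w, g)" "(point 0, 0)"]
      by simp
    moreover have r: "reached l0 (q, a # (t, z) # cs)" and w: "listed w g l0"
      using sim by blast+
    have "reached l0 (p', ?next)"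
      using reached_step [OF r] unfolding st .
    from tracks.sim [OF w this] have "tracks w (Sim p', (xtape w, g) # (point 0, 0) #
        (point 0, move_head m z) # (\<lambda>_. 0, move_head m z) # ?next)" .
    ultimately show ?thesis
      using l by (simp add: gens_def)
  qed
next
  case (seek g l0 a t p cs z)
  show ?thesis
  proof (cases l)
    case Go
    with assms(2) seek have "z = 0" by (auto simp: vstep_seek split: if_splits)
    with assms(2) seek Go tracks.scan [of w g l0 a t p cs "[]"] show ?thesis
      by (auto simp: vstep_seek gens_def)
  next
    case (TMove m)
    with assms(2) seek tracks.seek [of w g l0 a t p cs "move_head m z"] show ?thesis
      by (auto simp: vstep_seek gens_def)
  qed (use assms seek in \<open>auto simp: vstep_seek\<close>)
next
  case (scan g l0 a t p cs v)
  show ?thesis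
  proof (cases l)
    case Go
    let ?b = "t (int (length v))"
    show ?thesis
    proof (cases "?b = 0 \<or> length U < ?b")
      case True
      have answer: "(\<exists>u \<in> Orc. holds_word t u) \<longleftrightarrow> ?b = 0 \<and> zeval U v = 0"
        by (rule query_answer) (use scan True in blast)+
      let ?ans = "if \<exists>u \<in> Orc. holds_word t u then yes_state M else no_state M"
      have "vstep Go c = Some (Ret ?ans, snd c)"
        unfolding answer scan(1) vstep_scan using True by auto
      then have "(q', ts') = (Ret ?ans, snd c)"
        using assms(2) Go by simp
      moreover have "tracks w (Ret ?ans, snd c)"
        unfolding scan(1) snd_conv by (rule tracks.ret) (use scan in blast)+
      ultimately show ?thesis
        using Go by (simp add: gens_def)
    next
      case False
      define v' where "v' = v @ [?b - 1]"
      have len: "int (length v) + 1 = int (length v')"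
        by (simp add: v'_def)
      let ?c' = "(Walk True (U ! (?b - 1)), (xtape w, g + zeval U v) # (point 0, zeval U v) #
        (point 0, int (length v')) # (point p, int (length v')) # a # (t, int (length v')) # cs)"
      have "vstep Go c = Some ?c'"
        unfolding scan(1) vstep_scan len using False by simp
      moreover have "v' \<in> lists {..<length U}"
        using False scan by (auto simp: v'_def)
      moreover have "\<forall>i < length v'. t (int i) = Suc (v' ! i)"
        using False scan by (auto simp: v'_def nth_append less_Suc_eq)
      moreover have "zeval U v + U ! (?b - 1) = zeval U v'"
        by (simp add: v'_def zeval_snoc)
      ultimately have "vstep Go c = Some ?c' \<and> tracks w ?c'"
        using tracks.walk_scan [of w g l0 a t p cs v' "zeval U v"] scan by blast
      with assms(2) Go show ?thesis
        by (simp add: gens_def)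
    qed
  qed (use assms scan in \<open>auto simp: vstep_scan\<close>)
next
  case (walk_scan g l0 a t p cs v k d)
  show ?thesis
  proof (cases l)
    case Go
    show ?thesis
    proof (cases "d = 0")
      case True
      with walk_scan have "k = zeval U v" by simp
      with assms(2) walk_scan(1) Go True have "(q', ts') = (Scan, snd c)"
        by (simp add: vstep_walk)
      moreover have "tracks w (Scan, snd c)"
        unfolding walk_scan(1) snd_conv \<open>k = zeval U v\<close>
        by (rule tracks.scan) (use walk_scan in blast)+
      ultimately show ?thesis
        using Go by (simp add: gens_def)
    next
      case False
      let ?c' = "(Walk True (d - sgn d), (xtape w, g + (k + sgn d)) # (point 0, k + sgn d) #
        (point 0, int (length v)) # (point p, int (length v)) # a # (t, int (length v)) # cs)"
      have "vstep Go c = Some ?c'"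
        using False by (simp add: walk_scan(1) vstep_walk add.assoc)
      moreover have "k + sgn d + (d - sgn d) = zeval U v"
        using walk_scan by simp
      then have "tracks w ?c'"
        by (intro tracks.walk_scan [of w g l0 a t p cs v]) (use walk_scan in blast)+
      ultimately show ?thesis
        using assms(2) Go by (simp add: gens_def)
    qed
  qed (use assms walk_scan in \<open>auto simp: vstep_walk\<close>)
next
  case (ret g l0 a t p cs q k z)
  show ?thesis
  proof (cases l)
    case Go
    with assms(2) ret have z: "z = p" "k = 0" by (auto simp: vstep_ret split: if_splits)
    have r: "reached l0 (query_state M, a # (t, p) # cs)"
      using ret by blast
    have st: "otm_step Orc M (query_state M, a # (t, p) # cs) = (q, a # (t, p) # cs)"
      using ret by simp
    have "reached l0 (q, a # (t, p) # cs)"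
      using reached_step [OF r] unfolding st .
    moreover have "(point p)(p := 0) = (\<lambda>_. 0)" by (auto simp: point_def)
    ultimately show ?thesis
      using assms(2) ret(1,2) Go z tracks.sim [of w g l0 q a t p cs]
      by (simp add: vstep_ret gens_def)
  next
    case (HMove m)
    have "move_head m (g + k) = g + move_head m k" by (cases m) auto
    with assms(2) ret(1) HMove have "(q', ts') = (Ret q, (xtape w, g + move_head m k) #
        (point 0, move_head m k) # (point 0, z) # (point p, z) # a # (t, z) # cs)"
      by (simp add: vstep_ret)
    moreover have "tracks w \<dots>"
      by (rule tracks.ret) (use ret in blast)+
    ultimately show ?thesis
      using HMove by (simp add: gens_def)
  next
    case (TMove m)
    with assms(2) ret(1) have "(q', ts') = (Ret q, (xtape w, g + k) # (point 0, k) #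
        (point 0, move_head m z) # (point p, move_head m z) # a # (t, move_head m z) # cs)"
      by (simp add: vstep_ret)
    moreover have "tracks w \<dots>"
      by (rule tracks.ret) (use ret in blast)+
    ultimately show ?thesis
      using TMove by (simp add: gens_def)
  qed (use assms ret(1) in \<open>auto simp: vstep_ret\<close>)
qed

section \<open>Existence of certificates\<close>

text \<open>
  \<open>Trivial\<close> is only entered by the first instruction and has no successor.
\<close>

lemma tracks_run:
  assumes "script_run (verifier M U n) ls
      (Start, blank # blank # blank # blank # blank # blank # replicate K0 blank) = Some (q, ts)"
  shows "(q = Trivial \<and> (\<exists>l. ls = [l] \<and> gens [l] = [])) \<or> tracks (gens ls) (q, ts)"
  using assms
proof (induction ls arbitrary: q ts rule: rev_induct)
  case Nil
  then show ?case by (auto simp: gens_def intro: tracks.start)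
next
  case (snoc l ls)
  let ?c0 = "(Start, blank # blank # blank # blank # blank # blank # replicate K0 blank)"
  obtain q1 ts1 where c1: "script_run (verifier M U n) ls ?c0 = Some (q1, ts1)"
      "vstep l (q1, ts1) = Some (q, ts)"
    using snoc.prems
    by (auto simp: script_run_append vstep_def simp del: script_step.simps split: Option.bind_splits)
  from snoc.IH [OF c1(1)] show ?case
  proof
    assume "q1 = Trivial \<and> (\<exists>l. ls = [l] \<and> gens [l] = [])"
    then have "vstep l (q1, ts1) = None"
      by (auto simp: vstep_def verifier_def Let_def split: list.split)
    with c1 show ?thesis by simp
  next
    assume tr: "tracks (gens ls) (q1, ts1)"
    show ?thesis
    proof (cases "q = Trivial")
      case False
      with tracks_step [OF tr c1(2)] show ?thesis by simp
    next
      case True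
      have "q1 = Start \<and> gens [l] = []"
        using c1(2) True
        by (auto simp: vstep_def verifier_def Let_def gens_def
            split: list.splits ctl.splits instr.splits if_splits option.splits prod.splits)
      moreover have "ls = []"
      proof -
        from tr calculation have "script_run (verifier M U n) ls ?c0 = Some (Start, ts1)"
          using c1 by simp
        then show ?thesis
        proof (cases ls rule: rev_cases)
          case (snoc ls' l')
          with c1 calculation obtain c' where "vstep l' c' = Some (Start, ts1)"
            by (auto simp: script_run_append vstep_def simp del: script_step.simps split: Option.bind_splits)
          then show ?thesis
            by (cases c') (auto simp: vstep_def verifier_def Let_def
              split: list.splits ctl.splits instr.splits if_splits option.splits prod.splits)
        qed
      qed
      ultimately show ?thesis using True by simp
    qed
  qed
qed

definition cert_letters :: "instr list" where
  "cert_letters = [Go, Fin] @ map HMove [Go_Left, Stay, Go_Right] @ map TMove [Go_Left, Stay, Go_Right]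
     @ map Emit [0..<n_letters M]"

text \<open>
  The remaining task is to exhibit a script for each word that has one. Scripts are composed through
  the relation \<open>reach\<close>, which hides them; \<open>Gen\<close> is excluded because after the word has been read only
  instructions may follow.
\<close>

definition reach :: "ctl \<times> tape list \<Rightarrow> ctl \<times> tape list \<Rightarrow> bool" where
  "reach c c' \<longleftrightarrow>
     (\<exists>ls. set ls \<subseteq> set cert_letters \<and> script_run (verifier M U n) ls c = Some c')"

lemma reach_refl [simp]: "reach c c"
  unfolding reach_def by (rule exI [of _ "[]"]) simp

lemma reach_trans [trans]: "reach c c' \<Longrightarrow> reach c' c'' \<Longrightarrow> reach c c''"
proof -
  assume "reach c c'" "reach c' c''"
  then obtain u v where "set u \<subseteq> set cert_letters" "script_run (verifier M U n) u c = Some c'"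
      "set v \<subseteq> set cert_letters" "script_run (verifier M U n) v c' = Some c''"
    unfolding reach_def by blast
  then show "reach c c''"
    unfolding reach_def by (intro exI [of _ "u @ v"]) (simp add: script_run_append)
qed

lemma reach_step: "vstep l c = Some c' \<Longrightarrow> l \<in> set cert_letters \<Longrightarrow> reach c c'"
  unfolding reach_def by (intro exI [of _ "[l]"]) (simp add: vstep_def del: script_step.simps)

lemma cert_letters [simp]:
  "Go \<in> set cert_letters" "Fin \<in> set cert_letters"
  "HMove m \<in> set cert_letters" "TMove m \<in> set cert_letters"
  "Emit e \<in> set cert_letters \<longleftrightarrow> e < n_letters M"
  by (cases m; auto simp: cert_letters_def)+

text \<open>
  Free moves in both directions reach every position. This covers each place where the verifier
  has to find a mark.
\<close>

lemma reach_shift: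
  assumes "\<And>p. reach (f p) (f (p + 1))" "\<And>p. reach (f p) (f (p - 1))"
  shows "reach (f (p :: int)) (f q)"
proof -
  have "reach (f p) (f (p + int k))" "reach (f p) (f (p - int k))" for k
  proof (induction k)
    case (Suc k)
    have "p + int (Suc k) = p + int k + 1" "p - int (Suc k) = p - int k - 1" by auto
    then show "reach (f p) (f (p + int (Suc k)))" "reach (f p) (f (p - int (Suc k)))"
      using Suc assms(1) [of "p + int k"] assms(2) [of "p - int k"] reach_trans by metis+
  qed simp_all
  then have "reach (f p) (f (p + int (nat (q - p))))" "reach (f p) (f (p - int (nat (p - q))))"
    by blast+
  then show ?thesis by (cases "p \<le> q") auto
qed

lemma reach_walk:
  "reach (Walk s d, (x, p) # (h, k) # Z # R # A # B # C)
     (if s then Scan else Word, (x, p + d) # (h, k + d) # Z # R # A # B # C)"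
proof (induction "nat \<bar>d\<bar>" arbitrary: d p k)
  case 0
  then show ?case by (intro reach_step [of Go]) (simp_all add: vstep_walk)
next
  case (Suc j)
  then have "reach (Walk s (d - sgn d), (x, p + sgn d) # (h, k + sgn d) # Z # R # A # B # C)
     (if s then Scan else Word,
      (x, p + sgn d + (d - sgn d)) # (h, k + sgn d + (d - sgn d)) # Z # R # A # B # C)"
    by (intro Suc.hyps(1)) (auto simp: sgn_if split: if_splits)
  moreover have "reach (Walk s d, (x, p) # (h, k) # Z # R # A # B # C)
      (Walk s (d - sgn d), (x, p + sgn d) # (h, k + sgn d) # Z # R # A # B # C)"
    using Suc by (intro reach_step [of Go]) (auto simp: vstep_walk)
  ultimately show ?case by (auto intro: reach_trans)
qed

lemma reach_placing:
  "reach (Placing, (x, p) # H # Z # R # A # B # C) (Placing, (x, q) # H # Z # R # A # B # C)"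
  by (rule reach_shift [of "\<lambda>p. (Placing, (x, p) # H # Z # R # A # B # C)"])
    (rule reach_step [of "HMove Go_Right"] reach_step [of "HMove Go_Left"]; simp add: vstep_placing)+

lemma reach_pairs_home:
  "reach (Pairs, (x, g + k) # (h, k) # Z # R # (a, e) # B # C)
     (Pairs, (x, g) # (h, 0) # Z # R # (a, e) # B # C)"
proof -
  have "reach (Pairs, (x, g + k) # (h, k) # Z # R # (a, e) # B # C)
      (Pairs, (x, g + 0) # (h, 0) # Z # R # (a, e) # B # C)"
    by (rule reach_shift [of "\<lambda>k. (Pairs, (x, g + k) # (h, k) # Z # R # (a, e) # B # C)"])
      (rule reach_step [of "HMove Go_Right"] reach_step [of "HMove Go_Left"]; simp add: vstep_pairs)+
  then show ?thesis by simp
qed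

lemma reach_seek:
  "reach (Seek, X # H # (z, p) # (r, p) # A # (b, p) # C)
     (Seek, X # H # (z, q) # (r, q) # A # (b, q) # C)"
  by (rule reach_shift [of "\<lambda>p. (Seek, X # H # (z, p) # (r, p) # A # (b, p) # C)"])
    (rule reach_step [of "TMove Go_Right"] reach_step [of "TMove Go_Left"]; simp add: vstep_seek)+

lemma reach_ret_tape:
  "reach (Ret s, (x, i) # (h, k) # (z, p) # (r, p) # A # (b, p) # C)
     (Ret s, (x, i) # (h, k) # (z, q) # (r, q) # A # (b, q) # C)"
  by (rule reach_shift [of "\<lambda>p. (Ret s, (x, i) # (h, k) # (z, p) # (r, p) # A # (b, p) # C)"])
    (rule reach_step [of "TMove Go_Right"] reach_step [of "TMove Go_Left"]; simp add: vstep_ret)+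

lemma reach_ret_home:
  "reach (Ret s, (x, g + k) # (h, k) # (z, p) # (r, y) # A # (b, q) # C)
     (Ret s, (x, g) # (h, 0) # (z, p) # (r, y) # A # (b, q) # C)"
proof -
  have "reach (Ret s, (x, g + k) # (h, k) # (z, p) # (r, y) # A # (b, q) # C)
      (Ret s, (x, g + 0) # (h, 0) # (z, p) # (r, y) # A # (b, q) # C)"
    by (rule reach_shift [of "\<lambda>k. (Ret s, (x, g + k) # (h, k) # (z, p) # (r, y) # A # (b, q) # C)"])
      (rule reach_step [of "HMove Go_Right"] reach_step [of "HMove Go_Left"]; simp add: vstep_ret)+
  then show ?thesis by simp
qed

lemma reach_word:
  assumes "u \<in> lists {..<length U}" "map (\<lambda>i. 2 * i) u \<in> lists {..<n_letters M}"
  shows "reach (Word, (x, p) # (h, k) # Z # R # (tape_of_word s, int (length s)) # B # C)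
     (Word, (x, p + zeval U u) # (h, k + zeval U u) # Z # R #
        (tape_of_word (s @ map (\<lambda>i. 2 * i) u), int (length (s @ map (\<lambda>i. 2 * i) u))) # B # C)"
  using assms
proof (induction u rule: rev_induct)
  case (snoc i u)
  let ?s = "s @ map (\<lambda>i. 2 * i) u" and ?s' = "s @ map (\<lambda>i. 2 * i) (u @ [i])"
  have i: "i < length U" "2 * i < n_letters M" using snoc.prems by auto
  have t: "(tape_of_word ?s)(int (length ?s) := Suc (2 * i)) = tape_of_word ?s'"
    using tape_of_word_snoc [of ?s "2 * i"] by simp
  have len: "int (length ?s) + 1 = int (length ?s')" by simp
  have "reach (Word, (x, p) # (h, k) # Z # R # (tape_of_word s, int (length s)) # B # C)
     (Word, (x, p + zeval U u) # (h, k + zeval U u) # Z # R #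
        (tape_of_word ?s, int (length ?s)) # B # C)"
    using snoc by simp
  also have "reach \<dots> (Walk False (U ! i), (x, p + zeval U u) # (h, k + zeval U u) # Z # R #
        (tape_of_word ?s', int (length ?s')) # B # C)"
    using i t len by (intro reach_step [of "Emit (2 * i)"]) (simp_all add: vstep_word)
  also have "reach \<dots> (Word, (x, p + zeval U u + U ! i) # (h, k + zeval U u + U ! i) # Z # R #
        (tape_of_word ?s', int (length ?s')) # B # C)"
    using reach_walk [of False] by simp
  finally show ?case by (simp add: zeval_snoc add.assoc)
qed simp

lemma reach_pairs:
  assumes "\<forall>(u, a) \<in> set l. u \<in> lists {..<length U} \<and> x (g + zeval U u) = a"
    and "encode_listing l \<in> lists {..<n_letters M}"
  shows "reach (Pairs, (x, g) # (point 0, 0) # Z # R # blank # B # C)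
     (Pairs, (x, g) # (point 0, 0) # Z # R #
        (tape_of_word (encode_listing l), int (length (encode_listing l))) # B # C)"
  using assms
proof (induction l rule: rev_induct)
  case (snoc ua l)
  obtain u a where ua: "ua = (u, a)" by force
  let ?s = "encode_listing l" and ?u = "map (\<lambda>i. 2 * i) u"
  have u: "u \<in> lists {..<length U}" "?u \<in> lists {..<n_letters M}" "2 * a + 1 < n_letters M"
    and a: "x (g + zeval U u) = a" and "?s \<in> lists {..<n_letters M}"
    using snoc.prems by (auto simp: ua)
  have t: "(tape_of_word (?s @ ?u))(int (length (?s @ ?u)) := Suc (2 * a + 1)) =
      tape_of_word (encode_listing (l @ [ua]))"
    using tape_of_word_snoc [of "?s @ ?u" "2 * a + 1"] by (simp add: ua)
  have len: "int (length (?s @ ?u)) + 1 = int (length (encode_listing (l @ [ua])))"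
    by (simp add: ua)
  have "reach (Pairs, (x, g) # (point 0, 0) # Z # R # blank # B # C)
     (Pairs, (x, g) # (point 0, 0) # Z # R # (tape_of_word ?s, int (length ?s)) # B # C)"
    using snoc \<open>?s \<in> lists {..<n_letters M}\<close> by simp
  also have "reach \<dots> (Word, (x, g) # (point 0, 0) # Z # R # (tape_of_word ?s, int (length ?s)) # B # C)"
    by (rule reach_step [of Go]) (simp_all add: vstep_pairs)
  also have "reach \<dots> (Word, (x, g + zeval U u) # (point 0, 0 + zeval U u) # Z # R #
      (tape_of_word (?s @ ?u), int (length (?s @ ?u))) # B # C)"
    by (rule reach_word [OF u(1,2)])
  also have "reach \<dots> (Pairs, (x, g + zeval U u) # (point 0, 0 + zeval U u) # Z # R #
      (tape_of_word (encode_listing (l @ [ua])), int (length (encode_listing (l @ [ua])))) # B # C)"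
    using u(3) a t len by (intro reach_step [of "Emit (2 * a + 1)"]) (simp_all add: vstep_word)
  also have "reach \<dots> (Pairs, (x, g) # (point 0, 0) # Z # R #
      (tape_of_word (encode_listing (l @ [ua])), int (length (encode_listing (l @ [ua])))) # B # C)"
    using reach_pairs_home [of x g "zeval U u"] by simp
  finally show ?case .
qed simp

lemma reach_rewind:
  assumes "-1 \<le> p" "p < int (length s)"
  shows "reach (Rewind, X # H # Z # R # (tape_of_word s, p) # B # C)
     (Sim (start_state M), X # H # Z # R # (tape_of_word s, 0) # B # C)"
  using assms
proof (induction "nat (p + 1)" arbitrary: p)
  case 0
  then have "p = -1" by simp
  then show ?case
    by (intro reach_step [of Go]) (simp_all add: vstep_rewind tape_of_word_def)
next
  case (Suc j)
  then have "tape_of_word s p \<noteq> 0" by (simp add: tape_of_word_def)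
  then have "reach (Rewind, X # H # Z # R # (tape_of_word s, p) # B # C)
      (Rewind, X # H # Z # R # (tape_of_word s, p - 1) # B # C)"
    by (intro reach_step [of Go]) (simp_all add: vstep_rewind)
  also have "reach \<dots> (Sim (start_state M), X # H # Z # R # (tape_of_word s, 0) # B # C)"
    using Suc by (intro Suc.hyps(1)) auto
  finally show ?case .
qed

lemma reach_scan:
  assumes "v \<in> lists {..<length U}" "\<forall>i < length v. t (int i) = Suc (v ! i)"
  shows "reach (Scan, (x, g) # (h, 0) # (z, 0) # (r, 0) # A # (t, 0) # C)
    (Scan, (x, g + zeval U v) # (h, zeval U v) # (z, int (length v)) # (r, int (length v)) # A #
       (t, int (length v)) # C)"
  using assms
proof (induction v rule: rev_induct)
  case (snoc i v)
  have "t (int (length v)) = Suc i" "i < length U"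
    using snoc.prems by auto
  have prev: "\<forall>j < length v. t (int j) = Suc (v ! j)"
    using snoc.prems(2) by (auto simp: nth_append split: if_splits)
  let ?k = "int (length v)"
  have "reach (Scan, (x, g) # (h, 0) # (z, 0) # (r, 0) # A # (t, 0) # C)
    (Scan, (x, g + zeval U v) # (h, zeval U v) # (z, ?k) # (r, ?k) # A # (t, ?k) # C)"
    using snoc prev by simp
  also have "reach \<dots> (Walk True (U ! i), (x, g + zeval U v) # (h, zeval U v) # (z, ?k + 1) #
      (r, ?k + 1) # A # (t, ?k + 1) # C)"
    using \<open>t ?k = Suc i\<close> \<open>i < length U\<close>
    by (intro reach_step [of Go]) (simp_all add: vstep_scan)
  also have "reach \<dots> (Scan, (x, g + zeval U v + U ! i) # (h, zeval U v + U ! i) # (z, ?k + 1) #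
      (r, ?k + 1) # A # (t, ?k + 1) # C)"
    using reach_walk [of True] by simp
  finally show ?case by (simp add: zeval_snoc ac_simps)
qed simp


text \<open>
  One oracle query is replaced by a walk to cell 0, a scan up to the first cell that is not a letter
  over \<open>U\<close>, and a walk back.
\<close>

lemma reach_query:
  assumes "query_state M \<noteq> halt_state M" and fin: "finite {z. t z \<noteq> (0 :: nat)}"
  shows "reach (Sim (query_state M), (x, g) # (point 0, 0) # (point 0, p) # (\<lambda>_. 0, p) # A # (t, p) # C)
    (Sim (if \<exists>v \<in> Orc. holds_word t v then yes_state M else no_state M),
      (x, g) # (point 0, 0) # (point 0, p) # (\<lambda>_. 0, p) # A # (t, p) # C)"
    (is "reach ?c (Sim ?ans, ?ts)")
proof -
  define stop where "stop j \<longleftrightarrow> t (int j) = 0 \<or> length U < t (int j)" for j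
  have "finite {j. t (int j) \<noteq> 0}"
    by (rule finite_imageD [of int]) (auto intro: finite_subset [OF _ fin] simp: inj_on_def)
  from ex_new_if_finite [OF infinite_UNIV_nat this] obtain j where "t (int j) = 0"
    by auto
  then have ex: "\<exists>j. stop j" unfolding stop_def by blast
  \<comment> \<open>\<open>N\<close> is the cell at which the scan stops\<close>
  define N where "N = (LEAST j. stop j)"
  have before: "\<not> stop j" if "j < N" for j
    using not_less_Least [of j stop] that by (simp add: N_def)
  have stopN: "stop N" using LeastI_ex [OF ex] by (simp add: N_def)
  define v where "v = map (\<lambda>j. t (int j) - 1) [0..<N]"
  have v: "v \<in> lists {..<length U}" "\<forall>i < length v. t (int i) = Suc (v ! i)" "length v = N"
    using before by (fastforce simp: v_def stop_def)+
  have ans: "(\<exists>u \<in> Orc. holds_word t u) \<longleftrightarrow> t (int N) = 0 \<and> zeval U v = 0"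
    using query_answer [OF v(1,2)] stopN v(3) by (simp add: stop_def)
  have "reach ?c (Seek, (x, g) # (point 0, 0) # (point 0, p) # (point p, p) # A # (t, p) # C)"
    using assms(1) by (intro reach_step [of Go]) (simp_all add: vstep_sim_query point_def)
  also have "reach \<dots> (Seek, (x, g) # (point 0, 0) # (point 0, 0) # (point p, 0) # A # (t, 0) # C)"
    by (rule reach_seek)
  also have "reach \<dots> (Scan, (x, g) # (point 0, 0) # (point 0, 0) # (point p, 0) # A # (t, 0) # C)"
    by (rule reach_step [of Go]) (simp_all add: vstep_seek)
  also have "reach \<dots> (Scan, (x, g + zeval U v) # (point 0, zeval U v) # (point 0, int N) #
      (point p, int N) # A # (t, int N) # C)"
    using reach_scan [OF v(1,2)] v(3) by simp
  also have "reach \<dots> (Ret ?ans, (x, g + zeval U v) # (point 0, zeval U v) # (point 0, int N) #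
      (point p, int N) # A # (t, int N) # C)"
    unfolding ans using stopN by (intro reach_step [of Go]) (auto simp: vstep_scan stop_def)
  also have "reach \<dots> (Ret ?ans, (x, g + zeval U v) # (point 0, zeval U v) # (point 0, p) #
      (point p, p) # A # (t, p) # C)"
    by (rule reach_ret_tape)
  also have "reach \<dots> (Ret ?ans, (x, g) # (point 0, 0) # (point 0, p) # (point p, p) # A # (t, p) # C)"
    by (rule reach_ret_home)
  also have "reach \<dots> (Sim ?ans, ?ts)"
    by (rule reach_step [of Go]) (simp_all add: vstep_ret, simp add: point_def fun_eq_iff)
  finally show ?thesis .
qed

lemma reach_sim:
  assumes l: "encode_listing l \<in> lists {..<n_letters M}"
    and "(otm_step Orc M ^^ j) (otm_init M (encode_listing l)) = (q, a # (t, z) # cs)"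
  shows "reach (Sim (start_state M), (x, g) # (point 0, 0) # (point 0, 0) # (\<lambda>_. 0, 0) #
      (tape_of_word (encode_listing l), 0) # blank # replicate K0 blank)
    (Sim q, (x, g) # (point 0, 0) # (point 0, z) # (\<lambda>_. 0, z) # a # (t, z) # cs)"
  using assms(2)
proof (induction j arbitrary: q a t z cs)
  case 0
  then show ?case by (auto simp: otm_init_two_tapes)
next
  case (Suc j)
  let ?init = "(Sim (start_state M), (x, g) # (point 0, 0) # (point 0, 0) # (\<lambda>_. 0, 0) #
      (tape_of_word (encode_listing l), 0) # blank # replicate K0 blank)"
  obtain q1 ts1 where c1: "(otm_step Orc M ^^ j) (otm_init M (encode_listing l)) = (q1, ts1)"
    by force
  then have r: "reached l (q1, ts1)" by (auto simp: reached_def)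
  have regular: "regular (q1, ts1)" by (rule regular_reached [OF l r])
  then have "length ts1 = n_tapes M" "2 \<le> n_tapes M"
    using wf_M by (auto simp: regular_def wf_otm_def)
  then obtain a1 t1 z1 cs1 where ts1: "ts1 = a1 # (t1, z1) # cs1"
    by (cases ts1; cases "tl ts1") auto
  have IH: "reach ?init (Sim q1, (x, g) # (point 0, 0) # (point 0, z1) # (\<lambda>_. 0, z1) # ts1)"
    using Suc.IH c1 ts1 by simp
  have st: "otm_step Orc M (q1, ts1) = (q, a # (t, z) # cs)"
    using Suc.prems c1 by simp
  consider "q1 = halt_state M" | "q1 \<noteq> halt_state M" "q1 = query_state M"
    | "q1 \<noteq> halt_state M" "q1 \<noteq> query_state M" by blast
  then show ?case
  proof cases
    case 1
    with st IH ts1 show ?thesis by simp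
  next
    case 2
    have "finite {z. t1 z \<noteq> 0}"
      using regular by (simp add: regular_def ts1)
    from reach_query [OF _ this, of x g z1 a1 cs1] 2 st IH ts1 show ?thesis
      by (auto intro: reach_trans)
  next
    case 3
    obtain p' acts where tr: "trans_fun M q1 (map read_tape (a1 # (t1, z1) # cs1)) = (p', acts)"
      by force
    note wf = wf_trans [OF regular [unfolded ts1] tr]
    then have "2 \<le> length acts"
      using wf_M by (simp add: wf_otm_def)
    then obtain x1 b m acts' where acts: "acts = x1 # (b, m) # acts'"
      by (cases acts; cases "tl acts") auto
    have "otm_step Orc M (q1, a1 # (t1, z1) # cs1) = (p', map2 act_on_tape (a1 # (t1, z1) # cs1) acts)"
      using 3 tr by (simp add: read_tape_eq del: list.map)
    with st ts1 acts have "p' = q" "z = move_head m z1" by auto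
    have "vstep Go (Sim q1, (x, g) # (point 0, 0) # (point 0, z1) # (\<lambda>_. 0, z1) # a1 # (t1, z1) # cs1) =
        Some (Sim q, (x, g) # (point 0, 0) # (point 0, z) # (\<lambda>_. 0, z) # a # (t, z) # cs)"
      using vstep_sim_other [OF 3 tr [unfolded acts \<open>p' = q\<close>] st [unfolded ts1]] wf(4)
      unfolding \<open>z = move_head m z1\<close> by simp
    then show ?thesis
      using IH ts1 reach_step [of Go] reach_trans by simp
  qed
qed

lemma reach_halt:
  assumes "listed w g l" "otm_halts Orc M (encode_listing l)"
  shows "\<exists>ts. reach (Reading, (tape_of_word w, int (length w)) # blank # blank # blank # blank #
      blank # replicate K0 blank) (Sim (halt_state M), ts)"
proof -
  let ?s = "encode_listing l"
  obtain j ts where j: "(otm_step Orc M ^^ j) (otm_init M ?s) = (halt_state M, ts)"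
    using assms(2) unfolding otm_halts_def by (metis prod.collapse)
  have l: "?s \<in> lists {..<n_letters M}"
    and m: "\<forall>(u, a) \<in> set l. u \<in> lists {..<length U} \<and> xtape w (g + zeval U u) = a"
    using assms(1) by (auto simp: listed_def)
  have "regular (halt_state M, ts)"
    using regular_reached [OF l] j by (auto simp: reached_def)
  then have "length ts = n_tapes M" "2 \<le> n_tapes M"
    using wf_M by (auto simp: regular_def wf_otm_def)
  then obtain a t z cs where ts: "ts = a # (t, z) # cs"
    by (cases ts; cases "tl ts") auto
  have "reach (Reading, (tape_of_word w, int (length w)) # blank # blank # blank # blank #
      blank # replicate K0 blank)
    (Placing, (xtape w, int (length w)) # (point 0, 0) # (point 0, 0) # blank # blank #
      blank # replicate K0 blank)"
    by (rule reach_step [of Go]) (simp_all add: vstep_reading tape_of_word_snoc point_def)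
  also have "reach \<dots> (Placing, (xtape w, g) # (point 0, 0) # (point 0, 0) # blank # blank #
      blank # replicate K0 blank)"
    by (rule reach_placing)
  also have "reach \<dots> (Pairs, (xtape w, g) # (point 0, 0) # (point 0, 0) # blank # blank #
      blank # replicate K0 blank)"
    by (rule reach_step [of Go]) (simp_all add: vstep_placing)
  also have "reach \<dots> (Pairs, (xtape w, g) # (point 0, 0) # (point 0, 0) # blank #
      (tape_of_word ?s, int (length ?s)) # blank # replicate K0 blank)"
    by (rule reach_pairs [OF m l])
  also have "reach \<dots> (Rewind, (xtape w, g) # (point 0, 0) # (point 0, 0) # blank #
      (tape_of_word ?s, int (length ?s) - 1) # blank # replicate K0 blank)"
    by (rule reach_step [of Fin]) (simp_all add: vstep_pairs)
  also have "reach \<dots> (Sim (start_state M), (xtape w, g) # (point 0, 0) # (point 0, 0) # blank #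
      (tape_of_word ?s, 0) # blank # replicate K0 blank)"
    by (rule reach_rewind) auto
  also have "reach \<dots> (Sim (halt_state M), (xtape w, g) # (point 0, 0) # (point 0, z) #
      (\<lambda>_. 0, z) # a # (t, z) # cs)"
    using reach_sim [OF l] j ts by blast
  finally show ?thesis by blast
qed

lemma run_reading:
  assumes "w \<in> lists {..<n}" "w \<noteq> []"
  shows "script_run (verifier M U n) (map Gen w)
      (Start, blank # blank # blank # blank # blank # blank # replicate K0 blank) =
    Some (Reading, (tape_of_word w, int (length w)) # blank # blank # blank # blank # blank #
      replicate K0 blank)"
  using assms
proof (induction w rule: rev_induct)
  case (snoc i w)
  then have i: "i < n" and w: "w \<in> lists {..<n}" by auto
  have first: "script_step (verifier M U n) (Gen i) = vstep (Gen i)" by (simp add: vstep_def)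
  show ?case
  proof (cases "w = []")
    case True
    with i show ?thesis
      using tape_of_word_snoc [of "[]" i]
      by (simp add: first vstep_start del: script_step.simps)
  next
    case False
    with snoc.IH w have "script_run (verifier M U n) (map Gen w)
      (Start, blank # blank # blank # blank # blank # blank # replicate K0 blank) =
    Some (Reading, (tape_of_word w, int (length w)) # blank # blank # blank # blank # blank #
      replicate K0 blank)" by simp
    with i show ?thesis
      using tape_of_word_snoc [of w i]
      by (simp add: script_run_append first vstep_reading del: script_step.simps)
  qed
qed simp

section \<open>The relators accepted by the verifier\<close>

text \<open>
  A walk covers at most the absolute value of a single entry of \<open>U\<close>, so finitely many states suffice.
\<close>

definition ctls :: "ctl set" where
  "ctls = {q. case q of
     Walk s d \<Rightarrow> \<bar>d\<bar> \<le> sum_list (map abs U)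
   | Sim p \<Rightarrow> p < n_states M
   | Ret p \<Rightarrow> p < n_states M
   | _ \<Rightarrow> True}"

lemma finite_ctls: "finite ctls"
proof (rule finite_subset)
  let ?D = "sum_list (map abs U)"
  show "ctls \<subseteq> {Start, Reading, Trivial, Placing, Pairs, Word, Rewind, Seek, Scan} \<union>
      (\<Union>s. Walk s ` {- ?D..?D}) \<union> Sim ` {..<n_states M} \<union> Ret ` {..<n_states M}"
  proof
    fix q assume "q \<in> ctls"
    then show "q \<in> {Start, Reading, Trivial, Placing, Pairs, Word, Rewind, Seek, Scan} \<union>
        (\<Union>s. Walk s ` {- ?D..?D}) \<union> Sim ` {..<n_states M} \<union> Ret ` {..<n_states M}"
    proof (cases q)
      case (Walk s d)
      with \<open>q \<in> ctls\<close> have "d \<in> {- ?D..?D}"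
        by (auto simp: ctls_def)
      then have "q \<in> (\<Union>s. Walk s ` {- ?D..?D})"
        unfolding Walk by blast
      then show ?thesis by blast
    qed (auto simp: ctls_def)
  qed
qed auto

text \<open>
  The numbering of the instructions. It puts \<open>Gen i\<close> at place \<open>i\<close>, so that a word over \<open>S\<close> is literally the
  beginning of a script.
\<close>

definition letters :: "instr list" where
  "letters = map Gen [0..<n] @ cert_letters"

text \<open>
  Any number above all tape symbols of the verifier and above the number of letters would do.
\<close>

definition bound :: nat where
  "bound = n_symbols M + n_letters M + n + length letters + 3"

lemma abs_nth_le: "i < length U \<Longrightarrow> \<bar>U ! i\<bar> \<le> sum_list (map abs U)"
  by (rule member_le_sum_list) auto

lemma wf_verifier: "wf_rules (verifier M U n) letters (Suc (Suc (Suc (Suc (n_tapes M))))) bound ctls"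
  unfolding wf_rules_def
proof (intro ballI allI impI)
  fix l q rs q' acts
  assume l: "l \<in> set letters" and q: "q \<in> ctls" and len: "length rs = Suc (Suc (Suc (Suc (n_tapes M))))"
    and rs: "set rs \<subseteq> {..<bound}" and step: "verifier M U n l q rs = Some (q', acts)"
  have two: "2 \<le> n_tapes M" using wf_M by (simp add: wf_otm_def)
  then obtain k where "n_tapes M = Suc (Suc k)"
    by (metis add_2_eq_Suc le_Suc_ex)
  with len obtain x h z r a b cs where rs': "rs = x # h # z # r # a # b # cs"
    by (auto simp: length_Suc_conv)
  have states: "start_state M < n_states M" "yes_state M < n_states M" "no_state M < n_states M"
    using wf_M by (auto simp: wf_otm_def)
  have len': "Suc (Suc (length cs)) = n_tapes M" using len rs' by simp
  have small: "Suc n < bound" "0 < bound" "1 < bound" "\<And>i. i < n \<Longrightarrow> Suc i < bound"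
      "\<And>e. e < n_letters M \<Longrightarrow> Suc e < bound" "\<And>e. e < n_symbols M \<Longrightarrow> e < bound"
    by (auto simp: bound_def)
  show "q' \<in> ctls \<and> length acts = Suc (Suc (Suc (Suc (n_tapes M)))) \<and> (\<forall>(b, m)\<in>set acts. b < bound)"
  proof (cases "\<exists>p. q = Sim p \<and> p \<noteq> query_state M")
    case False
    have bnd: "x < bound" "h < bound" "z < bound" "r < bound" "a < bound" "b < bound"
        "\<And>y. y \<in> set cs \<Longrightarrow> y < bound"
      using rs rs' by auto
    show ?thesis
    proof (cases q)
      case Start
      with step show ?thesis
        unfolding rs' using bnd len' q states small
        by (cases l) (auto simp: verifier_def Let_def keep_def ctls_def abs_nth_le sgn_if split: if_splits)
    next
      case Reading
      with step show ?thesis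
        unfolding rs' using bnd len' q states small
        by (cases l) (auto simp: verifier_def Let_def keep_def ctls_def abs_nth_le sgn_if split: if_splits)
    next
      case Trivial
      with step show ?thesis
        unfolding rs' using bnd len' q states small
        by (cases l) (auto simp: verifier_def Let_def keep_def ctls_def abs_nth_le sgn_if split: if_splits)
    next
      case Placing
      with step show ?thesis
        unfolding rs' using bnd len' q states small
        by (cases l) (auto simp: verifier_def Let_def keep_def ctls_def abs_nth_le sgn_if split: if_splits)
    next
      case Pairs
      with step show ?thesis
        unfolding rs' using bnd len' q states small
        by (cases l) (auto simp: verifier_def Let_def keep_def ctls_def abs_nth_le sgn_if split: if_splits)
    next
      case Word
      with step show ?thesis
        unfolding rs' using bnd len' q states small
        by (cases l) (auto simp: verifier_def Let_def keep_def ctls_def abs_nth_le sgn_if split: if_splits)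
    next
      case (Walk s d)
      with step show ?thesis
        unfolding rs' using bnd len' q states small
        by (cases l) (auto simp: verifier_def Let_def keep_def ctls_def abs_nth_le sgn_if split: if_splits)
    next
      case Rewind
      with step show ?thesis
        unfolding rs' using bnd len' q states small
        by (cases l) (auto simp: verifier_def Let_def keep_def ctls_def abs_nth_le sgn_if split: if_splits)
    next
      case (Sim p)
      with step show ?thesis
        unfolding rs' using bnd len' q states small False
        by (cases l) (auto simp: verifier_def Let_def keep_def ctls_def abs_nth_le sgn_if split: if_splits)
    next
      case Seek
      with step show ?thesis
        unfolding rs' using bnd len' q states small
        by (cases l) (auto simp: verifier_def Let_def keep_def ctls_def abs_nth_le sgn_if split: if_splits)
    next
      case Scan
      with step show ?thesis
        unfolding rs' using bnd len' q states small
        by (cases l) (auto simp: verifier_def Let_def keep_def ctls_def abs_nth_le sgn_if split: if_splits)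
    next
      case (Ret p)
      with step show ?thesis
        unfolding rs' using bnd len' q states small
        by (cases l) (auto simp: verifier_def Let_def keep_def ctls_def abs_nth_le sgn_if split: if_splits)
    qed
  next
    case True
    then obtain p where p: "q = Sim p" "p \<noteq> query_state M" by blast
    have l: "l = Go"
      using step unfolding rs' p(1) by (cases l) (simp_all add: verifier_def Let_def)
    have sub: "set (a # b # cs) \<subseteq> {..<n_symbols M}"
    proof (rule ccontr)
      assume "\<not> ?thesis"
      with p(2) have "verifier M U n l q rs = None"
        unfolding rs' p(1) l by (auto simp: verifier_def Let_def)
      with step show False by simp
    qed
    obtain p' as where tr: "trans_fun M p (a # b # cs) = (p', as)" by force
    have "p < n_states M" using q p by (simp add: ctls_def)
    then have ok: "p' < n_states M" "length as = n_tapes M" "fst ` set as \<subseteq> {..<n_symbols M}"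
      using wf_otm_trans [OF wf_M _ _ sub tr] len' by simp_all
    have "q' = Sim p'" "acts = keep x # keep h # (z, snd (as ! 1)) # (r, snd (as ! 1)) # as"
      using step p rs' tr l by (auto simp: verifier_def Let_def split: if_splits)
    with ok rs rs' small(6) show ?thesis
      by (auto simp: keep_def ctls_def image_subset_iff split_beta)
  qed
qed


lemma gens_letters:
  assumes "u \<in> lists {..<length letters}"
  shows "gens (map ((!) letters) u) = filter (\<lambda>i. i < n) u"
  using assms
proof (induction u)
  case (Cons i u)
  have "letters ! i = (if i < n then Gen i else cert_letters ! (i - n))"
    by (auto simp: letters_def nth_append)
  moreover have "gens [l] = []" if "l \<in> set cert_letters" for l
    using that by (auto simp: cert_letters_def gens_def)
  moreover have "cert_letters ! (i - n) \<in> set cert_letters" if "\<not> i < n"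
    using Cons.hyps that by (auto simp: letters_def)
  ultimately have "gens [letters ! i] = (if i < n then [i] else [])"
    by (auto simp: gens_def)
  moreover have "gens (map ((!) letters) (i # u)) = gens [letters ! i] @ gens (map ((!) letters) u)"
    by (simp add: gens_def)
  ultimately show ?case
    using Cons.IH by simp
qed (simp add: gens_def)

lemma n_le_letters: "n \<le> length letters"
  by (simp add: letters_def)

text \<open>
  These are the relators of the presentation.
\<close>

definition scripts :: "nat list set" where
  "scripts = {u \<in> lists {..<length letters}.
     script_accepts None (verifier M U n) (Suc (Suc (Suc (Suc (n_tapes M))))) Start
       {Trivial, Sim (halt_state M)} (map ((!) letters) u)}"

lemma blank_tapes_eq:
  "blank_tapes (Suc (Suc (Suc (Suc (n_tapes M))))) =
    blank # blank # blank # blank # blank # blank # replicate K0 blank"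
  using wf_M by (cases "n_tapes M"; cases "n_tapes M - 1")
    (auto simp: wf_otm_def blank_tapes_def)

theorem recursively_enumerable_scripts: "recursively_enumerable scripts"
proof -
  have "length letters < bound" by (simp add: bound_def)
  from re_script_accepts [OF finite_ctls _ _ this wf_verifier, of Start "{}" False]
  show ?thesis
    by (simp add: recursively_enumerable_def scripts_def ctls_def)
qed

theorem scripts_sound:
  assumes "u \<in> scripts" "filter (\<lambda>i. i < n) u \<noteq> []"
  shows "\<exists>l g. listed (filter (\<lambda>i. i < n) u) g l \<and> otm_halts Orc M (encode_listing l)"
proof -
  let ?c0 = "(Start, blank # blank # blank # blank # blank # blank # replicate K0 blank)"
  from assms obtain q ts where run: "script_run (verifier M U n) (map ((!) letters) u) ?c0 = Some (q, ts)"
      and q: "q = Trivial \<or> q = Sim (halt_state M)" and u: "u \<in> lists {..<length letters}"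
    by (auto simp: scripts_def script_accepts_def blank_tapes_eq)
  have "tracks (filter (\<lambda>i. i < n) u) (q, ts)"
    using tracks_run [OF run] assms(2) gens_letters [OF u] by force
  then show ?thesis
    using q
  proof cases
    case (sim g l q0 a t z cs)
    with q have "reached l (halt_state M, a # (t, z) # cs)" by simp
    then have "otm_halts Orc M (encode_listing l)"
      unfolding reached_def otm_halts_def by (metis fst_conv)
    with sim show ?thesis by blast
  qed simp_all
qed

theorem scripts_trivial:
  assumes "n \<le> i" "i < length letters"
  shows "[i] \<in> scripts"
proof -
  have "letters ! i \<in> set cert_letters"
    using assms by (auto simp: letters_def nth_append)
  then have "vstep (letters ! i) (Start, blank # blank # blank # blank # blank # blank # replicate K0 blank) =
      Some (Trivial, blank # blank # blank # blank # blank # blank # replicate K0 blank)"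
    by (auto simp: vstep_start cert_letters_def)
  then show ?thesis
    using assms
    by (simp add: scripts_def script_accepts_def blank_tapes_eq vstep_def del: script_step.simps)
qed

theorem scripts_complete:
  assumes "listed w g l" "w \<noteq> []" "otm_halts Orc M (encode_listing l)"
  shows "\<exists>v \<in> lists {n..<length letters}. w @ v \<in> scripts"
proof -
  have w: "w \<in> lists {..<n}" using assms(1) by (simp add: listed_def)
  obtain ts ls where ls: "set ls \<subseteq> set cert_letters"
      "script_run (verifier M U n) ls (Reading, (tape_of_word w, int (length w)) # blank # blank #
         blank # blank # blank # replicate K0 blank) = Some (Sim (halt_state M), ts)"
    using reach_halt [OF assms(1,3)] unfolding reach_def by blast
  have "\<exists>v \<in> lists {n..<length letters}. map ((!) letters) v = ls"
    using ls(1)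
  proof (induction ls)
    case (Cons l ls)
    then obtain v where v: "v \<in> lists {n..<length letters}" "map ((!) letters) v = ls" by auto
    obtain i where "i < length cert_letters" "cert_letters ! i = l"
      using Cons.prems by (auto simp: in_set_conv_nth)
    then have "letters ! (n + i) = l" "n + i < length letters"
      by (simp_all add: letters_def nth_append)
    with v show ?case by (intro bexI [of _ "(n + i) # v"]) auto
  qed (rule bexI [of _ "[]"]; simp)
  then obtain v where v: "v \<in> lists {n..<length letters}" "map ((!) letters) v = ls" by blast
  have w_letters: "map ((!) letters) w = map Gen w"
    using w by (auto simp: letters_def nth_append)
  have "script_run (verifier M U n) (map ((!) letters) (w @ v))
      (Start, blank # blank # blank # blank # blank # blank # replicate K0 blank) =
      Some (Sim (halt_state M), ts)"
    unfolding map_append script_run_append w_letters v(2) run_reading [OF w assms(2)] using ls(2) by simp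
  moreover have "w @ v \<in> lists {..<length letters}"
    using w v n_le_letters by auto
  ultimately have "w @ v \<in> scripts"
    unfolding scripts_def script_accepts_def blank_tapes_eq by (auto simp del: map_append)
  with v show ?thesis by blast
qed

end

section \<open>A reader for the codings of relators\<close>

text \<open>
  The input is a coding of \<open>0 w $\<close>, and its group words are blocks. The block for the \<open>i\<close>-th letter
  (counted from 0) is \<open>t e\<^sup>i p\<^sup>i\<^sup>+\<^sup>1\<close>, where \<open>e\<close> stands for the identity, \<open>p\<close> for \<open>(\<one>, 1)\<close> and \<open>t\<close> is a word of
  trivial value that depends on the previous letter of \<open>w\<close>. The letters of \<open>t\<close> are read in phase
  \<open>Echo\<close>, the power of \<open>e\<close> in phase \<open>Back\<close>, and the power of \<open>p\<close> in the phases \<open>Step\<close> (inside a copy of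
  \<open>p\<close>) and \<open>Count\<close> (between two copies).
\<close>

datatype phase = Begin | Back | Step "nat list" | Count | Echo "(nat \<times> bool) list" | Done

abbreviation evens :: "nat list \<Rightarrow> nat list" where
  "evens u \<equiv> map (\<lambda>i. 2 * i) u"

text \<open>
  The counter tape: cell \<open>0\<close> carries the mark \<open>1\<close>, and the \<open>k\<close> letters read so far have left a mark \<open>2\<close>
  each. Reading a power of \<open>e\<close> brings the head back to cell \<open>0\<close>; reading the power of \<open>p\<close> brings it to the
  first blank cell, which is at distance \<open>k + 1\<close>. So a step moves the head by at most one cell, and the
  exponents are forced.
\<close>

definition marks :: "nat \<Rightarrow> int \<Rightarrow> nat" where
  "marks k z = (if z = 0 then 1 else if 0 < z \<and> z \<le> int k then 2 else 0)"

text \<open>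
  \<open>q s\<close> is a word for the generator \<open>s\<close> and \<open>q' s\<close> one for its inverse.
\<close>

locale code_reader =
  fixes n m e :: nat and p :: "nat list" and q q' :: "nat \<Rightarrow> nat list"
  assumes e: "e < m" and p: "p \<noteq> []" "p \<in> lists {..<m}"
    and q: "\<And>s. s < n \<Longrightarrow> q s \<in> lists {..<m}" "\<And>s. s < n \<Longrightarrow> q' s \<in> lists {..<m}"
begin

text \<open>
  The flag tells whether a letter is copied to the oracle tape. The word \<open>q s\<close> is copied and then undone
  by \<open>q' s\<close>, so the block keeps its value although it transmits \<open>q s\<close>. The final \<open>e\<close> makes the list
  nonempty.
\<close>

definition echo :: "nat \<Rightarrow> (nat \<times> bool) list" where
  "echo s = map (\<lambda>x. (x, True)) (q s) @ map (\<lambda>x. (x, False)) (q' s @ [e])"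

definition powers :: "nat \<Rightarrow> nat list" where
  "powers k = concat (replicate k p)"

text \<open>
  The generator \<open>s\<close> is known to the machine only after the symbol that ends a block, so its echo is put
  at the beginning of the next block. Hence the block depends on the letters before it.
\<close>

definition block :: "nat list \<Rightarrow> nat list" where
  "block w = (if w = [] then [] else map fst (echo (last w))) @
     replicate (length w) e @ powers (Suc (length w))"

definition listing :: "nat list \<Rightarrow> (nat list \<times> nat) list" where
  "listing w = ([], 0) # map (\<lambda>i. (block (take i w), Suc (w ! i))) [0..<length w]"

lemma listing_snoc: "listing (w @ [s]) = listing w @ [(block w, Suc s)]"
  by (simp add: listing_def nth_append)

text \<open>
  The marker \<open>n\<close> is treated as a last letter, so that the codings of interest are \<open>code (w @ [n])\<close>.
\<close>

definition code :: "nat list \<Rightarrow> nat list" where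
  "code w = encode_listing (listing w)"

lemma code_Nil: "code [] = [1]"
  by (simp add: code_def listing_def)

lemma code_snoc: "code (w @ [s]) = code w @ evens (block w) @ [2 * Suc s + 1]"
  by (simp add: code_def listing_snoc)

definition next_step :: "nat list \<Rightarrow> nat \<Rightarrow> nat \<Rightarrow> phase \<times> (nat \<times> move) list" where
  "next_step ps r d =
     (if ps = [] then (Count, [keep r, (d, Go_Right)]) else (Step ps, [keep r, keep d]))"

definition reader :: "(nat, phase) rules" where
  "reader l ph rs =
     (case rs of [r, d] \<Rightarrow>
       (case ph of
          Begin \<Rightarrow> if l = 1 then Some (Back, [keep r, (1, Stay)]) else None
        | Back \<Rightarrow>
            if d = 1 then (if l = 2 * hd p then Some (next_step (tl p) r d) else None)
            else if l = 2 * e then Some (Back, [keep r, (d, Go_Left)]) else None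
        | Step ps \<Rightarrow>
            (case ps of [] \<Rightarrow> None
             | x # ps \<Rightarrow> if l = 2 * x then Some (next_step ps r d) else None)
        | Count \<Rightarrow>
            if d \<noteq> 0 then (if l = 2 * hd p then Some (next_step (tl p) r d) else None)
            else if l = 2 * Suc n + 1 then Some (Done, [keep r, keep d])
            else if odd l \<and> 1 < l \<and> l < 2 * Suc n + 1
            then Some (Echo (echo ((l - 3) div 2)), [keep r, (2, Stay)])
            else None
        | Echo xs \<Rightarrow>
            (case xs of [] \<Rightarrow> None
             | (x, b) # xs \<Rightarrow>
                 if l = 2 * x
                 then Some (if xs = [] then Back else Echo xs,
                        [if b then (Suc x, Go_Right) else keep r, keep d])
                 else None)
        | Done \<Rightarrow> None)
      | _ \<Rightarrow> None)"

text \<open>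
  What has to be read before the next symbol, when the head of the counter tape is at cell \<open>c\<close> and \<open>k\<close>
  letters have been read. The reader is deterministic: the next input letter must be
  the first pending one. This yields soundness and completeness at once.
\<close>

fun pending :: "phase \<Rightarrow> nat \<Rightarrow> nat \<Rightarrow> nat list" where
  "pending Back c k = replicate c e @ powers (Suc k)"
| "pending (Step ps) c k = ps @ powers (k - c)"
| "pending Count c k = powers (Suc k - c)"
| "pending (Echo xs) c k = map fst xs @ replicate k e @ powers (Suc k)"
| "pending _ c k = []"

fun position_ok :: "phase \<Rightarrow> nat \<Rightarrow> nat \<Rightarrow> bool" where
  "position_ok Back c k \<longleftrightarrow> c \<le> k"
| "position_ok (Step ps) c k \<longleftrightarrow> ps \<noteq> [] \<and> c \<le> k"
| "position_ok Count c k \<longleftrightarrow> 0 < c \<and> c \<le> Suc k"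
| "position_ok (Echo xs) c k \<longleftrightarrow> xs \<noteq> [] \<and> c = k"
| "position_ok _ c k \<longleftrightarrow> False"

fun unsent :: "phase \<Rightarrow> nat list" where
  "unsent (Echo xs) = map fst (filter snd xs)"
| "unsent _ = []"

definition query_word :: "nat list \<Rightarrow> nat list" where
  "query_word w = concat (map q w)"

definition conf :: "phase \<Rightarrow> nat list \<Rightarrow> nat list \<Rightarrow> nat \<Rightarrow> phase \<times> tape list" where
  "conf ph out w c = (ph, [(tape_of_word out, int (length out)), (marks (length w), int c)])"

text \<open>
  The input \<open>u\<close> read so far, completed by the pending letters, is the coding of \<open>w\<close> followed by one more
  block; the output \<open>out\<close>, completed by the letters still to be copied, is the query for \<open>w\<close>.
\<close>

definition reads :: "nat list \<Rightarrow> nat list \<Rightarrow> phase \<Rightarrow> nat list \<Rightarrow> nat \<Rightarrow> bool" where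
  "reads u w ph out c \<longleftrightarrow> w \<in> lists {..<n} \<and> position_ok ph c (length w) \<and>
     u @ evens (pending ph c (length w)) = code w @ evens (block w) \<and>
     out @ unsent ph = query_word w"

lemma powers_Suc: "powers (Suc k) = hd p # tl p @ powers k"
  using p(1) by (simp add: powers_def)

lemma powers_0 [simp]: "powers 0 = []"
  by (simp add: powers_def)

lemma marks_0 [simp]: "marks k 0 = 1"
  by (simp add: marks_def)

lemma script_step_pending:
  assumes "reads u w ph out c" "pending ph c (length w) = x # xs"
  shows "\<exists>ph' out' c'.
    (\<forall>l. script_step reader l (conf ph out w c) = (if l = 2 * x then Some (conf ph' out' w c') else None)) \<and>
    reads (u @ [2 * x]) w ph' out' c' \<and> pending ph' c' (length w) = xs"
proof (cases ph)
  case Begin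
  with assms show ?thesis by simp
next
  case Done
  with assms show ?thesis by simp
next
  case Back
  show ?thesis
  proof (cases c)
    case 0
    let ?ph = "if tl p = [] then Count else Step (tl p)" and ?c = "if tl p = [] then Suc c else c"
    from Back 0 assms have x: "x = hd p" "xs = tl p @ powers (length w)"
      by (auto simp: powers_Suc)
    have "script_step reader l (conf ph out w c) = (if l = 2 * x then Some (conf ?ph out w ?c) else None)" for l
      using x Back 0
      by (auto simp: reader_def conf_def next_step_def tape_of_word_def)
    moreover have "pending ?ph ?c (length w) = xs"
      using x 0 by auto
    moreover have "reads (u @ [2 * x]) w ?ph out ?c"
      using assms x 0 Back by (auto simp: reads_def powers_Suc)
    ultimately show ?thesis by blast
  next
    case (Suc c1)
    from Back Suc assms have x: "x = e" "xs = replicate c1 e @ powers (Suc (length w))" "c \<le> length w"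
      by (auto simp: reads_def)
    have "script_step reader l (conf ph out w c) = (if l = 2 * x then Some (conf Back out w c1) else None)" for l
      using x Back Suc by (auto simp: reader_def conf_def marks_def tape_of_word_def)
    moreover have "reads (u @ [2 * x]) w Back out c1"
      using assms x Suc Back by (auto simp: reads_def)
    moreover have "pending Back c1 (length w) = xs"
      using x by simp
    ultimately show ?thesis by blast
  qed
next
  case (Step ps)
  with assms obtain ps' where ps: "ps = x # ps'" "xs = ps' @ powers (length w - c)" "c \<le> length w"
    by (cases ps) (auto simp: reads_def)
  let ?ph = "if ps' = [] then Count else Step ps'" and ?c = "if ps' = [] then Suc c else c"
  have "script_step reader l (conf ph out w c) = (if l = 2 * x then Some (conf ?ph out w ?c) else None)" for l
    using ps Step
    by (auto simp: reader_def conf_def next_step_def tape_of_word_def)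
  moreover have "pending ?ph ?c (length w) = xs"
    using ps by auto
  moreover have "reads (u @ [2 * x]) w ?ph out ?c"
    using assms ps Step by (auto simp: reads_def)
  ultimately show ?thesis by blast
next
  case Count
  let ?ph = "if tl p = [] then Count else Step (tl p)" and ?c = "if tl p = [] then Suc c else c"
  have c: "c \<le> length w" "0 < c"
    using Count assms by (auto simp: reads_def not_less_eq_eq intro: ccontr)
  then have "Suc (length w) - c = Suc (length w - c)" by simp
  with Count assms have x: "x = hd p" "xs = tl p @ powers (length w - c)"
    by (auto simp: powers_Suc)
  have "script_step reader l (conf ph out w c) = (if l = 2 * x then Some (conf ?ph out w ?c) else None)" for l
    using x Count c
    by (auto simp: reader_def conf_def next_step_def tape_of_word_def marks_def)
  moreover have "pending ?ph ?c (length w) = xs"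
    using x by auto
  moreover have "reads (u @ [2 * x]) w ?ph out ?c"
    using assms x Count c \<open>Suc (length w) - c = _\<close> by (auto simp: reads_def powers_Suc)
  ultimately show ?thesis by blast
next
  case (Echo ys)
  with assms obtain b ys' where ys: "ys = (x, b) # ys'"
      "xs = map fst ys' @ replicate (length w) e @ powers (Suc (length w))" "c = length w"
    by (cases ys) (auto simp: reads_def)
  let ?ph = "if ys' = [] then Back else Echo ys'" and ?out = "if b then out @ [x] else out"
  have "script_step reader l (conf ph out w c) = (if l = 2 * x then Some (conf ?ph ?out w c) else None)" for l
    using ys Echo tape_of_word_snoc [of out x]
    by (auto simp: reader_def conf_def tape_of_word_def)
  moreover have "pending ?ph c (length w) = xs"
    using ys by auto
  moreover have "reads (u @ [2 * x]) w ?ph ?out c"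
    using assms ys Echo by (auto simp: reads_def)
  ultimately show ?thesis by blast
qed

lemma block_snoc:
  "block (w @ [s]) = map fst (echo s) @ replicate (Suc (length w)) e @ powers (Suc (Suc (length w)))"
  by (simp add: block_def)

lemma pending_Nil:
  assumes "reads u w ph out c" "pending ph c (length w) = []"
  shows "ph = Count \<and> c = Suc (length w)"
  using assms by (cases ph) (auto simp: reads_def powers_Suc Suc_diff_le le_Suc_eq)

lemma marks_Suc: "(marks k)(int (Suc k) := 2) = marks (Suc k)"
  by (auto simp: marks_def fun_eq_iff)

lemma script_step_letter:
  assumes "reads u w ph out c" "pending ph c (length w) = []" "s < n"
  shows "script_step reader (2 * Suc s + 1) (conf ph out w c) = Some (conf (Echo (echo s)) out (w @ [s]) c)"
    and "reads (u @ [2 * Suc s + 1]) (w @ [s]) (Echo (echo s)) out c"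
proof -
  note ph = pending_Nil [OF assms(1,2)]
  show "script_step reader (2 * Suc s + 1) (conf ph out w c) = Some (conf (Echo (echo s)) out (w @ [s]) c)"
    using ph assms(3) marks_Suc [of "length w"]
    by (auto simp: reader_def conf_def tape_of_word_def marks_def)
  show "reads (u @ [2 * Suc s + 1]) (w @ [s]) (Echo (echo s)) out c"
    using assms ph
    by (auto simp: reads_def code_snoc block_snoc query_word_def echo_def filter_map o_def)
qed

lemma script_step_final:
  assumes "reads u w ph out c" "pending ph c (length w) = []"
  shows "script_step reader (2 * Suc n + 1) (conf ph out w c) = Some (conf Done out w c)"
    and "u @ [2 * Suc n + 1] = code (w @ [n])" "out = query_word w"
  using pending_Nil [OF assms] assms
  by (auto simp: reader_def conf_def tape_of_word_def marks_def reads_def code_snoc)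

lemma script_step_other:
  assumes "reads u w ph out c" "pending ph c (length w) = []"
    "script_step reader l (conf ph out w c) = Some c'"
  shows "\<exists>s \<le> n. l = 2 * Suc s + 1"
proof -
  have "odd l" "1 < l" "l \<le> 2 * Suc n + 1"
    using pending_Nil [OF assms(1,2)] assms(3)
    by (auto simp: reader_def conf_def tape_of_word_def marks_def split: if_splits)
  then show ?thesis
    by (intro exI [of _ "(l - 3) div 2"]) presburger
qed

lemma script_step_begin:
  "script_step reader l (Begin, [blank, blank]) = (if l = 1 then Some (conf Back [] [] 0) else None)"
  by (auto simp: reader_def conf_def marks_def fun_eq_iff keep_def)

lemma reads_begin: "reads [1] [] Back [] 0"
  by (simp add: reads_def code_Nil block_def query_word_def)

lemma run_sound:
  assumes "script_run reader u (Begin, [blank, blank]) = Some c"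
  shows "u = [] \<and> c = (Begin, [blank, blank]) \<or> (\<exists>w ph out k. c = conf ph out w k \<and>
     (reads u w ph out k \<or> ph = Done \<and> w \<in> lists {..<n} \<and> u = code (w @ [n]) \<and> out = query_word w))"
  using assms
proof (induction u arbitrary: c rule: rev_induct)
  case (snoc l u)
  then obtain c1 where c1: "script_run reader u (Begin, [blank, blank]) = Some c1"
      "script_step reader l c1 = Some c"
    by (auto simp: script_run_append simp del: script_step.simps split: Option.bind_splits)
  from snoc.IH [OF c1(1)] consider "u = []" "c1 = (Begin, [blank, blank])"
    | w ph out k where "c1 = conf ph out w k" "reads u w ph out k"
    | w out k where "c1 = conf Done out w k" by blast
  then show ?case
  proof cases
    case 1
    with c1(2) have "l = 1" "c = conf Back [] [] 0"
      by (auto simp only: script_step_begin split: if_splits)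
    with 1 reads_begin show ?thesis by fastforce
  next
    case (2 w ph out k)
    show ?thesis
    proof (cases "pending ph k (length w)")
      case Nil
      obtain s where s: "s \<le> n" "l = 2 * Suc s + 1"
        using script_step_other [OF 2(2) Nil] c1(2) 2(1) by blast
      show ?thesis
      proof (cases "s = n")
        case True
        then have l: "l = 2 * Suc n + 1" using s by simp
        have "c = conf Done out w k"
          using c1(2) unfolding 2(1) l script_step_final(1) [OF 2(2) Nil] by simp
        moreover have "w \<in> lists {..<n}"
          using 2(2) by (simp add: reads_def)
        ultimately show ?thesis
          using script_step_final(2,3) [OF 2(2) Nil] unfolding l by blast
      next
        case False
        with s have "s < n" by simp
        note step = script_step_letter [OF 2(2) Nil this]
        have "c = conf (Echo (echo s)) out (w @ [s]) k"
          using c1(2) unfolding 2(1) s(2) step(1) by simp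
        with step(2) show ?thesis
          unfolding s(2) by blast
      qed
    next
      case (Cons x xs)
      obtain ph' out' c' where *:
        "\<forall>l. script_step reader l (conf ph out w k) = (if l = 2 * x then Some (conf ph' out' w c') else None)"
        "reads (u @ [2 * x]) w ph' out' c'"
        using script_step_pending [OF 2(2) Cons] by blast
      have "l = 2 * x" "c = conf ph' out' w c'"
        using c1(2) unfolding 2(1) *(1) [rule_format] by (auto split: if_splits)
      with *(2) show ?thesis by blast
    qed
  next
    case (3 w out k)
    with c1(2) show ?thesis by (simp add: conf_def reader_def)
  qed
qed simp

lemma run_pending:
  assumes "reads u w ph out c"
    and "script_run reader u (Begin, [blank, blank]) = Some (conf ph out w c)"
  shows "\<exists>ph' out' c'. reads (code w @ evens (block w)) w ph' out' c' \<and> pending ph' c' (length w) = [] \<and>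
    script_run reader (code w @ evens (block w)) (Begin, [blank, blank]) = Some (conf ph' out' w c')"
  using assms
proof (induction "pending ph c (length w)" arbitrary: u ph out c)
  case Nil
  then have "u = code w @ evens (block w)"
    by (simp add: reads_def)
  with Nil show ?case by metis
next
  case (Cons x xs)
  obtain ph' out' c' where *:
    "\<forall>l. script_step reader l (conf ph out w c) = (if l = 2 * x then Some (conf ph' out' w c') else None)"
    "reads (u @ [2 * x]) w ph' out' c'" "pending ph' c' (length w) = xs"
    using script_step_pending [OF Cons.prems(1) Cons.hyps(2) [symmetric]] by blast
  have "script_run reader (u @ [2 * x]) (Begin, [blank, blank]) = Some (conf ph' out' w c')"
    using Cons.prems(2) *(1) by (simp add: script_run_append del: script_step.simps)
  from Cons.hyps(1) [OF *(3) [symmetric] *(2) this] show ?case .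
qed

lemma run_complete:
  assumes "w \<in> lists {..<n}"
  shows "\<exists>ph out c. reads (code w @ evens (block w)) w ph out c \<and> pending ph c (length w) = [] \<and>
    script_run reader (code w @ evens (block w)) (Begin, [blank, blank]) = Some (conf ph out w c)"
  using assms
proof (induction w rule: rev_induct)
  case Nil
  show ?case
    using run_pending [OF reads_begin] script_step_begin [of 1]
    by (simp del: script_step.simps)
next
  case (snoc s w)
  then obtain ph out c where IH: "reads (code w @ evens (block w)) w ph out c"
      "pending ph c (length w) = []"
      "script_run reader (code w @ evens (block w)) (Begin, [blank, blank]) = Some (conf ph out w c)"
    by auto
  have "s < n" using snoc.prems by simp
  note step = script_step_letter [OF IH(1,2) this]
  have "script_run reader ((code w @ evens (block w)) @ [2 * Suc s + 1]) (Begin, [blank, blank]) =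
      Some (conf (Echo (echo s)) out (w @ [s]) c)"
    using IH(3) step(1) unfolding script_run_append [of _ _ "[_]"] by (simp del: script_step.simps)
  from run_pending [OF step(2) this] show ?case .
qed


definition letter_count :: nat where
  "letter_count = 2 * m + 2 * n + 4"

text \<open>
  Only suffixes of \<open>p\<close> and of the lists \<open>echo s\<close> occur; bounding the length gives a simpler finite set.
\<close>

definition phases :: "phase set" where
  "phases = {ph. case ph of
     Step ps \<Rightarrow> set ps \<subseteq> {..<m} \<and> length ps \<le> length p
   | Echo xs \<Rightarrow> set xs \<subseteq> {..<m} \<times> UNIV \<and> length xs \<le> (\<Sum>s<n. length (echo s))
   | _ \<Rightarrow> True}"

lemma finite_phases: "finite phases"
proof (rule finite_subset)
  let ?A = "{ps. set ps \<subseteq> {..<m} \<and> length ps \<le> length p}"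
  let ?B = "{xs. set xs \<subseteq> {..<m} \<times> (UNIV :: bool set) \<and> length xs \<le> (\<Sum>s<n. length (echo s))}"
  show "phases \<subseteq> {Begin, Back, Count, Done} \<union> Step ` ?A \<union> Echo ` ?B"
  proof
    fix ph assume "ph \<in> phases"
    then show "ph \<in> {Begin, Back, Count, Done} \<union> Step ` ?A \<union> Echo ` ?B"
      by (cases ph) (auto simp: phases_def)
  qed
  show "finite ({Begin, Back, Count, Done} \<union> Step ` ?A \<union> Echo ` ?B)"
    by (simp add: finite_lists_length_le)
qed

lemma echo_phases:
  assumes "s < n" shows "Echo (echo s) \<in> phases"
proof -
  have "length (echo s) \<le> (\<Sum>s<n. length (echo s))"
    using assms by (intro member_le_sum) auto
  moreover have "set (echo s) \<subseteq> {..<m} \<times> UNIV"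
    using q [OF assms] e by (auto simp: echo_def)
  ultimately show ?thesis by (simp add: phases_def)
qed

lemma next_step_ok:
  assumes "set ps \<subseteq> {..<m}" "length ps \<le> length p" "r < B" "d < B"
  shows "fst (next_step ps r d) \<in> phases \<and> length (snd (next_step ps r d)) = 2 \<and>
    (\<forall>(b, m) \<in> set (snd (next_step ps r d)). b < B)"
  using assms by (auto simp: next_step_def phases_def keep_def)

lemma wf_reader: "wf_rules reader [0..<letter_count] 2 (Suc letter_count) phases"
  unfolding wf_rules_def
proof (intro ballI allI impI)
  fix l ph rs ph' acts
  assume ph: "ph \<in> phases" and len: "length rs = 2" and rs: "set rs \<subseteq> {..<Suc letter_count}"
    and step: "reader l ph rs = Some (ph', acts)"
  obtain r d where rs': "rs = [r, d]"
    using len by (auto simp: numeral_2_eq_2 length_Suc_conv)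
  have rd: "r < Suc letter_count" "d < Suc letter_count" using rs rs' by auto
  have small: "2 < Suc letter_count" "\<And>x. x < m \<Longrightarrow> Suc x < Suc letter_count"
    by (auto simp: letter_count_def)
  have tl: "set (tl p) \<subseteq> {..<m}" "length (tl p) \<le> length p"
    using p by (cases p; auto)+
  note ok = next_step_ok [OF _ _ rd]
  show "ph' \<in> phases \<and> length acts = 2 \<and> (\<forall>(b, m) \<in> set acts. b < Suc letter_count)"
  proof (cases ph)
    case Begin
    with step rs' rd small show ?thesis
      by (auto simp: reader_def phases_def keep_def split: if_splits)
  next
    case Back
    with step rs' rd small ok [OF tl] show ?thesis
      by (auto simp: reader_def phases_def keep_def split: if_splits)
  next
    case (Step ps)
    then obtain x ps' where ps: "ps = x # ps'"
      using step rs' by (cases ps) (auto simp: reader_def)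
    have "set ps' \<subseteq> {..<m}" "length ps' \<le> length p"
      using ph Step ps by (auto simp: phases_def)
    from ok [OF this] step rs' Step ps show ?thesis
      by (auto simp: reader_def split: if_splits)
  next
    case Count
    show ?thesis
    proof (cases "d = 0 \<and> l \<noteq> 2 * Suc n + 1")
      case False
      with Count step rs' rd ok [OF tl] show ?thesis
        by (auto simp: reader_def phases_def keep_def split: if_splits)
    next
      case True
      with Count step rs' have "1 < l" "l < 2 * Suc n + 1" "odd l"
          "ph' = Echo (echo ((l - 3) div 2))" "acts = [keep r, (2, Stay)]"
        by (auto simp: reader_def split: if_splits)
      moreover from this have "(l - 3) div 2 < n" by presburger
      ultimately show ?thesis
        using echo_phases rd small by (simp add: keep_def)
    qed
  next
    case (Echo xs)
    then obtain x b xs' where xs: "xs = (x, b) # xs'"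
      using step rs' by (cases xs) (auto simp: reader_def)
    have "set xs' \<subseteq> {..<m} \<times> UNIV" "length xs' \<le> (\<Sum>s<n. length (echo s))" "x < m"
      using ph Echo xs by (auto simp: phases_def)
    with step rs' Echo xs rd small(2) show ?thesis
      by (auto simp: reader_def phases_def keep_def split: if_splits)
  next
    case Done
    with step rs' show ?thesis by (simp add: reader_def)
  qed
qed

lemma holds_word_tape_of_word: "holds_word (tape_of_word v) w \<longleftrightarrow> w = v"
proof -
  have "holds_word (tape_of_word v) v"
    by (simp add: holds_word_def tape_of_word_def)
  then show ?thesis by (auto intro: holds_word_unique)
qed

lemma code_in_lists: "w \<in> lists {..<Suc n} \<Longrightarrow> butlast w \<in> lists {..<n} \<Longrightarrow> code w \<in> lists {..<letter_count}"
proof (induction w rule: rev_induct)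
  case Nil
  then show ?case by (simp add: code_Nil letter_count_def)
next
  case (snoc s w)
  have w: "w \<in> lists {..<n}" using snoc.prems by simp
  then have "butlast w \<in> lists {..<n}" "w \<in> lists {..<Suc n}"
    by (auto dest: in_set_butlastD)
  with snoc.IH have IH: "code w \<in> lists {..<letter_count}" by blast
  have "block w \<in> lists {..<m}"
  proof (cases "w = []")
    case False
    then have "last w < n" using w by auto
    with False show ?thesis
      using q [of "last w"] p e by (auto simp: block_def echo_def powers_def)
  qed (use p in \<open>auto simp: block_def powers_def\<close>)
  then have "evens (block w) \<in> lists {..<letter_count}"
    by (fastforce simp: letter_count_def)
  with IH snoc.prems show ?case
    by (auto simp: code_snoc letter_count_def)
qed

text \<open>
  Whatever the oracle, it is consulted once, for the word that has been copied.
\<close>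

theorem re_codes:
  "re_with_oracle Orc {code (w @ [n]) | w. w \<in> lists {..<n} \<and> query_word w \<in> Orc}"
proof -
  have map_letters: "map ((!) [0..<letter_count]) u = u" if "u \<in> lists {..<letter_count}" for u
    using that by (auto simp: map_idI)
  have "script_accepts (Some Orc) reader 2 Begin {Done} u \<longleftrightarrow>
      (\<exists>w. u = code (w @ [n]) \<and> w \<in> lists {..<n} \<and> query_word w \<in> Orc)" for u
  proof
    assume "script_accepts (Some Orc) reader 2 Begin {Done} u"
    then obtain ts v where run: "script_run reader u (Begin, [blank, blank]) = Some (Done, ts)"
        and v: "v \<in> Orc" "holds_word (fst (hd ts)) v"
      by (auto simp: script_accepts_def blank_tapes_def numeral_2_eq_2)
    from run_sound [OF run] obtain w k where "ts = snd (conf Done (query_word w) w k)"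
        "w \<in> lists {..<n}" "u = code (w @ [n])"
      by (auto simp: conf_def reads_def)
    with v show "\<exists>w. u = code (w @ [n]) \<and> w \<in> lists {..<n} \<and> query_word w \<in> Orc"
      by (auto simp: conf_def holds_word_tape_of_word)
  next
    assume "\<exists>w. u = code (w @ [n]) \<and> w \<in> lists {..<n} \<and> query_word w \<in> Orc"
    then obtain w where w: "u = code (w @ [n])" "w \<in> lists {..<n}" "query_word w \<in> Orc"
      by blast
    obtain ph out c where r: "reads (code w @ evens (block w)) w ph out c" "pending ph c (length w) = []"
        "script_run reader (code w @ evens (block w)) (Begin, [blank, blank]) = Some (conf ph out w c)"
      using run_complete [OF w(2)] by blast
    note step = script_step_final [OF r(1,2)]
    have "script_run reader ((code w @ evens (block w)) @ [2 * Suc n + 1]) (Begin, [blank, blank]) =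
        Some (conf Done out w c)"
      using r(3) step(1) unfolding script_run_append [of _ _ "[_]"] by (simp del: script_step.simps)
    then have "script_run reader u (Begin, [blank, blank]) = Some (conf Done (query_word w) w c)"
      unfolding step(2,3) w(1) .
    with w(3) show "script_accepts (Some Orc) reader 2 Begin {Done} u"
      by (auto simp: script_accepts_def blank_tapes_def numeral_2_eq_2 conf_def holds_word_tape_of_word)
  qed
  moreover have "code (w @ [n]) \<in> lists {..<letter_count}" if "w \<in> lists {..<n}" for w
    using that by (intro code_in_lists) auto
  ultimately have "u \<in> lists {..<letter_count} \<and> script_accepts (Some Orc) reader 2 Begin {Done}
        (map ((!) [0..<letter_count]) u) \<longleftrightarrow>
      (\<exists>w. u = code (w @ [n]) \<and> w \<in> lists {..<n} \<and> query_word w \<in> Orc)" for u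
    using map_letters [of u] by (cases "u \<in> lists {..<letter_count}") auto
  then have "{u \<in> lists {..<letter_count}. script_accepts (Some Orc) reader 2 Begin {Done}
        (map ((!) [0..<letter_count]) u)} =
      {code (w @ [n]) | w. w \<in> lists {..<n} \<and> query_word w \<in> Orc}"
    by (simp only:)
  moreover have "Begin \<in> phases" by (simp add: phases_def)
  ultimately show ?thesis
    using re_script_accepts [OF finite_phases _ _ _ wf_reader, of Begin Orc True "{Done}"] by simp
qed

end

section \<open>The subshift\<close>

text \<open>
  The pattern \<open>0 w $\<close> at position \<open>j\<close>, with \<open>n\<close> playing the role of the end marker before the shift by one.
\<close>

definition occurs :: "nat \<Rightarrow> nat list \<Rightarrow> (int \<Rightarrow> nat) \<Rightarrow> int \<Rightarrow> bool" where
  "occurs n w x j \<longleftrightarrow> x j = 0 \<and> (\<forall>i \<le> length w. x (j + 1 + int i) = Suc ((w @ [n]) ! i))"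

text \<open>
  In \<open>\<dots> 0 w $ 0 \<dots>\<close> the only \<open>0\<close> that is followed by a nonzero symbol is the one before \<open>w\<close>, and the
  first symbol \<open>$\<close> after it is the end of \<open>w\<close>.
\<close>

lemma occurs_tape_of_word:
  assumes "w \<in> lists {..<n}" "w' \<in> lists {..<n}"
  shows "occurs n w' (tape_of_word (w @ [n])) j \<longleftrightarrow> w' = w \<and> j = -1"
proof
  let ?x = "tape_of_word (w @ [n])"
  assume occ: "occurs n w' ?x j"
  then have "?x j = 0" "?x (j + 1) \<noteq> 0"
    by (auto simp: occurs_def dest: spec [of _ 0])
  then have j: "j = -1"
    by (auto simp: tape_of_word_def split: if_splits)
  have at: "?x (int i) = Suc ((w' @ [n]) ! i)" if "i \<le> length w'" for i
    using occ that by (simp add: occurs_def j)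
  have le: "length w' \<le> length w"
    using at [of "length w'"] by (auto simp: tape_of_word_def split: if_splits)
  have eq: "(w @ [n]) ! i = (w' @ [n]) ! i" if "i \<le> length w'" for i
    using at [OF that] that le by (auto simp: tape_of_word_def split: if_splits)
  have "length w' = length w"
  proof (rule ccontr)
    assume "length w' \<noteq> length w"
    with le have lt: "length w' < length w" by simp
    then have "w ! length w' = n"
      using eq [of "length w'"] by (simp add: nth_append)
    moreover have "w ! length w' < n"
      using assms(1) nth_mem [OF lt] by auto
    ultimately show False by simp
  qed
  moreover have "w' ! i = w ! i" if "i < length w'" for i
    using eq [of i] that calculation by (simp add: nth_append)
  ultimately have "w' = w" by (intro nth_equalityI) auto
  with j show "w' = w \<and> j = -1" by simp
qed (auto simp: occurs_def tape_of_word_def)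

lemma nth_snoc_le:
  assumes "w \<in> lists {..<n}" "i \<le> length w"
  shows "(w @ [n]) ! i \<le> (n :: nat)"
proof (cases "i < length w")
  case True
  then have "w ! i < n"
    using assms(1) by (simp add: in_lists_conv_set)
  with True show ?thesis
    by (simp add: nth_append)
qed (use assms(2) in simp)

lemma shift_avoiding_iff:
  "y \<in> shift_avoiding K T A C \<longleftrightarrow> y \<in> full_shift K A \<and>
     (\<forall>g \<in> carrier K. \<forall>c \<in> C. \<not> (\<forall>(u, a) \<in> c. y (g \<otimes>\<^bsub>K\<^esub> word_eval K T u) = a))"
  by (cases "y \<in> full_shift K A") (simp_all add: shift_avoiding_def cylinder_def split_beta)

lemma clopen_cylinder:
  assumes "g \<in> carrier K"
  shows "openin (product_topology (\<lambda>_. discrete_topology A) (carrier K)) (cylinder K A a g)"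
    and "closedin (product_topology (\<lambda>_. discrete_topology A) (carrier K)) (cylinder K A a g)"
proof -
  let ?T = "product_topology (\<lambda>_. discrete_topology A) (carrier K)"
  have cont: "continuous_map ?T (discrete_topology A) (\<lambda>x. x g)"
    using assms by (rule continuous_map_product_projection)
  have eq: "cylinder K A a g = {x \<in> topspace ?T. x g \<in> {a} \<inter> A}"
    using assms by (auto simp: cylinder_def full_shift_def topspace_product_topology PiE_iff)
  show "openin ?T (cylinder K A a g)"
    unfolding eq by (rule openin_continuous_map_preimage [OF cont]) simp
  show "closedin ?T (cylinder K A a g)"
    unfolding eq by (rule closedin_continuous_map_preimage [OF cont]) simp
qed

locale relator_shift = group G for G :: "('a, 'b) monoid_scheme" (structure) +
  fixes S :: "'a list"
  assumes S: "generating_list G S"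
begin

abbreviation "K \<equiv> G \<times>\<times> integer_group"

abbreviation "n \<equiv> length S"

definition A :: "nat set" where
  "A = {..Suc n}"

definition avoids :: "(int \<Rightarrow> nat) \<Rightarrow> bool" where
  "avoids x \<longleftrightarrow> (\<forall>w \<in> word_problem G S. \<forall>j. \<not> occurs n w x j)"

definition X :: "('a \<times> int \<Rightarrow> nat) set" where
  "X = {y \<in> full_shift K A. \<forall>g \<in> carrier G. avoids (\<lambda>k. y (g, k))}"

definition X\<^sub>Z :: "(int \<Rightarrow> nat) set" where
  "X\<^sub>Z = {x \<in> full_shift integer_group A. avoids x}"

lemma group_K: "group K"
  by (rule DirProd_group [OF group_axioms group_integer_group])

text \<open>
  For the inclusion from right to left, the given row is repeated on all cosets of \<open>\<int>\<close>.
\<close>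

lemma projection: "Z_projective_subdynamics G A X = X\<^sub>Z"
proof
  show "Z_projective_subdynamics G A X \<subseteq> X\<^sub>Z"
  proof
    fix x assume "x \<in> Z_projective_subdynamics G A X"
    then obtain y where "x \<in> full_shift integer_group A" "y \<in> X" "\<forall>k. x k = y (\<one>, k)"
      by (auto simp: Z_projective_subdynamics_def)
    moreover from this have "x = (\<lambda>k. y (\<one>, k))" by auto
    ultimately show "x \<in> X\<^sub>Z" by (auto simp: X_def X\<^sub>Z_def)
  qed
  show "X\<^sub>Z \<subseteq> Z_projective_subdynamics G A X"
  proof
    fix x assume x: "x \<in> X\<^sub>Z"
    define y where "y = (\<lambda>(g, k) \<in> carrier K. x k)"
    have "(\<lambda>k. y (g, k)) = x" if "g \<in> carrier G" for g
      using that by (auto simp: y_def)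
    with x have "y \<in> X"
      by (auto simp: X_def X\<^sub>Z_def full_shift_def y_def)
    with x show "x \<in> Z_projective_subdynamics G A X"
      by (auto simp: Z_projective_subdynamics_def X\<^sub>Z_def y_def intro!: bexI [of _ y])
  qed
qed

lemma subshift_X: "subshift K A X"
  unfolding subshift_def
proof (intro conjI ballI)
  let ?T = "product_topology (\<lambda>_. discrete_topology A) (carrier K)"
  define bad where "bad g j w = {y \<in> full_shift K A. occurs n w (\<lambda>k. y (g, k)) j}" for g j w
  have full: "full_shift K A = topspace ?T"
    by (simp add: full_shift_def topspace_product_topology)
  have X_eq: "X = full_shift K A \<inter>
      (\<Inter>(g, j, w) \<in> carrier G \<times> UNIV \<times> word_problem G S. full_shift K A - bad g j w)"
    by (auto simp: X_def avoids_def bad_def)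
  have "closedin ?T (full_shift K A - bad g j w)" if g: "g \<in> carrier G" for g j w
  proof -
    have "bad g j w = cylinder K A 0 (g, j) \<inter>
        (\<Inter>i \<in> {..length w}. cylinder K A (Suc ((w @ [n]) ! i)) (g, j + 1 + int i))"
      by (auto simp: bad_def occurs_def cylinder_def)
    also have "openin ?T \<dots>"
      using g by (intro openin_Int openin_INT2 clopen_cylinder) auto
    finally show ?thesis
      unfolding full by (rule closedin_diff [OF closedin_topspace])
  qed
  moreover have "closedin ?T (full_shift K A)"
    unfolding full by (rule closedin_topspace)
  moreover have "[] \<in> word_problem G S" by (simp add: word_problem_def)
  ultimately show "closedin ?T X"
    unfolding X_eq by (intro closedin_Int closedin_INT) (auto simp del: carrier_DirProd)
next
  fix h y assume h: "h \<in> carrier K" and y: "y \<in> X"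
  obtain g k where hgk: "h = (g, k)" "g \<in> carrier G" using h by auto
  have inv_h: "inv\<^bsub>K\<^esub> h = (inv g, -k)"
    using hgk by (simp add: inv_DirProd is_group)
  have shift: "shift K h y (g', j) = y (inv g \<otimes> g', j - k)" if "g' \<in> carrier G" for g' j
    using that by (simp add: shift_def inv_h)
  have "shift K h y \<in> full_shift K A"
    using y hgk by (auto simp: X_def full_shift_def shift_def inv_h PiE_iff)
  moreover have "avoids (\<lambda>j. shift K h y (g', j))" if g': "g' \<in> carrier G" for g'
    unfolding avoids_def
  proof (intro ballI allI notI)
    fix w j assume w: "w \<in> word_problem G S" and occ: "occurs n w (\<lambda>j. shift K h y (g', j)) j"
    have "occurs n w (\<lambda>j. y (inv g \<otimes> g', j)) (j - k)"
      using occ g' by (simp add: occurs_def shift algebra_simps)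
    moreover have "inv g \<otimes> g' \<in> carrier G"
      using g' hgk by simp
    ultimately show False
      using y w by (auto simp: X_def avoids_def)
  qed
  ultimately show "shift K h y \<in> X" by (simp add: X_def)
qed

text \<open>
  The oracle word for \<open>w\<close> has value \<open>(word_eval G S w, 0)\<close>, and the \<open>i\<close>-th block of the coding of \<open>w\<close> has
  value \<open>(\<one>, i + 1)\<close>. So \<open>re_codes\<close> enumerates codings of exactly the forbidden patterns.
\<close>

lemma effectively_closed_X:
  assumes T: "generating_list K T"
  shows "effectively_closed K T A X"
proof -
  interpret K: group K by (rule group_K)
  let ?m = "length T"
  have subT: "set T \<subseteq> carrier K" using T by (simp add: generating_list_def)
  have subS: "set S \<subseteq> carrier G" using S by (simp add: generating_list_def)
  obtain e where word_e: "e < ?m" "T ! e = \<one>\<^bsub>K\<^esub>"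
    using T by (metis generating_list_def in_set_conv_nth)
  define word_of where "word_of x = (SOME v. v \<in> lists {..<?m} \<and> word_eval K T v = x)" for x
  have word_of: "word_of x \<in> lists {..<?m}" "word_eval K T (word_of x) = x" if "x \<in> carrier K" for x
  proof -
    have "\<exists>v. v \<in> lists {..<?m} \<and> word_eval K T v = x"
      by (rule K.word_eval_surj [OF T that]) blast
    from someI_ex [OF this] show "word_of x \<in> lists {..<?m}" "word_eval K T (word_of x) = x"
      by (simp_all add: word_of_def)
  qed
  have Ssub: "S ! s \<in> carrier G" if "s < n" for s using subS that by auto
  define p where "p = word_of (\<one>, 1)"
  define q where "q s = word_of (S ! s, 0)" for s
  define q' where "q' s = word_of (inv (S ! s), 0)" for s
  have word_p: "p \<in> lists {..<?m}" "word_eval K T p = (\<one>, 1)"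
    using word_of [of "(\<one>, 1)"] by (simp_all add: p_def)
  then have "p \<noteq> []" by auto
  have word_q: "q s \<in> lists {..<?m}" "word_eval K T (q s) = (S ! s, 0)" if "s < n" for s
    using word_of [of "(S ! s, 0)"] Ssub [OF that] by (simp_all add: q_def)
  have word_q': "q' s \<in> lists {..<?m}" "word_eval K T (q' s) = (inv (S ! s), 0)" if "s < n" for s
    using word_of [of "(inv (S ! s), 0)"] Ssub [OF that] by (simp_all add: q'_def)
  interpret code_reader n ?m e p q q'
    using word_e word_p word_q word_q' \<open>p \<noteq> []\<close> by unfold_locales auto
  have eval_query: "query_word w \<in> lists {..<?m} \<and> word_eval K T (query_word w) = (word_eval G S w, 0)"
    if "w \<in> lists {..<n}" for w
    using that
  proof (induction w)
    case (Cons s w)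
    then have s: "s < n" by auto
    have "query_word (s # w) = q s @ query_word w" by (simp add: query_word_def)
    then show ?case
      using Cons.IH word_q [OF s] K.word_eval_append [OF subT, of "q s" "query_word w"] by simp
  qed (simp add: query_word_def)
  have eval_echo: "map fst (echo s) \<in> lists {..<?m} \<and> word_eval K T (map fst (echo s)) = \<one>\<^bsub>K\<^esub>"
    if "s < n" for s
  proof -
    have "map fst (echo s) = q s @ q' s @ [e]"
      by (simp add: echo_def o_def)
    then show ?thesis
      using word_q [OF that] word_q' [OF that] word_e subT Ssub [OF that] K.word_eval_append [OF subT]
      by simp
  qed
  have eval_rep: "replicate k e \<in> lists {..<?m} \<and> word_eval K T (replicate k e) = \<one>\<^bsub>K\<^esub>" for k
    by (induction k) (simp_all add: word_e)
  have eval_powers: "powers k \<in> lists {..<?m} \<and> word_eval K T (powers k) = (\<one>, int k)" for k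
  proof (induction k)
    case (Suc k)
    have "powers (Suc k) = p @ powers k" by (simp add: powers_def)
    with Suc show ?case
      using word_p K.word_eval_append [OF subT] by simp
  qed (simp add: powers_def)
  have eval_block: "block w \<in> lists {..<?m} \<and> word_eval K T (block w) = (\<one>, int (Suc (length w)))"
    if "w \<in> lists {..<n}" for w
  proof (cases "w = []")
    case True
    then show ?thesis using eval_powers [of 1] by (simp add: block_def)
  next
    case False
    then have "last w < n" using that last_in_set by auto
    then show ?thesis
      using False eval_echo [of "last w"] eval_powers [of "Suc (length w)"] eval_rep [of "length w"] word_e(1)
        K.word_eval_append [OF subT]
      by (simp add: block_def del: replicate_Suc)
  qed
  have WP_lists: "w \<in> lists {..<n}" if "w \<in> word_problem G S" for w
    using that by (simp add: word_problem_def)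
  define E where "E = {listing (w @ [n]) | w. w \<in> word_problem G S}"
  have query: "w \<in> lists {..<n} \<and> query_word w \<in> word_problem K T \<longleftrightarrow> w \<in> word_problem G S" for w
  proof (cases "w \<in> lists {..<n}")
    case True
    then show ?thesis
      using eval_query [OF True] by (simp add: word_problem_def)
  qed (simp add: word_problem_def)
  have "encode_listing ` E = {code (w @ [n]) | w. w \<in> word_problem G S}"
    unfolding E_def code_def by blast
  then have re: "re_with_oracle (word_problem K T) (encode_listing ` E)"
    using re_codes [of "word_problem K T"] unfolding query by simp
  have listing_eq: "set (listing (w @ [n])) =
      insert ([], 0) ((\<lambda>i. (block (take i w), Suc ((w @ [n]) ! i))) ` {..length w})" for w
  proof -
    have "set (listing (w @ [n])) = insert ([], 0)
        ((\<lambda>i. (block (take i (w @ [n])), Suc ((w @ [n]) ! i))) ` {..length w})"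
      by (simp add: listing_def atLeast0LessThan lessThan_Suc_atMost del: upt_Suc take_append)
    also have "(\<lambda>i. (block (take i (w @ [n])), Suc ((w @ [n]) ! i))) ` {..length w} =
        (\<lambda>i. (block (take i w), Suc ((w @ [n]) ! i))) ` {..length w}"
      by (rule image_cong) simp_all
    finally show ?thesis .
  qed
  have take_lists: "take i w \<in> lists {..<n}" if "w \<in> lists {..<n}" for i w
    using that by (auto dest: in_set_takeD)
  have matches: "(\<forall>(u, a) \<in> set (listing (w @ [n])). y ((g, j) \<otimes>\<^bsub>K\<^esub> word_eval K T u) = a) \<longleftrightarrow>
      occurs n w (\<lambda>k. y (g, k)) j"
    if "w \<in> word_problem G S" "g \<in> carrier G" for w g j y
  proof -
    have "word_eval K T (block (take i w)) = (\<one>, int (Suc i))" if "i \<le> length w" for i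
      using eval_block [OF take_lists [OF WP_lists [OF \<open>w \<in> word_problem G S\<close>]], of i] that
      by (simp add: min_def)
    then show ?thesis
      using that(2) unfolding listing_eq occurs_def by (auto simp: add.assoc)
  qed
  have "X = shift_avoiding K T A (set ` E)"
  proof (rule Set.set_eqI)
    fix y :: "'a \<times> int \<Rightarrow> nat"
    define P where "P h c \<longleftrightarrow> (\<forall>(u, a) \<in> c. y (h \<otimes>\<^bsub>K\<^esub> word_eval K T u) = a)" for h c
    have P_iff: "P (g, j) (set (listing (w @ [n]))) \<longleftrightarrow> occurs n w (\<lambda>k. y (g, k)) j"
      if "w \<in> word_problem G S" "g \<in> carrier G" for w g j
      unfolding P_def by (rule matches [OF that])
    have "y \<in> shift_avoiding K T A (set ` E) \<longleftrightarrow> y \<in> full_shift K A \<and>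
        (\<forall>h \<in> carrier G \<times> UNIV. \<forall>c \<in> set ` E. \<not> P h c)"
      unfolding shift_avoiding_iff P_def by simp
    also have "\<dots> \<longleftrightarrow> y \<in> full_shift K A \<and>
        (\<forall>g \<in> carrier G. \<forall>j. \<forall>w \<in> word_problem G S. \<not> P (g, j) (set (listing (w @ [n]))))"
      unfolding E_def by blast
    also have "\<dots> \<longleftrightarrow> y \<in> X"
      using P_iff by (auto simp: X_def avoids_def)
    finally show "y \<in> X \<longleftrightarrow> y \<in> shift_avoiding K T A (set ` E)" ..
  qed
  moreover have "set ` E \<subseteq> pattern_codings T A"
  proof -
    have "set (listing (w @ [n])) \<in> pattern_codings T A" if w: "w \<in> word_problem G S" for w
    proof -
      have "block (take i w) \<in> lists {..<?m}" for i
        using eval_block [OF take_lists [OF WP_lists [OF w]]] by blast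
      moreover have "Suc ((w @ [n]) ! i) \<in> A" if "i \<le> length w" for i
        using nth_snoc_le [OF WP_lists [OF w] that] by (simp add: A_def)
      moreover have "[] \<in> lists {..<?m}" "0 \<in> A"
        by (simp_all add: A_def)
      ultimately show ?thesis
        unfolding listing_eq pattern_codings_def by blast
    qed
    then show ?thesis by (auto simp: E_def)
  qed
  ultimately show ?thesis
    unfolding effectively_closed_def re_codings_with_oracle_def using re by blast
qed

text \<open>
  An enumeration of codings that define the \<open>\<int>\<close>-subshift makes membership in the word problem of \<open>G\<close>
  certifiable: \<open>w\<close> represents \<open>\<one>\<close> iff some enumerated listing matches the configuration
  \<open>tape_of_word (w @ [n])\<close>. The accepted scripts then form a recursively enumerable set of relators
  for \<open>G\<close>.
\<close>

lemma not_effectively_closed_X\<^sub>Z: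
  assumes U: "generating_list integer_group U" and not_rp: "\<not> recursively_presented G"
  shows "\<not> effectively_closed integer_group U A X\<^sub>Z"
proof
  assume "effectively_closed integer_group U A X\<^sub>Z"
  then obtain C E M where C: "C \<subseteq> pattern_codings U A" "C = set ` E"
      and XZ: "X\<^sub>Z = shift_avoiding integer_group U A C" and "wf_otm M"
      and M: "encode_listing ` E =
        {u \<in> lists {..<n_letters M}. otm_halts (word_problem integer_group U) M u}"
    unfolding effectively_closed_def re_codings_with_oracle_def re_with_oracle_def by blast
  interpret verification M U n by unfold_locales (rule \<open>wf_otm M\<close>)
  have full: "xtape w \<in> full_shift integer_group A" if "w \<in> lists {..<n}" for w
  proof -
    have "xtape w k \<in> A" for k
      using nth_snoc_le [OF that, of "nat k"]
      by (auto simp: tape_of_word_def A_def nat_le_iff)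
    then show ?thesis
      by (simp add: full_shift_def PiE_iff)
  qed
  have in_XZ: "xtape w \<in> X\<^sub>Z \<longleftrightarrow> w \<notin> word_problem G S" if "w \<in> lists {..<n}" for w
    using full [OF that] occurs_tape_of_word [OF that]
    by (auto simp: X\<^sub>Z_def avoids_def word_problem_def)
  have forbidden: "w \<in> word_problem G S \<longleftrightarrow>
      (\<exists>l g. listed w g l \<and> otm_halts Orc M (encode_listing l))" if w: "w \<in> lists {..<n}" for w
  proof -
    have "w \<in> word_problem G S \<longleftrightarrow>
        (\<exists>g. \<exists>l \<in> E. \<forall>(u, a) \<in> set l. xtape w (g + zeval U u) = a)"
      using in_XZ [OF w] full [OF w] unfolding XZ C(2) shift_avoiding_iff by fastforce
    also have "\<dots> \<longleftrightarrow> (\<exists>l g. listed w g l \<and> otm_halts Orc M (encode_listing l))"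
    proof -
      have certified: "l \<in> E \<and> (\<forall>(u, a) \<in> set l. xtape w (g + zeval U u) = a) \<longleftrightarrow>
          listed w g l \<and> otm_halts Orc M (encode_listing l)" for l g
      proof
        assume l: "l \<in> E \<and> (\<forall>(u, a) \<in> set l. xtape w (g + zeval U u) = a)"
        then have "set l \<in> pattern_codings U A" using C by blast
        then have "u \<in> lists {..<length U}" if "(u, a) \<in> set l" for u a
          using that by (auto simp: pattern_codings_def)
        with l have "\<forall>(u, a) \<in> set l. u \<in> lists {..<length U} \<and> xtape w (g + zeval U u) = a"
          by fast
        moreover have "encode_listing l \<in> encode_listing ` E" using l by blast
        then have "encode_listing l \<in> lists {..<n_letters M}" "otm_halts Orc M (encode_listing l)"
          unfolding M by blast+
        ultimately show "listed w g l \<and> otm_halts Orc M (encode_listing l)"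
          using w unfolding listed_def by (intro conjI)
      next
        assume l: "listed w g l \<and> otm_halts Orc M (encode_listing l)"
        then have "encode_listing l \<in> lists {..<n_letters M}"
          by (simp add: listed_def)
        with l have "encode_listing l \<in> encode_listing ` E"
          unfolding M by blast
        then have "l \<in> E"
          using encode_listing_inject by (metis imageE)
        moreover have "\<forall>(u, a) \<in> set l. xtape w (g + zeval U u) = a"
          using l by (auto simp: listed_def)
        ultimately show "l \<in> E \<and> (\<forall>(u, a) \<in> set l. xtape w (g + zeval U u) = a)" ..
      qed
      show ?thesis
        unfolding certified [symmetric] by blast
    qed
    finally show ?thesis .
  qed
  have "G \<cong> presented_group (length letters) scripts"
  proof (rule presentation_by_certified_relators [OF S _ n_le_letters])
    show "scripts \<subseteq> lists {..<length letters}"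
      unfolding scripts_def by blast
    show "word_eval G S (filter (\<lambda>i. i < n) u) = \<one>" if "u \<in> scripts" for u
    proof (cases "filter (\<lambda>i. i < n) u = []")
      case False
      moreover have "filter (\<lambda>i. i < n) u \<in> lists {..<n}" by auto
      ultimately show ?thesis
        using scripts_sound [OF that] forbidden by (simp add: word_problem_def)
    qed simp
    show "[i] \<in> scripts" if "n \<le> i" "i < length letters" for i
      using that by (rule scripts_trivial)
    show "\<exists>v. v \<in> lists {n..<length letters} \<and> w @ v \<in> scripts"
      if "w \<in> word_problem G S" "w \<noteq> []" for w
    proof -
      have "w \<in> lists {..<n}" using that(1) by (simp add: word_problem_def)
      with forbidden that(1) obtain l g where "listed w g l" "otm_halts Orc M (encode_listing l)"
        by blast
      from scripts_complete [OF this(1) that(2) this(2)] show ?thesis by blast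
    qed
  qed
  moreover have "scripts \<subseteq> lists {..<length letters}"
    unfolding scripts_def by blast
  ultimately have "recursively_presented G"
    unfolding recursively_presented_def using recursively_enumerable_scripts by blast
  with not_rp show False ..
qed

end

theorem proposition2p13:
  fixes G :: "('a, 'b) monoid_scheme"
  assumes "group G"
    and "finitely_generated G"
    and "\<not> recursively_presented G"
  shows "\<exists>(A :: nat set) X.
           finite A \<and>
           subshift (G \<times>\<times> integer_group) A X \<and>
           (\<forall>T. generating_list (G \<times>\<times> integer_group) T \<longrightarrow>
                effectively_closed (G \<times>\<times> integer_group) T A X) \<and>
           (\<forall>U. generating_list integer_group U \<longrightarrow>
                \<not> effectively_closed integer_group U A (Z_projective_subdynamics G A X))"
proof -
  obtain S where S: "generating_list G S"
    using group.finitely_generated_imp_generating_list [OF assms(1,2)] .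
  interpret relator_shift G S
    using assms(1) S by (simp add: relator_shift_def relator_shift_axioms_def)
  have "finite A" by (simp add: A_def)
  moreover have "\<not> effectively_closed integer_group U A (Z_projective_subdynamics G A X)"
    if "generating_list integer_group U" for U
    unfolding projection using that assms(3) by (rule not_effectively_closed_X\<^sub>Z)
  ultimately show ?thesis
    using subshift_X effectively_closed_X by blast
qed

end
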